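(* Let $\kappa_0,\nu_0>0$, $\mu_0\in\mathbb{R}^d$ and let $\Sigma_0$ be a positive definite symmetric $d\times d$ matrix. Consider the Normal Bayesian Mixture Model (see context) in which the component distribution with parameter $\theta=(\mu,\Lambda)$ is $\mathcal{N}(\mu,\Lambda)$ on $\mathbb{R}^d$ and the prior on the component parameters is Normal-inverse-Wishart: $$\Lambda\sim\mathcal{W}^{-1}(\nu_0+d+1,\nu_0\Sigma_0),\qquad \mu\mid\Lambda\sim\mathcal{N}(\mu_0,\Lambda/\kappa_0).$$ Let $x_1,\ldots,x_n\in\mathbb{R}^d$ be pairwise distinct and let $\hat{\mathcal{I}}$ be a MAP partition of $(x_1,\ldots,x_n)$ in this model. Then the family $\{\{x_i:i\in I\}:I\in\hat{\mathcal{I}}\}$ is quadratically separable, i.e. every two clusters are separated by a quadratic surface: for every two distinct $I,J\in\hat{\mathcal{I}}$ there is a real polynomial $L$ on $\mathbb{R}^d$ of degree at most $2$ with $L(x_i)\ge0$ for all $i\in I$ and $L(x_j)<0$ for all $j\in J$.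
   Context: Notation: $[n]=\{1,\ldots,n\}$; for $\mathbf{x}=(x_1,\ldots,x_n)$ and $I\subseteq[n]$, $\mathbf{x}_I=(x_i)_{i\in I}$. Bayesian Mixture Model. Let $\Theta$ be the parameter space, $\{g_\theta:\theta\in\Theta\}$ a family of probability densities on $\mathbb{R}^d$, $\pi$ a prior probability density on $\Theta$, $m\in\mathbb{N}\cup\{\infty\}$, and $\mathcal{P}$ a probability distribution on the simplex $\Delta^m=\{(p_i)_{i=1}^m: p_i\ge0,\ \sum_i p_i=1\}$. The model is: $(p_i)_{i=1}^m\sim\mathcal{P}$; independently $\theta_1,\theta_2,\ldots$ i.i.d. from $\pi$; given these, $\phi_1,\ldots,\phi_n$ are i.i.d. from $\sum_{i=1}^m p_i\delta_{\theta_i}$; and, given everything, $x_i\sim g_{\phi_i}$ independently. The clusters are the equivalence classes of the relation $i\sim j\iff\phi_i=\phi_j$ on $[n]$. This gives a random partition of $[n]$; $p_n(\mathcal{I})$ denotes the probability that it equals the partition $\mathcal{I}$. It is exchangeable: $p_n(\mathcal{I})=p_n(\{\sigma(I):I\in\mathcal{I}\})$ for all permutations $\sigma$ of $[n]$. For $k\in\mathbb{N}$ put $$f_k(u_1,\ldots,u_k)=\int_\Theta\pi(\theta)\prod_{i=1}^k g_\theta(u_i)\,d\theta,\qquad f(\mathbf{x}\mid\mathcal{I})=\prod_{I\in\mathcal{I}}f_{|I|}(\mathbf{x}_I).$$ A partition $\hat{\mathcal{I}}$ of $[n]$ is a MAP partition of $\mathbf{x}$ if $p_n(\mathcal{I})f(\mathbf{x}\mid\mathcal{I})\le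 p_n(\hat{\mathcal{I}})f(\mathbf{x}\mid\hat{\mathcal{I}})$ for every partition $\mathcal{I}$ of $[n]$. Here $\Theta=\mathbb{R}^d\times\mathcal{S}^d_+$, where $\mathcal{S}^d_+$ is the set of positive definite symmetric $d\times d$ matrices (an open subset of the Euclidean space of symmetric matrices). $\mathcal{W}^{-1}(\nu,\Psi)$ is the inverse-Wishart distribution, with density on $\mathcal{S}^d_+$ proportional to $|\Lambda|^{-(\nu+d+1)/2}\exp\{-\frac12\mathrm{tr}(\Psi\Lambda^{-1})\}$, where $|\Lambda|$ is the determinant. *)

theory Defs
  imports "HOL-Probability.Probability"
begin

section \<open>Bayesian mixture models\<close>

text \<open>
  The mixture weights are sequences \<open>p :: nat \<Rightarrow> real\<close>, indexed from 0. For finite \<open>m\<close> a point of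
  \<open>\<Delta>\<^sup>m\<close> is extended by zeros.
\<close>

definition weight_simplex :: "enat \<Rightarrow> (nat \<Rightarrow> real) set" where
  "weight_simplex m = {p. (\<forall>i. p i \<ge> 0) \<and> (\<forall>i. m \<le> enat i \<longrightarrow> p i = 0) \<and> p sums 1}"

definition weight_space :: "enat \<Rightarrow> (nat \<Rightarrow> real) measure" where
  "weight_space m = restrict_space (Pi\<^sub>M UNIV (\<lambda>_. borel)) (weight_simplex m)"

text \<open>The discrete measure \<open>\<Sum>\<^sub>i p\<^sub>i \<delta>\<^bsub>\<theta>\<^sub>i\<^esub>\<close> on the measurable space of \<open>T\<close>.\<close>

definition mixing_measure :: "'t measure \<Rightarrow> (nat \<Rightarrow> real) \<Rightarrow> (nat \<Rightarrow> 't) \<Rightarrow> 't measure" where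
  "mixing_measure T p \<theta> = distr (point_measure UNIV (\<lambda>i. ennreal (p i))) T \<theta>"

text \<open>
  The parameter space is a measure \<open>T\<close> whose \<open>space\<close> is the set of parameters and which plays the
  role of \<open>d\<theta>\<close>; the prior is given by its density \<open>\<pi>\<close> with respect to \<open>T\<close>. The following is
  the joint law of the latent parameters \<open>\<phi>\<^sub>1, \<dots>, \<phi>\<^sub>n\<close>, as a function on \<open>{1..n}\<close>.
\<close>

definition latent_law ::
  "'t measure \<Rightarrow> ('t \<Rightarrow> real) \<Rightarrow> (nat \<Rightarrow> real) measure \<Rightarrow> nat \<Rightarrow> (nat \<Rightarrow> 't) measure" where
  "latent_law T \<pi> P n =
     P \<bind> (\<lambda>p. Pi\<^sub>M UNIV (\<lambda>_::nat. density T (\<lambda>\<theta>. ennreal (\<pi> \<theta>)))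
       \<bind> (\<lambda>\<theta>. Pi\<^sub>M {1..n} (\<lambda>_. mixing_measure T p \<theta>)))"

definition cluster_partition :: "nat \<Rightarrow> (nat \<Rightarrow> 't) \<Rightarrow> nat set set" where
  "cluster_partition n \<phi> = {1..n} // {(i, j). i \<in> {1..n} \<and> j \<in> {1..n} \<and> \<phi> i = \<phi> j}"

definition partition_prob ::
  "'t measure \<Rightarrow> ('t \<Rightarrow> real) \<Rightarrow> (nat \<Rightarrow> real) measure \<Rightarrow> nat \<Rightarrow> nat set set \<Rightarrow> real" where
  "partition_prob T \<pi> P n \<I> =
     measure (latent_law T \<pi> P n) {\<phi> \<in> space (latent_law T \<pi> P n). cluster_partition n \<phi> = \<I>}"

text \<open>
  \<open>cluster_likelihood T \<pi> g x I\<close> is \<open>f\<^sub>k(x\<^sub>I)\<close> with \<open>k = |I|\<close>. As \<open>f\<^sub>k\<close> is symmetric in its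
  arguments, it may be evaluated at the family \<open>(x\<^sub>i)\<^bsub>i \<in> I\<^esub>\<close> without enumerating \<open>I\<close>.
\<close>

definition cluster_likelihood ::
  "'t measure \<Rightarrow> ('t \<Rightarrow> real) \<Rightarrow> ('t \<Rightarrow> 'x \<Rightarrow> real) \<Rightarrow> (nat \<Rightarrow> 'x) \<Rightarrow> nat set \<Rightarrow> real" where
  "cluster_likelihood T \<pi> g x I = (\<integral>\<theta>. \<pi> \<theta> * (\<Prod>i\<in>I. g \<theta> (x i)) \<partial>T)"

definition partition_likelihood ::
  "'t measure \<Rightarrow> ('t \<Rightarrow> real) \<Rightarrow> ('t \<Rightarrow> 'x \<Rightarrow> real) \<Rightarrow> (nat \<Rightarrow> 'x) \<Rightarrow> nat set set \<Rightarrow> real" where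
  "partition_likelihood T \<pi> g x \<I> = (\<Prod>I\<in>\<I>. cluster_likelihood T \<pi> g x I)"

definition MAP_partition ::
  "'t measure \<Rightarrow> ('t \<Rightarrow> real) \<Rightarrow> ('t \<Rightarrow> 'x \<Rightarrow> real) \<Rightarrow> (nat \<Rightarrow> real) measure \<Rightarrow> nat \<Rightarrow>
   (nat \<Rightarrow> 'x) \<Rightarrow> nat set set \<Rightarrow> bool" where
  "MAP_partition T \<pi> g P n x \<I>\<^sub>0 \<longleftrightarrow>
     partition_on {1..n} \<I>\<^sub>0 \<and>
     (\<forall>\<I>. partition_on {1..n} \<I> \<longrightarrow>
        partition_prob T \<pi> P n \<I> * partition_likelihood T \<pi> g x \<I>
          \<le> partition_prob T \<pi> P n \<I>\<^sub>0 * partition_likelihood T \<pi> g x \<I>\<^sub>0)"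


section \<open>The Normal model with Normal-inverse-Wishart prior\<close>

definition pos_def :: "real^'d^'d \<Rightarrow> bool" where
  "pos_def A \<longleftrightarrow> transpose A = A \<and> (\<forall>v. v \<noteq> 0 \<longrightarrow> v \<bullet> (A *v v) > 0)"

text \<open>
  Lebesgue measure on the space of symmetric matrices, which is a null set of \<^term>\<open>lborel\<close> on
  \<^typ>\<open>real^'d^'d\<close>. The coordinates are the entries with \<open>i \<le> j\<close>; since \<^typ>\<open>'d\<close> carries no order,
  they are indexed by the unordered pairs \<open>{i, j}\<close>, with \<open>{i, i} = {i}\<close> for the diagonal. This
  differs from the measure of the Euclidean structure on the symmetric matrices by a constant
  factor, which cancels because densities are normalised with respect to the same measure.
\<close>

definition lborel_sym :: "(real^'d^'d) measure" where
  "lborel_sym =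
     distr (Pi\<^sub>M {{i, j} | i j. True} (\<lambda>_. lborel)) borel (\<lambda>z. \<chi> (i::'d) (j::'d). z {i, j})"

definition lborel_pos_def :: "(real^'d^'d) measure" where
  "lborel_pos_def = restrict_space lborel_sym {\<Lambda>. pos_def \<Lambda>}"

definition mvn_density :: "real^'d \<Rightarrow> real^'d^'d \<Rightarrow> real^'d \<Rightarrow> real" where
  "mvn_density \<mu> \<Lambda> x =
     exp (- ((x - \<mu>) \<bullet> (matrix_inv \<Lambda> *v (x - \<mu>))) / 2) / sqrt ((2 * pi) ^ CARD('d) * det \<Lambda>)"

definition inv_wishart_kernel :: "real \<Rightarrow> real^'d^'d \<Rightarrow> real^'d^'d \<Rightarrow> real" where
  "inv_wishart_kernel \<nu> \<Psi> \<Lambda> =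
     det \<Lambda> powr (- (\<nu> + real CARD('d) + 1) / 2) * exp (- trace (\<Psi> ** matrix_inv \<Lambda>) / 2)"

definition inv_wishart_density :: "real \<Rightarrow> real^'d^'d \<Rightarrow> real^'d^'d \<Rightarrow> real" where
  "inv_wishart_density \<nu> \<Psi> \<Lambda> =
     inv_wishart_kernel \<nu> \<Psi> \<Lambda> / (\<integral>\<Lambda>'. inv_wishart_kernel \<nu> \<Psi> \<Lambda>' \<partial>lborel_pos_def)"

definition niw_space :: "((real^'d) \<times> (real^'d^'d)) measure" where
  "niw_space = lborel \<Otimes>\<^sub>M lborel_pos_def"

definition niw_density ::
  "real \<Rightarrow> real \<Rightarrow> real^'d \<Rightarrow> real^'d^'d \<Rightarrow> (real^'d) \<times> (real^'d^'d) \<Rightarrow> real" where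
  "niw_density \<kappa>\<^sub>0 \<nu>\<^sub>0 \<mu>\<^sub>0 \<Sigma>\<^sub>0 = (\<lambda>(\<mu>, \<Lambda>).
     inv_wishart_density (\<nu>\<^sub>0 + real CARD('d) + 1) (\<nu>\<^sub>0 *\<^sub>R \<Sigma>\<^sub>0) \<Lambda>
       * mvn_density \<mu>\<^sub>0 ((1 / \<kappa>\<^sub>0) *\<^sub>R \<Lambda>) \<mu>)"

definition normal_component :: "(real^'d) \<times> (real^'d^'d) \<Rightarrow> real^'d \<Rightarrow> real" where
  "normal_component = (\<lambda>(\<mu>, \<Lambda>). mvn_density \<mu> \<Lambda>)"


section \<open>Quadratic separability\<close>

text \<open>A monomial is given by its exponents \<open>\<alpha> :: 'd \<Rightarrow> nat\<close>.\<close>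

definition polynomial_of_degree_le :: "nat \<Rightarrow> (real^'d \<Rightarrow> real) \<Rightarrow> bool" where
  "polynomial_of_degree_le k L \<longleftrightarrow>
     (\<exists>c. \<forall>v. L v = (\<Sum>\<alpha> | (\<Sum>i\<in>UNIV. \<alpha> i) \<le> k. c \<alpha> * (\<Prod>i\<in>UNIV. (v $ i) ^ \<alpha> i)))"

definition quadratically_separable :: "(real^'d) set set \<Rightarrow> bool" where
  "quadratically_separable \<C> \<longleftrightarrow>
     (\<forall>A\<in>\<C>. \<forall>B\<in>\<C>. A \<noteq> B \<longrightarrow>
        (\<exists>L. polynomial_of_degree_le 2 L \<and> (\<forall>a\<in>A. L a \<ge> 0) \<and> (\<forall>b\<in>B. L b < 0)))"

end

theory Submission
  imports Defs
begin

text \<open>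
  The theorem rests on a convexity argument. Fix two clusters \<open>I\<close> and \<open>J\<close> of a MAP partition. With
  \<open>\<theta> = (\<mu>, \<Lambda>)\<close> and \<open>Y = \<Lambda>\<^sup>-\<^sup>1\<close>, the log-likelihood of an observation \<open>v\<close> is, up to a term that
  depends on \<open>\<theta>\<close> only, \<open>q\<^sub>\<theta>(v) = Y\<mu> \<bullet> v - (v \<bullet> Yv) / 2\<close>, a quadratic polynomial in \<open>v\<close>
  (\<open>log_likelihood_kernel\<close>). Exchanging \<open>i \<in> I\<close> with \<open>j \<in> J\<close> keeps all cluster sizes, so by
  exchangeability it keeps the prior probability of the partition
  (\<open>partition_prob_exchangeable\<close>), and maximality gives \<open>F(I') F(J') \<le> F(I) F(J)\<close> for the cluster
  likelihoods \<open>F\<close> (\<open>MAP_cluster_exchange\<close>). On the other hand, \<open>F(I')\<close> is the integral of the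
  integrand of \<open>F(I)\<close> times \<open>exp (q\<^sub>\<theta>(x\<^sub>j) - q\<^sub>\<theta>(x\<^sub>i))\<close>. Writing \<open>E\<^sub>I\<close> for the mean under the posterior of
  the cluster \<open>I\<close>, Jensen's inequality gives \<open>F(I') > F(I) exp (E\<^sub>I q(x\<^sub>j) - E\<^sub>I q(x\<^sub>i))\<close>, strictly because
  for \<open>x\<^sub>i \<noteq> x\<^sub>j\<close> the exponent is not almost surely constant
  (\<open>cluster_likelihood_exchange_strict\<close>), and likewise \<open>F(J') \<ge> F(J) exp (E\<^sub>J q(x\<^sub>i) - E\<^sub>J q(x\<^sub>j))\<close>.
  Multiplying, the function \<open>E\<^sub>I q - E\<^sub>J q\<close> takes a strictly smaller value at \<open>x\<^sub>j\<close> than at \<open>x\<^sub>i\<close>, for all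
  \<open>i \<in> I\<close> and \<open>j \<in> J\<close>. It is a quadratic polynomial, and subtracting its minimum over \<open>I\<close> gives the
  separating polynomial (\<open>MAP_clusters_separated\<close>).

  The argument divides by \<open>F(I)\<close>, \<open>F(J)\<close> and by the probability of the MAP partition, and it takes
  posterior means of the entries of \<open>Y\<close> and of \<open>Y\<mu>\<close>. So the prior must be a genuine
  probability measure and these integrals must converge. Everything is reduced to the finiteness of
  \<open>\<integral> |\<Lambda>|\<^sup>-\<^sup>\<alpha> exp (- c tr(\<Lambda>\<^sup>-\<^sup>1)) d\<Lambda>\<close> over the positive definite \<open>d \<times> d\<close> matrices for \<open>\<alpha> > d\<close> and
  \<open>c > 0\<close> (\<open>nn_integral_wishart_bound_finite\<close>). That is an induction on the dimension: a matrix that is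
  bordered by a row \<open>b\<close> and a diagonal entry \<open>a\<close> has the pivot \<open>s = a - b \<bullet> N\<^sup>-\<^sup>1b\<close>, where \<open>N\<close> is the
  smaller matrix; the integral over \<open>b\<close> is Gaussian and costs one power of \<open>|N|\<close>, and the integral
  over \<open>s\<close> is one-dimensional. Any extra factor of the posterior integrands, such as powers of
  \<open>|\<Lambda>|\<^sup>-\<^sup>1\<close> or of \<open>tr(\<Lambda>\<^sup>-\<^sup>1)\<close>, is absorbed by part of the exponential.
\<close>

section \<open>The random partition of the mixture model\<close>

lemma cluster_partition_eq_image:
  "cluster_partition n \<phi> = (\<lambda>i. {j\<in>{1..n}. \<phi> i = \<phi> j}) ` {1..n}"
  by (auto simp: cluster_partition_def quotient_def)

lemma partition_on_cluster_partition: "partition_on {1..n} (cluster_partition n \<phi>)"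
  unfolding cluster_partition_def
  by (rule partition_on_quotient) (auto simp: equiv_def refl_on_def sym_def trans_def)

text \<open>
  Relabelling the coordinates of \<open>\<phi>\<close> by \<open>\<sigma>\<close> relabels its clusters by the inverse permutation; the
  statement is turned around so that it describes the preimage of an event under the relabelling.
\<close>

lemma cluster_partition_permute:
  assumes "\<sigma> permutes {1..n}"
  shows "cluster_partition n (\<lambda>k\<in>{1..n}. \<phi> (\<sigma> k)) = \<I> \<longleftrightarrow>
         cluster_partition n \<phi> = (`) \<sigma> ` \<I>"
proof -
  have image_eq: "cluster_partition n \<phi> = (`) \<sigma> ` cluster_partition n (\<lambda>k\<in>{1..n}. \<phi> (\<sigma> k))"
  proof -
    have N: "\<sigma> ` {1..n} = {1..n}"
      by (rule permutes_image[OF assms])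
    have "{j \<in> {1..n}. \<phi> (\<sigma> i) = \<phi> j} =
        \<sigma> ` {j \<in> {1..n}. (\<lambda>k\<in>{1..n}. \<phi> (\<sigma> k)) i = (\<lambda>k\<in>{1..n}. \<phi> (\<sigma> k)) j}"
      if "i \<in> {1..n}" for i
    proof -
      have "{j \<in> \<sigma> ` {1..n}. \<phi> (\<sigma> i) = \<phi> j} = \<sigma> ` {j \<in> {1..n}. \<phi> (\<sigma> i) = \<phi> (\<sigma> j)}"
        by blast
      then show ?thesis
        using that unfolding N by (simp cong: conj_cong)
    qed
    then have "(\<lambda>i. {j \<in> {1..n}. \<phi> i = \<phi> j}) ` \<sigma> ` {1..n} =
        (`) \<sigma> ` cluster_partition n (\<lambda>k\<in>{1..n}. \<phi> (\<sigma> k))"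
      unfolding cluster_partition_eq_image image_image by (rule image_cong[OF refl])
    then show ?thesis
      unfolding N cluster_partition_eq_image[of n \<phi>] .
  qed
  have "inj ((`) ((`) \<sigma>))"
    using permutes_inj[OF assms] by (simp add: inj_image_eq_iff inj_def)
  then show ?thesis
    by (subst image_eq) (simp add: inj_eq)
qed

lemma emeasure_mixing_measure:
  assumes "\<theta> \<in> UNIV \<rightarrow> space T" "A \<in> sets T"
  shows "emeasure (mixing_measure T p \<theta>) A = (\<Sum>i. ennreal (p i) * indicator A (\<theta> i))"
proof -
  have "\<theta> \<in> measurable (point_measure UNIV (\<lambda>i. ennreal (p i))) T"
    using assms(1) by simp
  then have "emeasure (mixing_measure T p \<theta>) A =
      emeasure (point_measure UNIV (\<lambda>i. ennreal (p i))) (\<theta> -` A)"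
    using assms(2) by (simp add: mixing_measure_def emeasure_distr space_point_measure)
  also have "\<dots> = (\<integral>\<^sup>+i. ennreal (p i) * indicator A (\<theta> i) \<partial>count_space UNIV)"
    by (simp add: point_measure_def emeasure_density indicator_vimage[symmetric])
  finally show ?thesis
    by (simp add: nn_integral_count_space_nat)
qed

lemma prob_space_mixing_measure:
  assumes "p \<in> weight_simplex m" "\<theta> \<in> UNIV \<rightarrow> space T"
  shows "prob_space (mixing_measure T p \<theta>)"
proof
  have p: "p i \<ge> 0" "p sums 1" for i
    using assms(1) by (auto simp: weight_simplex_def)
  have "emeasure (mixing_measure T p \<theta>) (space T) = (\<Sum>i. ennreal (p i))"
    using assms(2) by (subst emeasure_mixing_measure) (auto intro!: suminf_cong simp: Pi_iff)
  also have "\<dots> = 1"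
    using p by (simp add: suminf_ennreal2 sums_iff)
  finally show "emeasure (mixing_measure T p \<theta>) (space (mixing_measure T p \<theta>)) = 1"
    by (simp add: mixing_measure_def)
qed

lemma sets_mixing_measure [simp, measurable_cong]: "sets (mixing_measure T p \<theta>) = sets T"
  by (simp add: mixing_measure_def)

text \<open>
  Joint measurability in the weights and the atoms, without which the nested \<open>\<bind>\<close> in the latent law
  would carry no information. It suffices to test on boxes, where the measure is a finite product of
  series in the weights and the indicators of the atoms.
\<close>

lemma measurable_mixing_kernel:
  assumes Q: "sets Q = sets T"
  shows "(\<lambda>(p, \<theta>). Pi\<^sub>M {1..n::nat} (\<lambda>_. mixing_measure T p \<theta>))
      \<in> weight_space m \<Otimes>\<^sub>M Pi\<^sub>M (UNIV :: nat set) (\<lambda>_. Q) \<rightarrow>\<^sub>M prob_algebra (Pi\<^sub>M {1..n} (\<lambda>_. T))"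
proof (rule measurable_prob_algebra_generated[OF sets_PiM Int_stable_prod_algebra
        prod_algebra_sets_into_space], goal_cases)
  case (1 a)
  then have "snd a \<in> UNIV \<rightarrow> space T" "fst a \<in> weight_simplex m"
    using sets_eq_imp_space_eq[OF Q]
    by (auto simp: space_pair_measure space_PiM weight_space_def space_restrict_space)
  then show ?case
    by (auto simp: case_prod_beta intro!: prob_space_PiM prob_space_mixing_measure[where m=m])
next
  case (2 a)
  show ?case by (auto simp: case_prod_beta intro!: sets_PiM_cong)
next
  case (3 A)
  then obtain X where X: "A = Pi\<^sub>E {1..n} X" "X \<in> {1..n} \<rightarrow> sets T"
    by (auto simp: prod_algebra_eq_finite)
  have "emeasure (case a of (p, \<theta>) \<Rightarrow> Pi\<^sub>M {1..n} (\<lambda>_. mixing_measure T p \<theta>)) A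
      = (\<Prod>j\<in>{1..n}. \<Sum>i. ennreal (fst a i) * indicator (X j) (snd a i))"
    if "a \<in> space (weight_space m \<Otimes>\<^sub>M Pi\<^sub>M UNIV (\<lambda>_. Q))" for a
  proof -
    have a: "snd a \<in> UNIV \<rightarrow> space T" "fst a \<in> weight_simplex m"
      using sets_eq_imp_space_eq[OF Q] that
      by (auto simp: space_pair_measure space_PiM weight_space_def space_restrict_space)
    interpret M: prob_space "mixing_measure T (fst a) (snd a)"
      using a by (intro prob_space_mixing_measure)
    interpret product_sigma_finite "\<lambda>_::nat. mixing_measure T (fst a) (snd a)"
      by standard
    show ?thesis
      using X a by (auto simp: case_prod_beta emeasure_PiM emeasure_mixing_measure Pi_iff
          intro!: prod.cong)
  qed
  moreover have "(\<lambda>a. \<Prod>j\<in>{1..n}. \<Sum>i. ennreal (fst a i) * indicator (X j) (snd a i))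
      \<in> borel_measurable (weight_space m \<Otimes>\<^sub>M Pi\<^sub>M UNIV (\<lambda>_. Q))"
  proof -
    have [measurable]: "(\<lambda>p. p i) \<in> borel_measurable (weight_space m)" for i
      unfolding weight_space_def by (intro measurable_restrict_space1) simp
    have [measurable]: "X j \<in> sets Q" if "j \<in> {1..n}" for j
      using that X Q by auto
    show ?thesis
      by (intro borel_measurable_prod_ennreal) measurable
  qed
  ultimately show ?case
    by (subst measurable_cong) auto
qed

context
  fixes T :: "'t::{second_countable_topology, t2_space} measure"
    and \<pi> :: "'t \<Rightarrow> real" and P :: "(nat \<Rightarrow> real) measure" and m :: enat and n :: nat
  assumes T: "(\<lambda>t. t) \<in> T \<rightarrow>\<^sub>M borel"
    and prior: "prob_space (density T (\<lambda>\<theta>. ennreal (\<pi> \<theta>)))"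
    and P: "P \<in> space (prob_algebra (weight_space m))"
begin

abbreviation (input) "prior_law \<equiv> density T (\<lambda>\<theta>. ennreal (\<pi> \<theta>))"

lemma prior_product_in_prob_algebra:
  "Pi\<^sub>M UNIV (\<lambda>_::nat. prior_law) \<in> space (prob_algebra (Pi\<^sub>M UNIV (\<lambda>_. prior_law)))"
  using prior by (auto simp: space_prob_algebra intro!: prob_space_PiM)

lemma measurable_latent_kernel:
  "(\<lambda>p. Pi\<^sub>M UNIV (\<lambda>_::nat. prior_law) \<bind> (\<lambda>\<theta>. Pi\<^sub>M {1..n} (\<lambda>_. mixing_measure T p \<theta>)))
     \<in> weight_space m \<rightarrow>\<^sub>M prob_algebra (Pi\<^sub>M {1..n} (\<lambda>_. T))"
  by (rule measurable_bind_prob_space2[where N="Pi\<^sub>M UNIV (\<lambda>_. prior_law)"])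
     (use prior_product_in_prob_algebra measurable_mixing_kernel[of prior_law T n m] in auto)

lemma measurable_mixing_kernel_fixed_weights:
  assumes "p \<in> space (weight_space m)"
  shows "(\<lambda>\<theta>. Pi\<^sub>M {1..n} (\<lambda>_. mixing_measure T p \<theta>))
     \<in> Pi\<^sub>M UNIV (\<lambda>_::nat. prior_law) \<rightarrow>\<^sub>M prob_algebra (Pi\<^sub>M {1..n} (\<lambda>_. T))"
  using measurable_Pair2[OF measurable_mixing_kernel[of prior_law T n m] assms] by simp

lemma prob_space_latent_law: "prob_space (latent_law T \<pi> P n)"
  unfolding latent_law_def by (rule prob_space_bind'[OF P measurable_latent_kernel])

lemma sets_latent_law: "sets (latent_law T \<pi> P n) = sets (Pi\<^sub>M {1..n} (\<lambda>_. T))"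
  unfolding latent_law_def by (rule sets_bind'[OF P measurable_latent_kernel])

lemma emeasure_latent_law:
  assumes "E \<in> sets (Pi\<^sub>M {1..n} (\<lambda>_. T))"
  shows "emeasure (latent_law T \<pi> P n) E =
    (\<integral>\<^sup>+p. \<integral>\<^sup>+\<theta>. emeasure (Pi\<^sub>M {1..n} (\<lambda>_. mixing_measure T p \<theta>)) E \<partial>Pi\<^sub>M UNIV (\<lambda>_::nat. prior_law) \<partial>P)"
  unfolding latent_law_def
proof (subst emeasure_bind_prob_algebra[OF P measurable_latent_kernel assms], rule nn_integral_cong)
  fix p assume "p \<in> space P"
  then have "p \<in> space (weight_space m)"
    using P by (simp add: space_prob_algebra cong: sets_eq_imp_space_eq)
  from emeasure_bind_prob_algebra[OF prior_product_in_prob_algebra measurable_mixing_kernel_fixed_weights[OF this] assms]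
  show "emeasure (Pi\<^sub>M UNIV (\<lambda>_::nat. prior_law) \<bind> (\<lambda>\<theta>. Pi\<^sub>M {1..n} (\<lambda>_. mixing_measure T p \<theta>))) E =
    (\<integral>\<^sup>+\<theta>. emeasure (Pi\<^sub>M {1..n} (\<lambda>_. mixing_measure T p \<theta>)) E \<partial>Pi\<^sub>M UNIV (\<lambda>_::nat. prior_law))" .
qed

text \<open>
  The clusters are determined by the finitely many events \<open>\<phi> i = \<phi> j\<close>, each of which is measurable
  because the diagonal of a second countable Hausdorff space is.
\<close>

lemma sets_cluster_event:
  "{\<phi> \<in> space (Pi\<^sub>M {1..n} (\<lambda>_. T)). cluster_partition n \<phi> = \<I>} \<in> sets (Pi\<^sub>M {1..n} (\<lambda>_. T))"
proof -
  let ?M = "Pi\<^sub>M {1..n} (\<lambda>_. T)"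
  let ?R = "\<lambda>\<phi>. {(i, j). i \<in> {1..n} \<and> j \<in> {1..n} \<and> \<phi> i = \<phi> j}"
  have eq_pred: "Measurable.pred ?M (\<lambda>\<phi>. \<phi> i = \<phi> j)" if "i \<in> {1..n}" "j \<in> {1..n}" for i j
    unfolding pred_def
    using measurable_compose[OF measurable_component_singleton[OF that(1)] T]
      measurable_compose[OF measurable_component_singleton[OF that(2)] T]
    by (rule measurable_equality_set)
  have "{\<phi> \<in> space ?M. cluster_partition n \<phi> = \<I>} =
    (\<Union>R\<in>{R \<in> Pow ({1..n} \<times> {1..n}). {1..n} // R = \<I>}.
       {\<phi> \<in> space ?M. \<forall>i\<in>{1..n}. \<forall>j\<in>{1..n}. \<phi> i = \<phi> j \<longleftrightarrow> (i, j) \<in> R})" (is "?L = ?U")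
  proof
    show "?L \<subseteq> ?U"
    proof
      fix \<phi> assume "\<phi> \<in> ?L"
      then show "\<phi> \<in> ?U"
        by (intro UN_I[of "?R \<phi>"]) (auto simp: cluster_partition_def)
    qed
    have "?R \<phi> = R" if "R \<subseteq> {1..n} \<times> {1..n}"
      "\<forall>i\<in>{1..n}. \<forall>j\<in>{1..n}. \<phi> i = \<phi> j \<longleftrightarrow> (i, j) \<in> R" for R and \<phi> :: "nat \<Rightarrow> 't"
      using that by blast
    then show "?U \<subseteq> ?L"
      by (auto simp: cluster_partition_def)
  qed
  also have "\<dots> \<in> sets ?M"
    by (intro sets.finite_UN predE pred_intros_finite pred_intros_logic)
       (auto intro!: finite_subset[of _ "Pow ({1..n} \<times> {1..n})"] eq_pred simp del: One_nat_def)
  finally show ?thesis .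
qed

text \<open>
  Given weights and atoms, the law of \<open>\<phi>\<close> is a power of a single measure and therefore invariant under
  permutations of the coordinates; this survives averaging over weights and atoms.
\<close>

lemma partition_prob_exchangeable:
  assumes \<sigma>: "\<sigma> permutes {1..n}"
  shows "partition_prob T \<pi> P n ((`) \<sigma> ` \<I>) = partition_prob T \<pi> P n \<I>"
proof -
  let ?M = "Pi\<^sub>M {1..n} (\<lambda>_. T)" and ?t = "\<lambda>\<phi>. \<lambda>k\<in>{1..n}. \<phi> (\<sigma> k)"
  let ?E = "\<lambda>\<I>. {\<phi> \<in> space ?M. cluster_partition n \<phi> = \<I>}"
  have inner: "emeasure (Pi\<^sub>M {1..n} (\<lambda>_. mixing_measure T p \<theta>)) (?E ((`) \<sigma> ` \<I>))
      = emeasure (Pi\<^sub>M {1..n} (\<lambda>_. mixing_measure T p \<theta>)) (?E \<I>)"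
    if "p \<in> space P" "\<theta> \<in> space (Pi\<^sub>M UNIV (\<lambda>_::nat. prior_law))" for p \<theta>
  proof -
    let ?K = "Pi\<^sub>M {1..n} (\<lambda>_. mixing_measure T p \<theta>)"
    have "p \<in> weight_simplex m"
      using that(1) P by (auto simp: space_prob_algebra weight_space_def space_restrict_space
          dest!: sets_eq_imp_space_eq)
    then have mix: "prob_space (mixing_measure T p \<theta>)"
      using that(2) by (auto simp: space_PiM intro!: prob_space_mixing_measure[where m=m])
    have sets: "sets ?K = sets ?M"
      by (intro sets_PiM_cong) auto
    note space = sets_eq_imp_space_eq[OF sets]
    have \<sigma>': "inj_on \<sigma> {1..n}" "\<sigma> \<in> {1..n} \<rightarrow> {1..n}"
      using \<sigma> by (auto simp: permutes_inj_on permutes_in_image simp del: atLeastAtMost_iff)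
    have t: "?t \<in> ?K \<rightarrow>\<^sub>M ?K"
      using \<sigma>' by (intro measurable_restrict measurable_component_singleton) auto
    have K: "distr ?K ?K ?t = ?K"
      using distr_PiM_reindex[of "{1..n}" "\<lambda>_. mixing_measure T p \<theta>" \<sigma> "{1..n}"] \<sigma>' mix by simp
    have "emeasure ?K (?E \<I>) = emeasure (distr ?K ?K ?t) (?E \<I>)"
      using K by simp
    also have "\<dots> = emeasure ?K (?t -` ?E \<I> \<inter> space ?K)"
      using sets_cluster_event sets by (intro emeasure_distr t) auto
    also have "?t -` ?E \<I> \<inter> space ?K = ?E ((`) \<sigma> ` \<I>)"
      using measurable_space[OF t] unfolding space vimage_def
      by (simp add: cluster_partition_permute[OF \<sigma>] Int_def conj_commute
          cong: conj_cong del: One_nat_def)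
    finally show ?thesis ..
  qed
  have "emeasure (latent_law T \<pi> P n) (?E ((`) \<sigma> ` \<I>)) = emeasure (latent_law T \<pi> P n) (?E \<I>)"
    unfolding emeasure_latent_law[OF sets_cluster_event]
    by (intro nn_integral_cong inner)
  then show ?thesis
    unfolding partition_prob_def measure_def sets_eq_imp_space_eq[OF sets_latent_law] by simp
qed

lemma partition_prob_nonneg: "partition_prob T \<pi> P n \<I> \<ge> 0"
  by (simp add: partition_prob_def)

text \<open>
  The cluster events of the finitely many partitions cover the whole probability space. This is used
  to see that a MAP partition has positive prior probability, so that this factor may be cancelled.
\<close>

lemma ex_partition_prob_pos:
  obtains \<I> where "partition_on {1..n} \<I>" "partition_prob T \<pi> P n \<I> > 0"
proof -
  interpret prob_space "latent_law T \<pi> P n" by (rule prob_space_latent_law)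
  let ?L = "latent_law T \<pi> P n"
  let ?E = "\<lambda>\<I>. {\<phi> \<in> space ?L. cluster_partition n \<phi> = \<I>}"
  have sets: "?E \<I> \<in> sets ?L" for \<I>
    using sets_cluster_event unfolding sets_eq_imp_space_eq[OF sets_latent_law] sets_latent_law .
  have fin: "finite {\<I>. partition_on {1..n} \<I>}"
    by (rule finitely_many_partition_on) simp
  have "1 = measure ?L (\<Union>\<I>\<in>{\<I>. partition_on {1..n} \<I>}. ?E \<I>)"
    using partition_on_cluster_partition
    by (subst prob_space[symmetric], intro arg_cong[where f="measure ?L"]) auto
  also have "\<dots> \<le> (\<Sum>\<I> | partition_on {1..n} \<I>. partition_prob T \<pi> P n \<I>)"
    unfolding partition_prob_def using fin sets by (intro finite_measure_subadditive_finite) auto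
  finally have "(\<Sum>\<I> | partition_on {1..n} \<I>. partition_prob T \<pi> P n \<I>) > 0" by simp
  then obtain \<I> where "partition_on {1..n} \<I>" "partition_prob T \<pi> P n \<I> \<noteq> 0"
    by (metis (mono_tags, lifting) less_irrefl mem_Collect_eq sum.neutral)
  then show ?thesis
    using that[of \<I>] partition_prob_nonneg[of \<I>] by linarith
qed

end

section \<open>A strict Jensen inequality for the exponential function\<close>

text \<open>
  Integrate the tangent inequality \<open>exp r \<ge> exp m (1 + r - m)\<close>, taken at the weighted mean \<open>m\<close> of \<open>r\<close>.
  Since equality holds only for \<open>r = m\<close>, the integral of the difference vanishes only if \<open>r\<close> is
  almost everywhere constant.
\<close>

lemma
  fixes h r :: "'a \<Rightarrow> real"
  assumes h: "integrable M h" "\<And>t. t \<in> space M \<Longrightarrow> h t > 0"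
    and hr: "integrable M (\<lambda>t. h t * r t)"
    and hexp: "integrable M (\<lambda>t. h t * exp (r t))"
    and pos: "(\<integral>t. h t \<partial>M) > 0"
  defines "m \<equiv> (\<integral>t. h t * r t \<partial>M) / (\<integral>t. h t \<partial>M)"
  shows jensen_exp: "(\<integral>t. h t \<partial>M) * exp m \<le> (\<integral>t. h t * exp (r t) \<partial>M)"
    and jensen_exp_strict: "(\<And>c. \<not> (AE t in M. r t = c)) \<Longrightarrow>
        (\<integral>t. h t \<partial>M) * exp m < (\<integral>t. h t * exp (r t) \<partial>M)"
proof -
  let ?D = "\<lambda>t. h t * exp (r t) - exp m * (h t + h t * r t - m * h t)"
  have D_eq: "?D t = h t * exp m * (exp (r t - m) - (1 + (r t - m)))" for t
    by (simp add: exp_diff field_simps)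
  \<comment> \<open>Squaring \<open>1 + u / 2 \<le> exp (u / 2)\<close> gains the positive term \<open>u\<^sup>2 / 4\<close>.\<close>
  have strict: "1 + u < exp u" if "u \<noteq> 0" for u :: real
  proof (cases "1 + u / 2 \<ge> 0")
    case True
    have "1 + u < (1 + u / 2)\<^sup>2"
      using that by (simp add: power2_eq_square algebra_simps) (simp flip: power2_eq_square)
    also have "\<dots> \<le> (exp (u / 2))\<^sup>2"
      using True exp_ge_add_one_self[of "u / 2"] by (intro power_mono) auto
    also have "\<dots> = exp u"
      by (simp flip: exp_double)
    finally show ?thesis .
  next
    case False
    then have "1 + u < 0" by simp
    then show ?thesis using exp_gt_zero[of u] by linarith
  qed
  have nonneg: "?D t \<ge> 0" if "t \<in> space M" for t
    unfolding D_eq using h(2)[OF that] exp_ge_add_one_self[of "r t - m"] by simp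
  have integrable: "integrable M ?D"
    using h hr hexp by simp
  have integral: "(\<integral>t. ?D t \<partial>M) = (\<integral>t. h t * exp (r t) \<partial>M) - (\<integral>t. h t \<partial>M) * exp m"
  proof -
    have "(\<integral>t. ?D t \<partial>M) = (\<integral>t. h t * exp (r t) \<partial>M)
        - exp m * ((\<integral>t. h t \<partial>M) + (\<integral>t. h t * r t \<partial>M) - m * (\<integral>t. h t \<partial>M))"
      using h hr hexp by simp
    also have "(\<integral>t. h t * r t \<partial>M) = m * (\<integral>t. h t \<partial>M)"
      using pos by (simp add: m_def)
    finally show ?thesis by (simp add: mult.commute)
  qed
  show "(\<integral>t. h t \<partial>M) * exp m \<le> (\<integral>t. h t * exp (r t) \<partial>M)"
    using integral Bochner_Integration.integral_nonneg[of M ?D] nonneg by simp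
  show "(\<integral>t. h t \<partial>M) * exp m < (\<integral>t. h t * exp (r t) \<partial>M)"
    if nonconst: "\<And>c. \<not> (AE t in M. r t = c)"
  proof -
    have "(\<integral>t. ?D t \<partial>M) \<noteq> 0"
    proof
      assume "(\<integral>t. ?D t \<partial>M) = 0"
      then have "AE t in M. ?D t = 0"
        using integral_nonneg_eq_0_iff_AE[OF integrable] nonneg by simp
      then have "AE t in M. r t = m"
      proof (rule AE_mp, intro AE_I2 impI)
        fix t assume "t \<in> space M" "?D t = 0"
        then show "r t = m"
          using h(2)[of t] strict[of "r t - m"] unfolding D_eq by auto
      qed
      with nonconst show False by blast
    qed
    then show ?thesis
      using integral Bochner_Integration.integral_nonneg[of M ?D] nonneg by simp
  qed
qed

section \<open>Polynomials of degree at most two\<close>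

text \<open>
  The sum that defines a polynomial ranges over all exponents of bounded degree and is only meaningful
  because there are finitely many of them.
\<close>

lemma finite_exponents: "finite {\<alpha> :: 'd::finite \<Rightarrow> nat. (\<Sum>i\<in>UNIV. \<alpha> i) \<le> k}"
proof (rule finite_subset)
  show "{\<alpha> :: 'd \<Rightarrow> nat. (\<Sum>i\<in>UNIV. \<alpha> i) \<le> k} \<subseteq> Pi\<^sub>E UNIV (\<lambda>_. {..k})"
  proof (intro subsetI PiE_I)
    fix \<alpha> :: "'d \<Rightarrow> nat" and i
    assume "\<alpha> \<in> {\<alpha>. (\<Sum>i\<in>UNIV. \<alpha> i) \<le> k}"
    then show "\<alpha> i \<in> {..k}"
      using member_le_sum[of i UNIV \<alpha>] by simp
  qed simp
qed (intro finite_PiE; simp)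

lemma polynomial_of_degree_le_monomial:
  assumes "(\<Sum>i\<in>UNIV. \<beta> i) \<le> k"
  shows "polynomial_of_degree_le k (\<lambda>v :: real^'d. a * (\<Prod>i\<in>UNIV. (v $ i) ^ \<beta> i))"
  unfolding polynomial_of_degree_le_def
proof (intro exI allI)
  fix v :: "real^'d"
  show "a * (\<Prod>i\<in>UNIV. (v $ i) ^ \<beta> i) = (\<Sum>\<alpha> | (\<Sum>i\<in>UNIV. \<alpha> i) \<le> k.
      (if \<alpha> = \<beta> then a else 0) * (\<Prod>i\<in>UNIV. (v $ i) ^ \<alpha> i))"
    using assms finite_exponents[of k]
    by (subst sum.remove[of _ \<beta>]) (auto intro!: sum.neutral)
qed

lemma polynomial_of_degree_le_add:
  assumes "polynomial_of_degree_le k L" "polynomial_of_degree_le k M"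
  shows "polynomial_of_degree_le k (\<lambda>v :: real^'d. L v + M v)"
proof -
  from assms obtain b c where
    "\<And>v. L v = (\<Sum>\<alpha> | (\<Sum>i\<in>UNIV. \<alpha> i) \<le> k. b \<alpha> * (\<Prod>i\<in>UNIV. (v $ i) ^ \<alpha> i))"
    "\<And>v. M v = (\<Sum>\<alpha> | (\<Sum>i\<in>UNIV. \<alpha> i) \<le> k. c \<alpha> * (\<Prod>i\<in>UNIV. (v $ i) ^ \<alpha> i))"
    unfolding polynomial_of_degree_le_def by blast
  then show ?thesis
    unfolding polynomial_of_degree_le_def
    by (intro exI[of _ "\<lambda>\<alpha>. b \<alpha> + c \<alpha>"]) (simp add: sum.distrib algebra_simps)
qed

lemma polynomial_of_degree_le_sum:
  assumes "finite A" "\<And>a. a \<in> A \<Longrightarrow> polynomial_of_degree_le k (L a)"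
  shows "polynomial_of_degree_le k (\<lambda>v :: real^'d. \<Sum>a\<in>A. L a v)"
  using assms
proof (induction A rule: finite_induct)
  case empty
  show ?case
    using polynomial_of_degree_le_monomial[of "\<lambda>_. 0" k 0] by simp
qed (simp add: polynomial_of_degree_le_add)

lemma polynomial_of_degree_le_quadratic:
  fixes Q :: "real^'d^'d" and b :: "real^'d"
  shows "polynomial_of_degree_le 2 (\<lambda>v. v \<bullet> (Q *v v) + b \<bullet> v + c)"
proof -
  have quad: "polynomial_of_degree_le 2 (\<lambda>v :: real^'d. a * (v $ i * v $ j))" for a i j
  proof -
    have "(\<Prod>l\<in>UNIV. (v $ l) ^ (of_bool (l = i) + of_bool (l = j))) = v $ i * v $ j" for v :: "real^'d"
      by (simp add: power_add prod.distrib of_bool_def if_distrib[of "\<lambda>n. _ ^ n"] cong: if_cong)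
    moreover have "(\<Sum>l\<in>UNIV. of_bool (l = i) + of_bool (l = j)) \<le> (2::nat)"
      by (simp add: sum.distrib)
    ultimately show ?thesis
      using polynomial_of_degree_le_monomial[of "\<lambda>l. of_bool (l = i) + of_bool (l = j)" 2 a] by simp
  qed
  have lin: "polynomial_of_degree_le 2 (\<lambda>v :: real^'d. a * v $ i)" for a i
  proof -
    have "(\<Prod>l\<in>UNIV. (v $ l) ^ of_bool (l = i)) = v $ i" for v :: "real^'d"
      by (simp add: of_bool_def if_distrib[of "\<lambda>n. _ ^ n"] cong: if_cong)
    then show ?thesis
      using polynomial_of_degree_le_monomial[of "\<lambda>l. of_bool (l = i)" 2 a] by simp
  qed
  have const: "polynomial_of_degree_le 2 (\<lambda>v :: real^'d. c)"
    using polynomial_of_degree_le_monomial[of "\<lambda>_. 0" 2 c] by simp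
  have eq: "v \<bullet> (Q *v v) + b \<bullet> v + c =
      (\<Sum>i\<in>UNIV. \<Sum>j\<in>UNIV. Q $ i $ j * (v $ i * v $ j)) + (\<Sum>i\<in>UNIV. b $ i * v $ i) + c" for v
    by (simp add: inner_vec_def matrix_vector_mult_def sum_distrib_left mult_ac)
  show ?thesis
    unfolding eq
    by (intro polynomial_of_degree_le_add polynomial_of_degree_le_sum quad lin const finite)
qed

section \<open>Positive definite matrices\<close>

lemma matrix_inv_unique:
  fixes A V :: "real^'d^'d"
  assumes "A ** V = mat 1"
  shows "matrix_inv A = V"
proof -
  have VA: "V ** A = mat 1"
    using assms matrix_left_right_inverse by blast
  show ?thesis
    unfolding matrix_inv_def
  proof (rule some_equality)
    fix W assume "A ** W = mat 1 \<and> W ** A = mat 1"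
    then show "W = V"
      by (metis VA matrix_mul_assoc matrix_mul_lid matrix_mul_rid)
  qed (use assms VA in simp)
qed

lemma pos_def_nth_commute: "pos_def A \<Longrightarrow> A $ i $ j = A $ j $ i"
  by (auto simp: pos_def_def transpose_def vec_eq_iff)

lemma pos_def_inner_commute: "pos_def A \<Longrightarrow> u \<bullet> (A *v v) = (A *v u) \<bullet> v"
  using dot_lmul_matrix[of u A v] transpose_matrix_vector[of A u] by (simp add: pos_def_def)

lemma pos_def_diag_pos:
  assumes "pos_def A"
  shows "A $ k $ k > 0"
proof -
  have "axis k 1 \<bullet> (A *v axis k 1) > 0"
    using assms by (simp add: pos_def_def)
  then show ?thesis
    by (simp add: matrix_vector_mult_basis inner_axis' column_def)
qed

lemma pos_def_det_nonzero:
  assumes "pos_def A"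
  shows "det A \<noteq> 0"
proof -
  have "v = 0" if "A *v v = 0" for v
    using assms that unfolding pos_def_def by (metis inner_zero_right less_irrefl)
  then have "\<exists>B. B ** A = mat 1"
    by (simp add: matrix_left_invertible_ker)
  then have "invertible A"
    by (simp add: invertible_left_inverse)
  then show ?thesis by (simp add: invertible_det_nz)
qed

lemma pos_def_matrix_inv:
  assumes "pos_def A"
  shows "A ** matrix_inv A = mat 1" and "matrix_inv A ** A = mat 1" and "pos_def (matrix_inv A)"
proof -
  obtain V where V: "A ** V = mat 1" "V ** A = mat 1"
    using pos_def_det_nonzero[OF assms] invertible_det_nz unfolding invertible_def by blast
  note inv = matrix_inv_unique[OF V(1)]
  show "A ** matrix_inv A = mat 1" "matrix_inv A ** A = mat 1"
    using V inv by auto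
  have sym: "transpose V = V"
  proof -
    have "A ** transpose V = transpose (V ** A)"
      using assms by (simp add: matrix_transpose_mul pos_def_def)
    then show ?thesis
      using matrix_inv_unique[of A "transpose V"] V inv by simp
  qed
  have "v \<bullet> (V *v v) > 0" if "v \<noteq> 0" for v
  proof -
    have v: "v = A *v (V *v v)"
      using V by (simp add: matrix_vector_mul_assoc)
    then have "V *v v \<noteq> 0" using that by auto
    then have "(V *v v) \<bullet> (A *v (V *v v)) > 0"
      using assms by (simp add: pos_def_def)
    with v show ?thesis by (simp add: inner_commute)
  qed
  with sym show "pos_def (matrix_inv A)"
    by (simp add: inv pos_def_def)
qed

lemma pos_def_scaleR:
  assumes "pos_def A" "c > 0"
  shows "pos_def (c *\<^sub>R A)" and "matrix_inv (c *\<^sub>R A) = (1 / c) *\<^sub>R matrix_inv A"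
proof -
  show "pos_def (c *\<^sub>R A)"
    using assms by (auto simp: pos_def_def transpose_scalar scaleR_matrix_vector_assoc[symmetric])
  show "matrix_inv (c *\<^sub>R A) = (1 / c) *\<^sub>R matrix_inv A"
    using assms pos_def_matrix_inv[OF assms(1)]
    by (intro matrix_inv_unique) (simp add: matrix_scalar_ac scalar_matrix_assoc[symmetric])
qed

section \<open>Elimination of one coordinate\<close>

text \<open>
  The rows and columns outside \<open>S\<close> are replaced by those of the identity. Principal submatrices of all
  sizes thereby live in one matrix type, with the determinant and the inverse of the actual submatrix,
  and statements about them can be proved by induction on \<open>S\<close>.
\<close>

definition principal_block :: "'d set \<Rightarrow> real^'d^'d \<Rightarrow> real^'d^'d" where
  "principal_block S A = (\<chi> i j. if i \<in> S \<and> j \<in> S then A $ i $ j else of_bool (i = j))"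

text \<open>
  As for principal blocks, the row and column \<open>k\<close> that have been eliminated become those of the identity.
\<close>

definition schur_complement :: "'d \<Rightarrow> real^'d^'d \<Rightarrow> real^'d^'d" where
  "schur_complement k A = (\<chi> i j. if i = k \<or> j = k then of_bool (i = j)
     else A $ i $ j - A $ i $ k * A $ k $ j / A $ k $ k)"

text \<open>
  The change of coordinates that completes the square in the variable \<open>v $ k\<close> of the form \<open>v \<bullet> Av\<close>. The
  normalisation by \<open>sqrt (A $ k $ k)\<close> makes the coefficient of the new square equal to one.
\<close>

definition elimination :: "'d \<Rightarrow> real^'d^'d \<Rightarrow> real^'d^'d" where
  "elimination k A = (\<chi> i. if i = k then (1 / sqrt (A $ k $ k)) *\<^sub>R A $ k else axis i 1)"

lemma principal_block_nth:
  "principal_block S A $ i $ j = (if i \<in> S \<and> j \<in> S then A $ i $ j else of_bool (i = j))"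
  by (simp add: principal_block_def)

lemma principal_block_UNIV [simp]: "principal_block UNIV A = A"
  by (simp add: principal_block_def vec_eq_iff)

lemma schur_complement_nth:
  "schur_complement k A $ i $ j = (if i = k \<or> j = k then of_bool (i = j)
     else A $ i $ j - A $ i $ k * A $ k $ j / A $ k $ k)"
  by (simp add: schur_complement_def)

lemma elimination_mult_nth:
  "(elimination k A *v v) $ i = (if i = k then (A $ k \<bullet> v) / sqrt (A $ k $ k) else v $ i)"
  by (simp add: elimination_def matrix_vector_mul_component inner_axis')

text \<open>
  An instance of Cramer's rule: the row \<open>x\<close> is the combination of the rows of the identity with
  coefficients \<open>x $ i\<close>.
\<close>

lemma det_replace_row_mat_1:
  fixes x :: "real^'d"
  shows "det (\<chi> i. if i = k then x else axis i 1) = x $ k"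
proof -
  have row: "row i (mat 1) = (axis i 1 :: real^'d)" for i
    by (simp add: row_def mat_def axis_def vec_eq_iff eq_commute)
  have "(\<Sum>i\<in>UNIV. x $ i *s (axis i 1 :: real^'d)) = x"
    by (rule basis_expansion)
  then show ?thesis
    using cramer_lemma_transpose[of k x "mat 1"] unfolding row by (simp only: det_I mult_1_right)
qed

lemma det_elimination:
  assumes "pos_def A"
  shows "det (elimination k A) = sqrt (A $ k $ k)"
  using pos_def_diag_pos[OF assms, of k]
  by (simp add: elimination_def det_replace_row_mat_1 real_div_sqrt)

lemma schur_complement_factorization:
  assumes "pos_def A"
  shows "A = transpose (elimination k A) ** schur_complement k A ** elimination k A"
proof -
  let ?G = "elimination k A" and ?C = "schur_complement k A"
  have a: "A $ k $ k > 0" by (rule pos_def_diag_pos[OF assms])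
  have G: "?G $ i $ j = (if i = k then A $ k $ j / sqrt (A $ k $ k) else of_bool (i = j))" for i j
    by (simp add: elimination_def axis_def)
  have CG: "(?C ** ?G) $ i $ j =
      (if i = k then ?G $ k $ j else (if j = k then 0 else ?C $ i $ j))" for i j
  proof (cases "i = k")
    case True
    then show ?thesis
      by (simp add: matrix_matrix_mult_def schur_complement_nth of_bool_def
          if_distrib[of "\<lambda>y. y * _"] cong: if_cong)
  next
    case False
    have "(?C ** ?G) $ i $ j = (\<Sum>q\<in>UNIV. if q = j then (if j = k then 0 else ?C $ i $ j) else 0)"
      unfolding matrix_matrix_mult_def vec_lambda_beta
    proof (rule sum.cong[OF refl])
      fix q
      show "?C $ i $ q * ?G $ q $ j = (if q = j then (if j = k then 0 else ?C $ i $ j) else 0)"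
        using False by (cases "q = k") (auto simp: schur_complement_nth G)
    qed
    then show ?thesis using False by simp
  qed
  have "(transpose ?G ** (?C ** ?G)) $ i $ j = A $ i $ j" for i j
  proof -
    have "(transpose ?G ** (?C ** ?G)) $ i $ j = (\<Sum>p\<in>UNIV. ?G $ p $ i * (?C ** ?G) $ p $ j)"
      by (simp add: matrix_matrix_mult_def transpose_def)
    also have "\<dots> = ?G $ k $ i * ?G $ k $ j + (\<Sum>p\<in>UNIV - {k}. ?G $ p $ i * (?C ** ?G) $ p $ j)"
      by (subst sum.remove[of _ k]) (auto simp: CG)
    also have "(\<Sum>p\<in>UNIV - {k}. ?G $ p $ i * (?C ** ?G) $ p $ j)
        = (\<Sum>p\<in>UNIV - {k}. if p = i then (if j = k then 0 else ?C $ i $ j) else 0)"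
      by (intro sum.cong) (auto simp: G CG)
    also have "\<dots> = (if i = k \<or> j = k then 0 else ?C $ i $ j)"
      by simp
    also have "?G $ k $ i * ?G $ k $ j = A $ k $ i * A $ k $ j / A $ k $ k"
      using a by (simp add: G)
    finally show ?thesis
      using a pos_def_nth_commute[OF assms, of k i] by (simp add: schur_complement_nth)
  qed
  then show ?thesis by (simp add: vec_eq_iff matrix_mul_assoc)
qed

lemma quadratic_form_transpose_mult:
  fixes A G :: "real^'d^'d"
  shows "v \<bullet> ((transpose G ** A ** G) *v v) = (G *v v) \<bullet> (A *v (G *v v))"
proof -
  have "v \<bullet> ((transpose G ** A ** G) *v v) = ((A *v (G *v v)) v* G) \<bullet> v"
    by (simp add: matrix_vector_mul_assoc[symmetric] inner_commute)
  then show ?thesis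
    unfolding dot_lmul_matrix by (simp only: inner_commute)
qed

lemma pos_def_congruence:
  assumes "pos_def A" "det G \<noteq> 0"
  shows "pos_def (transpose G ** A ** G)"
  unfolding pos_def_def
proof (intro conjI allI impI)
  show "transpose (transpose G ** A ** G) = transpose G ** A ** G"
    using assms(1) by (simp add: pos_def_def matrix_transpose_mul matrix_mul_assoc)
  fix v :: "real^'a" assume "v \<noteq> 0"
  then have "G *v v \<noteq> 0"
    using assms(2) inj_matrix_vector_mult[of G] injD[of "(*v) G" v 0] by (auto simp: invertible_det_nz)
  then show "v \<bullet> ((transpose G ** A ** G) *v v) > 0"
    using assms(1) by (simp add: quadratic_form_transpose_mult pos_def_def)
qed

lemma pos_def_schur_complement:
  assumes "pos_def A"
  shows "pos_def (schur_complement k A)"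
proof -
  let ?G = "elimination k A"
  have detG: "det ?G \<noteq> 0"
    using pos_def_diag_pos[OF assms, of k] by (simp add: det_elimination[OF assms])
  then obtain H where H: "?G ** H = mat 1" "H ** ?G = mat 1"
    using invertible_det_nz unfolding invertible_def by blast
  have "det H \<noteq> 0"
    using H(1) by (metis det_I det_mul mult_zero_right zero_neq_one)
  moreover have "transpose H ** A ** H = schur_complement k A"
  proof -
    have "transpose H ** A ** H = transpose (?G ** H) ** schur_complement k A ** (?G ** H)"
      by (subst schur_complement_factorization[OF assms, of k])
         (simp add: matrix_transpose_mul matrix_mul_assoc)
    then show ?thesis by (simp add: H)
  qed
  ultimately show ?thesis
    using pos_def_congruence[OF assms, of H] by simp
qed

lemma det_schur_complement:
  assumes "pos_def A"
  shows "det A = A $ k $ k * det (schur_complement k A)"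
proof -
  have "det A = det (elimination k A) * det (elimination k A) * det (schur_complement k A)"
    by (subst schur_complement_factorization[OF assms, of k]) (simp add: det_mul det_transpose)
  then show ?thesis
    using pos_def_diag_pos[OF assms, of k] by (simp add: det_elimination[OF assms])
qed

lemma principal_block_schur_complement:
  assumes "principal_block (insert k S) A = A"
  shows "principal_block (S - {k}) (schur_complement k A) = schur_complement k A"
proof -
  have A: "A $ i $ j = of_bool (i = j)" if "i \<notin> insert k S \<or> j \<notin> insert k S" for i j
    using that principal_block_nth[of "insert k S" A i j] unfolding assms by (auto split: if_splits)
  have "schur_complement k A $ i $ j = of_bool (i = j)" if "i \<notin> S - {k} \<or> j \<notin> S - {k}" for i j
    using that A[of i j] A[of i k] A[of k j] by (auto simp: schur_complement_nth)
  then show ?thesis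
    by (auto simp: vec_eq_iff principal_block_nth)
qed

text \<open>
  Eliminate the coordinates one after the other and collect the changes of coordinates.
\<close>

lemma cholesky:
  fixes A :: "real^'d^'d"
  assumes "pos_def A"
  obtains B :: "real^'d^'d" where "A = transpose B ** B"
proof -
  have "\<exists>B :: real^'d^'d. A = transpose B ** B"
    if "finite S" "pos_def A" "principal_block S A = A" for S :: "'d set" and A :: "real^'d^'d"
    using that
  proof (induction S arbitrary: A rule: finite_induct)
    case empty
    then have "A = mat 1"
      by (simp add: principal_block_def mat_def of_bool_def)
    then show ?case by (intro exI[of _ "mat 1"]) simp
  next
    case (insert k S)
    from insert.hyps principal_block_schur_complement[OF insert.prems(2)]
    have "principal_block S (schur_complement k A) = schur_complement k A" by simp
    with insert.IH pos_def_schur_complement[OF insert.prems(1)]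
    obtain B :: "real^'d^'d" where B: "schur_complement k A = transpose B ** B" by blast
    show ?case
      by (rule exI[of _ "B ** elimination k A"], subst schur_complement_factorization[OF insert.prems(1), of k])
         (simp add: B matrix_transpose_mul matrix_mul_assoc)
  qed
  from this[of UNIV A] assms obtain B :: "real^'d^'d" where "A = transpose B ** B"
    by auto
  then show ?thesis by (rule that)
qed

lemma pos_def_det_pos:
  fixes A :: "real^'d^'d"
  assumes "pos_def A"
  shows "det A > 0"
proof -
  obtain B :: "real^'d^'d" where "A = transpose B ** B" by (rule cholesky[OF assms])
  then have "det A = (det B)\<^sup>2" by (simp add: det_mul power2_eq_square)
  then show ?thesis using pos_def_det_nonzero[OF assms] by simp
qed

lemma det_matrix_inv:
  assumes "pos_def A"
  shows "det (matrix_inv A) = 1 / det A"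
proof -
  have "det A * det (matrix_inv A) = 1"
    using arg_cong[OF pos_def_matrix_inv(1)[OF assms], of det] by (simp add: det_mul)
  then show ?thesis
    using pos_def_det_pos[OF assms] by (simp add: field_simps)
qed

section \<open>Trace bounds for positive definite matrices\<close>

text \<open>
  With \<open>Y = B\<^sup>TB\<close>, the entries of \<open>Y\<close> are the inner products of the columns of \<open>B\<close> and the trace is the
  sum of their squared lengths, so that both bounds are the Cauchy-Schwarz inequality.
\<close>

lemma pos_def_trace_bounds:
  fixes Y :: "real^'d^'d"
  assumes "pos_def Y"
  shows "trace Y \<ge> 0" and "\<bar>Y $ i $ j\<bar> \<le> trace Y" and "((Y *v v) $ i)\<^sup>2 \<le> trace Y * (v \<bullet> (Y *v v))"
proof -
  obtain B :: "real^'d^'d" where B: "Y = transpose B ** B" by (rule cholesky[OF assms])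
  have Y: "Y $ i $ j = column i B \<bullet> column j B" for i j
    by (simp add: B matrix_matrix_mult_def transpose_def column_def inner_vec_def)
  have tr: "trace Y = (\<Sum>i\<in>UNIV. (norm (column i B))\<^sup>2)"
    by (simp add: trace_def Y power2_norm_eq_inner)
  have col: "(norm (column i B))\<^sup>2 \<le> trace Y" for i
    unfolding tr by (rule member_le_sum) auto
  show "trace Y \<ge> 0" unfolding tr by (rule sum_nonneg) simp
  have "\<bar>Y $ i $ j\<bar> \<le> norm (column i B) * norm (column j B)"
    unfolding Y by (rule Cauchy_Schwarz_ineq2)
  also have "\<dots> \<le> ((norm (column i B))\<^sup>2 + (norm (column j B))\<^sup>2) / 2"
    using sum_squares_bound[of "norm (column i B)" "norm (column j B)"] by simp
  also have "\<dots> \<le> trace Y" using col[of i] col[of j] by simp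
  finally show "\<bar>Y $ i $ j\<bar> \<le> trace Y" .
  have "(Y *v v) $ i = column i B \<bullet> (B *v v)"
    by (simp add: B matrix_vector_mul_assoc[symmetric] vector_matrix_mult_def column_def inner_vec_def
        mult.commute)
  then have "((Y *v v) $ i)\<^sup>2 \<le> (column i B \<bullet> column i B) * ((B *v v) \<bullet> (B *v v))"
    using Cauchy_Schwarz_ineq[of "column i B" "B *v v"] by simp
  also have "(B *v v) \<bullet> (B *v v) = v \<bullet> (Y *v v)"
    using quadratic_form_transpose_mult[of v B "mat 1"] by (simp add: B)
  also have "(column i B \<bullet> column i B) * (v \<bullet> (Y *v v)) \<le> trace Y * (v \<bullet> (Y *v v))"
    using col[of i] \<open>(B *v v) \<bullet> (B *v v) = v \<bullet> (Y *v v)\<close>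
    by (intro mult_right_mono) (auto simp: power2_norm_eq_inner inner_ge_zero simp flip: \<open>(B *v v) \<bullet> (B *v v) = v \<bullet> (Y *v v)\<close>)
  finally show "((Y *v v) $ i)\<^sup>2 \<le> trace Y * (v \<bullet> (Y *v v))" .
qed

text \<open>
  A crude bound from the Leibniz formula. Only some power of the trace is needed, because the trace
  always occurs together with a decaying exponential.
\<close>

lemma pos_def_det_le_trace:
  fixes Y :: "real^'d^'d"
  assumes "pos_def Y"
  shows "det Y \<le> fact CARD('d) * trace Y ^ CARD('d)"
proof -
  have "det Y \<le> (\<Sum>p | p permutes (UNIV :: 'd set). \<bar>of_int (sign p) * (\<Prod>i\<in>UNIV. Y $ i $ p i)\<bar>)"
    unfolding det_def by (rule order_trans[OF abs_ge_self sum_abs])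
  also have "\<dots> \<le> (\<Sum>p | p permutes (UNIV :: 'd set). trace Y ^ CARD('d))"
  proof (rule sum_mono)
    fix p
    have "\<bar>of_int (sign p) * (\<Prod>i\<in>UNIV. Y $ i $ p i)\<bar> = (\<Prod>i\<in>UNIV. \<bar>Y $ i $ p i\<bar>)"
      by (simp add: abs_mult abs_prod sign_def)
    also have "\<dots> \<le> (\<Prod>i\<in>(UNIV :: 'd set). trace Y)"
      using pos_def_trace_bounds[OF assms] by (intro prod_mono) auto
    finally show "\<bar>of_int (sign p) * (\<Prod>i\<in>UNIV. Y $ i $ p i)\<bar> \<le> trace Y ^ CARD('d)" by simp
  qed
  also have "\<dots> = fact CARD('d) * trace Y ^ CARD('d)"
    by (simp add: card_permutations)
  finally show ?thesis .
qed

lemma pos_def_bounded_below: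
  fixes A :: "real^'d^'d"
  assumes "pos_def A"
  obtains e where "e > 0" "\<And>v. v \<bullet> (A *v v) \<ge> e * (norm v)\<^sup>2"
proof -
  have "continuous_on (sphere 0 1) (\<lambda>v. v \<bullet> (A *v v))"
    by (intro continuous_intros)
  moreover have "sphere (0 :: real^'d) 1 \<noteq> {}"
    using norm_axis_1[of undefined] by (auto simp: sphere_def dist_norm intro!: exI[of _ "axis undefined 1"])
  ultimately have "\<exists>u\<in>sphere 0 1. \<forall>v\<in>sphere 0 1. u \<bullet> (A *v u) \<le> v \<bullet> (A *v v)"
    by (intro continuous_attains_inf) auto
  then obtain u where u: "norm u = 1" "\<And>v. norm v = 1 \<Longrightarrow> u \<bullet> (A *v u) \<le> v \<bullet> (A *v v)"
    by auto
  show ?thesis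
  proof (rule that)
    show "u \<bullet> (A *v u) > 0" using assms u(1) by (cases "u = 0") (auto simp: pos_def_def)
    fix v :: "real^'d"
    show "v \<bullet> (A *v v) \<ge> u \<bullet> (A *v u) * (norm v)\<^sup>2"
    proof (cases "v = 0")
      case False
      define w where "w = (1 / norm v) *\<^sub>R v"
      have v: "v = norm v *\<^sub>R w" using False by (simp add: w_def)
      have "v \<bullet> (A *v v) = (norm v)\<^sup>2 * (w \<bullet> (A *v w))"
        by (subst (1 2) v) (simp add: matrix_vector_mult_scaleR power2_eq_square)
      moreover have "norm w = 1" using False by (simp add: w_def)
      ultimately show ?thesis using u(2)[of w] by (simp add: mult.commute mult_right_mono)
    qed simp
  qed
qed

text \<open>
  With \<open>Y = B\<^sup>TB\<close>, the trace of \<open>AY\<close> is the sum of the form of \<open>A\<close> over the rows of \<open>B\<close>. This compares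
  the exponent of the inverse Wishart density with a multiple of \<open>tr(\<Lambda>\<^sup>-\<^sup>1)\<close>.
\<close>

lemma pos_def_trace_mult_ge:
  fixes A :: "real^'d^'d"
  assumes "pos_def A"
  obtains e where "e > 0" "\<And>Y. pos_def Y \<Longrightarrow> trace (A ** Y) \<ge> e * trace Y"
proof -
  obtain e where e: "e > 0" "\<And>v. v \<bullet> (A *v v) \<ge> e * (norm v)\<^sup>2"
    using pos_def_bounded_below[OF assms] by blast
  have "trace (A ** Y) \<ge> e * trace Y" if Y: "pos_def Y" for Y :: "real^'d^'d"
  proof -
    obtain B :: "real^'d^'d" where B: "Y = transpose B ** B" by (rule cholesky[OF Y])
    have "trace (A ** Y) = trace (B ** A ** transpose B)"
      by (metis B matrix_mul_assoc trace_mul_sym)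
    also have "\<dots> = (\<Sum>i\<in>UNIV. row i B \<bullet> (A *v row i B))"
      by (simp add: trace_def matrix_matrix_mult_def transpose_def row_def inner_vec_def
          matrix_vector_mult_def sum_distrib_left sum_distrib_right mult_ac) (intro sum.cong refl sum.swap[THEN trans] sum.cong, simp add: mult_ac)
    also have "\<dots> \<ge> (\<Sum>i\<in>UNIV. e * (norm (row i B))\<^sup>2)"
      by (intro sum_mono e)
    also have "(\<Sum>i\<in>UNIV. e * (norm (row i B))\<^sup>2) = e * trace Y"
      unfolding B trace_mul_sym[of "transpose B"] 
      by (simp add: trace_def power2_norm_eq_inner sum_distrib_left matrix_matrix_mult_def transpose_def row_def
          inner_vec_def)
    finally show ?thesis .
  qed
  with e(1) show ?thesis by (rule that)
qed

text \<open>
  The operator norm of \<open>A - 1\<close> is at most the sum of the absolute values of its entries, hence less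
  than one. The resulting box of positive definite matrices shows that they have positive measure.
\<close>

lemma pos_def_near_identity:
  fixes A :: "real^'d^'d"
  assumes "transpose A = A" "\<And>i j. \<bar>A $ i $ j - of_bool (i = j)\<bar> < 1 / (real CARD('d) * real CARD('d))"
  shows "pos_def A"
proof -
  let ?E = "A - mat 1"
  have "onorm ((*v) ?E) \<le> (\<Sum>i\<in>UNIV. \<Sum>j\<in>UNIV. \<bar>?E $ i $ j\<bar>)"
    by (rule onorm_le_matrix_component_sum)
  also have "\<dots> < (\<Sum>i\<in>(UNIV :: 'd set). \<Sum>j\<in>(UNIV :: 'd set). 1 / (real CARD('d) * real CARD('d)))"
    using assms(2) by (intro sum_strict_mono) (auto simp: mat_def of_bool_def)
  also have "\<dots> = 1" by simp
  finally have small: "onorm ((*v) ?E) < 1" .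
  have "v \<bullet> (A *v v) > 0" if "v \<noteq> 0" for v
  proof -
    have "\<bar>v \<bullet> (?E *v v)\<bar> \<le> norm v * (onorm ((*v) ?E) * norm v)"
      by (intro order_trans[OF Cauchy_Schwarz_ineq2] mult_left_mono onorm) auto
    also have "\<dots> < norm v * (1 * norm v)"
      using small that by (intro mult_strict_left_mono mult_strict_right_mono) auto
    finally have "\<bar>v \<bullet> (?E *v v)\<bar> < v \<bullet> v"
      by (simp add: power2_norm_eq_inner[symmetric] power2_eq_square)
    moreover have "v \<bullet> (A *v v) = v \<bullet> v + v \<bullet> (?E *v v)"
      by (simp add: matrix_vector_mult_diff_rdistrib inner_diff_right)
    ultimately show ?thesis by linarith
  qed
  with assms(1) show ?thesis by (simp add: pos_def_def)
qed

section \<open>Measurability of matrix operations\<close>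

lemma borel_measurable_vec_lambda [measurable (raw)]:
  fixes f :: "'a \<Rightarrow> 'i::finite \<Rightarrow> 'b::euclidean_space"
  assumes "\<And>i. (\<lambda>x. f x i) \<in> borel_measurable M"
  shows "(\<lambda>x. \<chi> i. f x i) \<in> borel_measurable M"
proof (subst borel_measurable_euclidean_space, intro ballI)
  fix b :: "'b^'i" assume "b \<in> Basis"
  then obtain i u where "b = axis i u"
    by (auto simp: Basis_vec_def)
  then show "(\<lambda>x. (\<chi> i. f x i) \<bullet> b) \<in> borel_measurable M"
    using assms[of i] by (simp add: inner_axis)
qed

lemma borel_measurable_vec_nth [measurable (raw)]:
  fixes f :: "'a \<Rightarrow> 'b::euclidean_space^'i"
  assumes "f \<in> borel_measurable M"
  shows "(\<lambda>x. f x $ i) \<in> borel_measurable M"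
  by (rule measurable_compose[OF assms borel_measurable_continuous_onI])
     (intro continuous_on_component continuous_on_id)

lemma borel_measurable_matrix_vector_mult [measurable (raw)]:
  fixes f :: "'a \<Rightarrow> real^'n^'m"
  assumes [measurable]: "f \<in> borel_measurable M" "g \<in> borel_measurable M"
  shows "(\<lambda>x. f x *v g x) \<in> borel_measurable M"
  unfolding matrix_vector_mult_def by measurable

lemma borel_measurable_det [measurable (raw)]:
  fixes f :: "'a \<Rightarrow> real^'n^'n"
  assumes [measurable]: "f \<in> borel_measurable M"
  shows "(\<lambda>x. det (f x)) \<in> borel_measurable M"
  unfolding det_def by measurable

lemma borel_measurable_trace [measurable (raw)]:
  fixes f :: "'a \<Rightarrow> real^'n^'n"
  assumes [measurable]: "f \<in> borel_measurable M"
  shows "(\<lambda>x. trace (f x)) \<in> borel_measurable M"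
  unfolding trace_def by measurable

lemma borel_measurable_matrix_matrix_mult [measurable (raw)]:
  fixes f :: "'a \<Rightarrow> real^'n^'m" and g :: "'a \<Rightarrow> real^'p^'n"
  assumes [measurable]: "f \<in> borel_measurable M" "g \<in> borel_measurable M"
  shows "(\<lambda>x. f x ** g x) \<in> borel_measurable M"
  unfolding matrix_matrix_mult_def by measurable

lemma matrix_inv_cramer:
  fixes A :: "real^'d^'d"
  assumes "det A \<noteq> 0"
  shows "matrix_inv A = (\<chi> i j. det (\<chi> p q. if q = i then axis j 1 $ p else A $ p $ q) / det A)"
proof -
  obtain V where V: "A ** V = mat 1"
    using assms invertible_det_nz unfolding invertible_def by blast
  have "A *v (column j V) = axis j 1" for j
    using V by (simp add: vec_eq_iff matrix_vector_mult_def column_def matrix_matrix_mult_def mat_def axis_def)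
  then have "column j V = (\<chi> k. det (\<chi> p q. if q = k then (axis j 1 :: real^'d) $ p else A $ p $ q) / det A)" for j
    using cramer[OF assms] by blast
  then have "V $ i $ j = det (\<chi> p q. if q = i then axis j 1 $ p else A $ p $ q) / det A" for i j
    by (simp add: vec_eq_iff column_def)
  then show ?thesis
    using matrix_inv_unique[OF V] by (simp add: vec_eq_iff)
qed

text \<open>
  Cramer's rule expresses the inverse by determinants. On singular matrices \<open>matrix_inv\<close> is one fixed
  unspecified matrix, so it is measurable on the whole matrix space.
\<close>

lemma borel_measurable_matrix_inv [measurable (raw)]:
  fixes f :: "'a \<Rightarrow> real^'d^'d"
  assumes [measurable]: "f \<in> borel_measurable M"
  shows "(\<lambda>x. matrix_inv (f x)) \<in> borel_measurable M"
proof -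
  have singular: "matrix_inv A = (SOME V. False)" if "det A = 0" for A :: "real^'d^'d"
    unfolding matrix_inv_def using that by (metis det_I det_mul mult_zero_left zero_neq_one)
  have "matrix_inv (f x) = (if det (f x) = 0 then (SOME V. False)
      else (\<chi> i j. det (\<chi> p q. if q = i then axis j 1 $ p else f x $ p $ q) / det (f x)))" for x
    using singular matrix_inv_cramer by auto
  moreover have "(\<lambda>x. if det (f x) = 0 then (SOME V. False)
      else (\<chi> i j. det (\<chi> p q. if q = i then axis j 1 $ p else f x $ p $ q) / det (f x)))
      \<in> borel_measurable M"
    by measurable
  ultimately show ?thesis by simp
qed

text \<open>
  The matrices whose form is not positive somewhere on the unit sphere are the projection of a closed
  set along a compact one, hence closed.
\<close>

lemma sets_pos_def: "{A :: real^'d^'d. pos_def A} \<in> sets borel"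
proof -
  let ?T = "{(v, A). v \<bullet> ((A :: real^'d^'d) *v v) \<le> 0}"
  have "continuous_on UNIV (\<lambda>(v, A). v \<bullet> ((A :: real^'d^'d) *v v))"
    unfolding case_prod_beta inner_vec_def matrix_vector_mult_def
    by (intro continuous_intros)
  then have "closed ?T"
    using closed_Collect_le[of "\<lambda>(v, A). v \<bullet> ((A :: real^'d^'d) *v v)" "\<lambda>_. 0"]
    by (simp add: case_prod_unfold)
  then have "closed {A :: real^'d^'d. \<exists>v. v \<in> sphere 0 1 \<and> (v, A) \<in> ?T}"
    by (rule closed_compact_projection[OF compact_sphere])
  then have [measurable]: "{A :: real^'d^'d. \<exists>v. v \<in> sphere 0 1 \<and> (v, A) \<in> ?T} \<in> sets borel"
    by simp
  have "{A :: real^'d^'d. pos_def A} = {A. \<forall>i j. A $ i $ j = A $ j $ i} \<inter>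
      (- {A. \<exists>v. v \<in> sphere 0 1 \<and> (v, A) \<in> ?T})"
  proof (intro set_eqI iffI)
    fix A :: "real^'d^'d" assume "A \<in> {A. pos_def A}"
    then have A: "pos_def A" by simp
    have "\<not> v \<bullet> (A *v v) \<le> 0" if "norm v = 1" for v
      using A that unfolding pos_def_def by (metis norm_zero not_le zero_neq_one)
    then show "A \<in> {A. \<forall>i j. A $ i $ j = A $ j $ i} \<inter> (- {A. \<exists>v. v \<in> sphere 0 1 \<and> (v, A) \<in> ?T})"
      using pos_def_nth_commute[OF A] by auto
  next
    fix A :: "real^'d^'d"
    assume "A \<in> {A. \<forall>i j. A $ i $ j = A $ j $ i} \<inter> (- {A. \<exists>v. v \<in> sphere 0 1 \<and> (v, A) \<in> ?T})"
    then have sym: "\<forall>i j. A $ i $ j = A $ j $ i" and pos: "\<And>v. norm v = 1 \<Longrightarrow> v \<bullet> (A *v v) > 0"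
      by (auto simp: not_le)
    have "v \<bullet> (A *v v) > 0" if "v \<noteq> 0" for v
    proof -
      define w where "w = (1 / norm v) *\<^sub>R v"
      have v: "v = norm v *\<^sub>R w" using that by (simp add: w_def)
      have "v \<bullet> (A *v v) = (norm v)\<^sup>2 * (w \<bullet> (A *v w))"
        by (subst (1 2) v) (simp add: matrix_vector_mult_scaleR power2_eq_square)
      moreover have "norm w = 1" using that by (simp add: w_def)
      ultimately show ?thesis using pos[of w] that by simp
    qed
    with sym show "A \<in> {A. pos_def A}" by (simp add: pos_def_def transpose_def vec_eq_iff)
  qed
  also have "\<dots> \<in> sets borel"
    by measurable
  finally show ?thesis .
qed

section \<open>Bordering a principal block\<close>

lemma pos_def_principal_block:
  fixes A :: "real^'d^'d"
  assumes "pos_def A"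
  shows "pos_def (principal_block S A)"
  unfolding pos_def_def
proof (intro conjI allI impI)
  show "transpose (principal_block S A) = principal_block S A"
    using pos_def_nth_commute[OF assms] by (simp add: vec_eq_iff transpose_def principal_block_nth eq_commute)
  fix v :: "real^'d" assume "v \<noteq> 0"
  define u where "u = (\<chi> i. if i \<in> S then v $ i else 0)"
  have "(principal_block S A *v v) $ i = (if i \<in> S then (A *v u) $ i else v $ i)" for i
  proof (cases "i \<in> S")
    case True
    then show ?thesis
      by (auto simp: matrix_vector_mult_def principal_block_nth u_def intro!: sum.cong)
  next
    case False
    then show ?thesis
      by (simp add: matrix_vector_mult_def principal_block_nth of_bool_def if_distrib[of "\<lambda>y. y * _"] cong: if_cong)
  qed
  then have "v \<bullet> (principal_block S A *v v) = (\<Sum>i\<in>UNIV. u $ i * (A *v u) $ i + (v $ i - u $ i)\<^sup>2)"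
    unfolding inner_vec_def by (intro sum.cong) (auto simp: u_def power2_eq_square)
  also have "\<dots> = u \<bullet> (A *v u) + (norm (v - u))\<^sup>2"
    unfolding power2_norm_eq_inner by (simp add: sum.distrib inner_vec_def power2_eq_square)
  also have "\<dots> > 0"
  proof (cases "u = 0")
    case True
    then show ?thesis using \<open>v \<noteq> 0\<close> by simp
  next
    case False
    then have "u \<bullet> (A *v u) > 0" using assms by (simp add: pos_def_def)
    then show ?thesis by (intro add_pos_nonneg) auto
  qed
  finally show "v \<bullet> (principal_block S A *v v) > 0" .
qed

text \<open>
  \<open>A\<close> is the block \<open>N\<close> on \<open>S\<close>, bordered by the row \<open>b\<close> and the diagonal entry \<open>A $ k $ k\<close>. All three
  claims come from the vector \<open>u = e - w\<close>, where \<open>e\<close> is the \<open>k\<close>-th unit vector and \<open>Nw = b\<close>: it satisfies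
  \<open>Au = s e\<close>, so that \<open>u \<bullet> Au = s\<close> is positive, Cramer's rule for this equation gives the determinant,
  and the inverse of \<open>A\<close> is \<open>N\<^sup>-\<^sup>1 - e e\<^sup>T + u u\<^sup>T / s\<close>.
\<close>

lemma
  fixes A :: "real^'d^'d"
  assumes A: "pos_def A" and block: "principal_block (insert k S) A = A" and k: "k \<notin> S"
  defines "b \<equiv> \<chi> i. if i \<in> S then A $ k $ i else 0"
  defines "w \<equiv> matrix_inv (principal_block S A) *v b"
  defines "s \<equiv> A $ k $ k - b \<bullet> w"
  shows bordered_pivot_pos: "s > 0"
    and bordered_det: "det A = s * det (principal_block S A)"
    and bordered_trace_inv: "trace (matrix_inv A) =
      trace (matrix_inv (principal_block S A)) - 1 + (1 + (norm w)\<^sup>2) / s"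
proof -
  let ?N = "principal_block S A"
  let ?P = "matrix_inv ?N"
  define e :: "real^'d" where "e = axis k 1"
  define u where "u = e - w"
  note N = pos_def_principal_block[OF A, of S]
  note P = pos_def_matrix_inv[OF N]
  have A0: "A $ i $ j = of_bool (i = j)" if "i \<notin> insert k S \<or> j \<notin> insert k S" for i j
    using that principal_block_nth[of "insert k S" A i j] unfolding block by (auto split: if_splits)
  have entry: "A $ i $ j = ?N $ i $ j + e $ i * b $ j + b $ i * e $ j + (A $ k $ k - 1) * (e $ i * e $ j)" for i j
    using k A0[of i j] pos_def_nth_commute[OF A, of i j]
    by (auto simp: principal_block_nth e_def b_def axis_def)
  have mult: "A *v y = ?N *v y + (b \<bullet> y) *\<^sub>R e + (y $ k) *\<^sub>R b + ((A $ k $ k - 1) * y $ k) *\<^sub>R e" for y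
  proof (simp add: vec_eq_iff, intro allI)
    fix i
    have e_sum: "(\<Sum>j\<in>UNIV. e $ j * y $ j) = y $ k"
      by (simp add: e_def axis_def if_distrib[of "\<lambda>x. x * _"] cong: if_cong)
    have "(A *v y) $ i = (\<Sum>j\<in>UNIV. ?N $ i $ j * y $ j) + e $ i * (\<Sum>j\<in>UNIV. b $ j * y $ j)
        + b $ i * (\<Sum>j\<in>UNIV. e $ j * y $ j) + (A $ k $ k - 1) * e $ i * (\<Sum>j\<in>UNIV. e $ j * y $ j)"
      unfolding matrix_vector_mult_def vec_lambda_beta
      by (subst entry) (simp add: sum.distrib sum_subtractf sum_distrib_left algebra_simps)
    then show "(A *v y) $ i = (?N *v y) $ i + b \<bullet> y * e $ i + y $ k * b $ i + (A $ k $ k - 1) * y $ k * e $ i"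
      unfolding e_sum by (simp add: matrix_vector_mult_def inner_vec_def algebra_simps)
  qed
  have NP: "?N *v (?P *v y) = y" for y
    using P(1) by (simp add: matrix_vector_mul_assoc)
  have N_k: "(?N *v y) $ k = y $ k" for y
    using k by (simp add: matrix_vector_mult_def principal_block_nth of_bool_def if_distrib[of "\<lambda>x. x * _"] cong: if_cong)
  have P_k: "(?P *v y) $ k = y $ k" for y
    using N_k[of "?P *v y"] by (simp add: NP)
  have N_e: "?N *v e = e"
    unfolding e_def matrix_vector_mult_basis
    using k by (simp add: column_def vec_eq_iff principal_block_nth axis_def)
  have b_k: "b $ k = 0" using k by (simp add: b_def)
  have w_k: "w $ k = 0" using P_k[of b] b_k by (simp add: w_def)
  have e_k: "e $ k = 1" by (simp add: e_def)
  have inner_e: "y \<bullet> e = y $ k" "e \<bullet> y = y $ k" for y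
    by (simp_all add: e_def inner_axis inner_axis')
  have Nw: "?N *v w = b" by (simp add: w_def NP)
  have Au: "A *v u = s *\<^sub>R e"
    unfolding mult u_def
    by (simp add: matrix_vector_mult_diff_distrib N_e Nw inner_diff_right inner_e b_k w_k e_k s_def algebra_simps)
  have u_k: "u $ k = 1" by (simp add: u_def w_k e_k)
  then have "u \<noteq> 0" by auto
  then have "u \<bullet> (A *v u) > 0" using A by (simp add: pos_def_def)
  then show s: "s > 0"
    unfolding Au by (simp add: inner_e u_k)
  show "det A = s * det ?N"
  proof -
    \<comment> \<open>Replacing column \<open>k\<close> of \<open>A\<close> by \<open>Au = s e\<close> gives the same matrix as replacing row \<open>k\<close> of the block by
      \<open>b + s e = N (w + s e)\<close>; Cramer's rule applies to both descriptions.\<close>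
    let ?x = "w + s *\<^sub>R e"
    have "(\<Sum>i\<in>UNIV. ?x $ i *s row i ?N) = ?N *v ?x"
      using pos_def_nth_commute[OF N]
      unfolding vec_eq_iff matrix_vector_mult_def by (simp add: row_def algebra_simps)
    also have "\<dots> = b + s *\<^sub>R e"
      by (simp add: matrix_vector_right_distrib Nw N_e matrix_vector_mult_scaleR)
    finally have x: "(\<Sum>i\<in>UNIV. ?x $ i *s row i ?N) = b + s *\<^sub>R e" .
    have "det A = det (\<chi> i j. if j = k then (A *v u) $ i else A $ i $ j)"
      by (simp add: cramer_lemma u_k)
    also have "(\<chi> i j. if j = k then (A *v u) $ i else A $ i $ j) =
        (\<chi> i. if i = k then (\<Sum>i\<in>UNIV. ?x $ i *s row i ?N) else row i ?N)"
      unfolding x Au using k A0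
      by (auto simp: vec_eq_iff row_def principal_block_nth b_def e_def axis_def)
    also have "det \<dots> = s * det ?N"
      by (subst cramer_lemma_transpose) (simp add: w_k e_k)
    finally show ?thesis .
  qed
  show "trace (matrix_inv A) = trace ?P - 1 + (1 + (norm w)\<^sup>2) / s"
  proof -
    define V where "V = (\<chi> i j. ?P $ i $ j - e $ i * e $ j + u $ i * u $ j / s)"
    have V: "V *v y = ?P *v y - (y $ k) *\<^sub>R e + ((u \<bullet> y) / s) *\<^sub>R u" for y
    proof (simp add: vec_eq_iff, intro allI)
      fix i
      have "(V *v y) $ i = (\<Sum>j\<in>UNIV. ?P $ i $ j * y $ j) - e $ i * (\<Sum>j\<in>UNIV. e $ j * y $ j)
          + u $ i * (\<Sum>j\<in>UNIV. u $ j * y $ j) / s"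
        unfolding matrix_vector_mult_def vec_lambda_beta V_def
        by (simp add: sum.distrib sum_subtractf sum_distrib_left sum_divide_distrib algebra_simps)
      then show "(V *v y) $ i = (?P *v y) $ i - y $ k * e $ i + (u \<bullet> y) * u $ i / s"
        using inner_e(2)[of y] by (simp add: matrix_vector_mult_def inner_vec_def algebra_simps)
    qed
    have "A *v (V *v y) = y" for y
    proof -
      have "b \<bullet> (?P *v y) = w \<bullet> y"
        unfolding w_def by (rule pos_def_inner_commute[OF P(3)])
      then have "A *v (?P *v y) = y + (w \<bullet> y) *\<^sub>R e + (y $ k) *\<^sub>R b + ((A $ k $ k - 1) * y $ k) *\<^sub>R e"
        by (simp add: mult NP P_k)
      moreover have "A *v e = b + (A $ k $ k) *\<^sub>R e"
        by (simp add: mult N_e inner_e b_k e_k algebra_simps)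
      moreover have "A *v (V *v y) = A *v (?P *v y) - (y $ k) *\<^sub>R (A *v e) + ((u \<bullet> y) / s) *\<^sub>R (s *\<^sub>R e)"
        unfolding V Au[symmetric]
        by (simp add: matrix_vector_right_distrib matrix_vector_mult_diff_distrib matrix_vector_mult_scaleR)
      moreover have "((u \<bullet> y) / s) *\<^sub>R (s *\<^sub>R e) = (y $ k - w \<bullet> y) *\<^sub>R e"
        using s by (simp add: u_def inner_diff_left inner_e)
      ultimately have "A *v (V *v y) = (y + (w \<bullet> y) *\<^sub>R e + (y $ k) *\<^sub>R b + ((A $ k $ k - 1) * y $ k) *\<^sub>R e)
          - (y $ k) *\<^sub>R (b + (A $ k $ k) *\<^sub>R e) + (y $ k - w \<bullet> y) *\<^sub>R e"
        by (simp only:)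
      then show ?thesis
        by (simp add: algebra_simps)
    qed
    then have "A ** V = mat 1"
      by (simp add: matrix_eq matrix_vector_mul_assoc)
    then have "trace (matrix_inv A) = trace V" by (simp add: matrix_inv_unique)
    also have "\<dots> = trace ?P - e \<bullet> e + (u \<bullet> u) / s"
      by (simp add: trace_def V_def sum.distrib sum_subtractf inner_vec_def sum_divide_distrib)
    also have "u \<bullet> u = 1 + (norm w)\<^sup>2"
      by (simp add: u_def inner_diff_left inner_diff_right inner_e e_k w_k power2_norm_eq_inner)
    also have "e \<bullet> e = 1" by (simp add: inner_e e_k)
    finally show ?thesis .
  qed
qed

section \<open>Gaussian integrals\<close>

lemma nn_integral_gaussian_1d:
  fixes c t \<beta> :: real
  assumes "c > 0" "t > 0"
  shows "(\<integral>\<^sup>+y. ennreal (exp (- (t * (c * y + \<beta>)\<^sup>2))) \<partial>lborel) = ennreal (sqrt (pi / t) / c)"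
proof -
  define \<sigma> where "\<sigma> = 1 / (c * sqrt (2 * t))"
  have \<sigma>: "\<sigma> > 0" using assms by (simp add: \<sigma>_def)
  have \<sigma>2: "\<sigma>\<^sup>2 = 1 / (2 * t * c\<^sup>2)"
    using assms by (simp add: \<sigma>_def power_divide power_mult_distrib)
  have root: "sqrt (2 * pi * \<sigma>\<^sup>2) = sqrt (pi / t) / c"
    using assms by (simp add: \<sigma>2 real_sqrt_divide real_sqrt_mult)
  have "exp (- (t * (c * y + \<beta>)\<^sup>2)) = sqrt (pi / t) / c * normal_density (- \<beta> / c) \<sigma> y" for y
  proof -
    have "c * y + \<beta> = c * (y - (- \<beta> / c))" using assms by (simp add: field_simps)
    then have "t * (c * y + \<beta>)\<^sup>2 = (y - (- \<beta> / c))\<^sup>2 / (2 * \<sigma>\<^sup>2)"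
      using assms by (simp add: \<sigma>2 power_mult_distrib)
    moreover have "sqrt (pi / t) / c > 0" using assms by simp
    ultimately show ?thesis
      unfolding normal_density_def root using assms by simp
  qed
  then have "(\<integral>\<^sup>+y. ennreal (exp (- (t * (c * y + \<beta>)\<^sup>2))) \<partial>lborel) =
      (\<integral>\<^sup>+y. ennreal (sqrt (pi / t) / c) * ennreal (normal_density (- \<beta> / c) \<sigma> y) \<partial>lborel)"
    using assms by (simp add: ennreal_mult[symmetric])
  also have "\<dots> = ennreal (sqrt (pi / t) / c) * (\<integral>\<^sup>+y. ennreal (normal_density (- \<beta> / c) \<sigma> y) \<partial>lborel)"
    by (rule nn_integral_cmult) simp
  also have "(\<integral>\<^sup>+y. ennreal (normal_density (- \<beta> / c) \<sigma> y) \<partial>lborel) = 1"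
    using \<sigma> by (subst nn_integral_eq_integral) auto
  finally show ?thesis by simp
qed

text \<open>
  Coordinates of a product space that are indexed by \<open>e i\<close> for \<open>i \<in> S\<close>, read as a vector. The reindexing
  \<open>e\<close> allows a row of a symmetric matrix, whose entries are indexed by the pairs \<open>{k, j}\<close>, to be used as a
  vector.
\<close>

definition extend_zero :: "'d::finite set \<Rightarrow> ('d \<Rightarrow> 'i) \<Rightarrow> ('i \<Rightarrow> real) \<Rightarrow> real^'d" where
  "extend_zero S e z = (\<chi> i. if i \<in> S then z (e i) else 0)"

lemma measurable_extend_zero:
  assumes "e ` S \<subseteq> J"
  shows "extend_zero S e \<in> borel_measurable (Pi\<^sub>M J (\<lambda>_. lborel))"
  unfolding extend_zero_def
proof (rule borel_measurable_vec_lambda)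
  fix i show "(\<lambda>z. if i \<in> S then z (e i) else 0) \<in> borel_measurable (Pi\<^sub>M J (\<lambda>_. lborel))"
    using assms by (cases "i \<in> S") auto
qed

interpretation lborel_product: product_sigma_finite "\<lambda>_ :: 'i. lborel :: real measure"
  by standard

text \<open>
  Induction on \<open>S\<close>: completing the square in one coordinate leaves a one-dimensional Gaussian integral and
  the form of the Schur complement in the remaining coordinates.
\<close>

lemma nn_integral_gaussian_PiM:
  fixes A :: "real^'d^'d"
  assumes "t > 0" "inj_on e S" "pos_def A" "principal_block S A = A"
  shows "(\<integral>\<^sup>+z. ennreal (exp (- (t * (extend_zero S e z \<bullet> (A *v extend_zero S e z))))) \<partial>Pi\<^sub>M (e ` S) (\<lambda>_. lborel))
    = ennreal (sqrt (pi / t) ^ card S / sqrt (det A))"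
  using finite[of S] assms(2-4)
proof (induction S arbitrary: A rule: finite_induct)
  case empty
  then have "A = mat 1"
    by (simp add: principal_block_def mat_def of_bool_def)
  moreover have "extend_zero {} e z = 0" for z
    by (simp add: extend_zero_def vec_eq_iff)
  ultimately show ?case
    by (simp add: PiM_empty nn_integral_count_space_finite)
next
  case (insert k S)
  let ?C = "schur_complement k A" and ?a = "A $ k $ k"
  have a: "?a > 0" by (rule pos_def_diag_pos[OF insert.prems(2)])
  have C: "pos_def ?C" by (rule pos_def_schur_complement[OF insert.prems(2)])
  have block: "principal_block S ?C = ?C"
    using principal_block_schur_complement[OF insert.prems(3)] insert.hyps by simp
  have e: "inj_on e S" "e k \<notin> e ` S"
    using insert.prems(1) insert.hyps(2) by (simp_all add: inj_on_insert)
  have e_neq: "e i \<noteq> e k" if "i \<in> S" for i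
    using e(2) imageI[OF that, of e] by metis
  note [measurable] = measurable_extend_zero[OF order.refl]
  have form: "extend_zero (insert k S) e (x(e k := y)) \<bullet> (A *v extend_zero (insert k S) e (x(e k := y))) =
      extend_zero S e x \<bullet> (?C *v extend_zero S e x) +
      (sqrt ?a * y + (A $ k \<bullet> extend_zero S e x) / sqrt ?a)\<^sup>2" for x y
  proof -
    let ?u = "extend_zero S e x" and ?v = "extend_zero (insert k S) e (x(e k := y))"
    let ?\<eta> = "sqrt ?a * y + (A $ k \<bullet> ?u) / sqrt ?a"
    have v: "?v = ?u + y *\<^sub>R axis k 1"
      using insert.hyps e_neq by (auto simp: vec_eq_iff extend_zero_def axis_def)
    have u_k: "?u $ k = 0" using insert.hyps by (simp add: extend_zero_def)
    have "(A $ k \<bullet> ?v) / sqrt ?a = ?\<eta>"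
      unfolding v using a by (simp add: inner_add_right inner_axis field_simps)
    then have G: "elimination k A *v ?v = ?u + ?\<eta> *\<^sub>R axis k 1"
      using u_k by (simp add: vec_eq_iff elimination_mult_nth) (auto simp: v axis_def)
    have "?C *v axis k 1 = axis k 1"
      unfolding matrix_vector_mult_basis
      by (simp add: column_def vec_eq_iff schur_complement_nth axis_def)
    then have "(?u + ?\<eta> *\<^sub>R axis k 1) \<bullet> (?C *v (?u + ?\<eta> *\<^sub>R axis k 1)) =
        ?u \<bullet> (?C *v ?u) + ?\<eta>\<^sup>2"
      using pos_def_inner_commute[OF C, of "axis k 1" ?u] u_k
      by (simp add: matrix_vector_right_distrib matrix_vector_mult_scaleR inner_add_left
          inner_add_right inner_axis inner_axis' power2_eq_square)
    then show ?thesis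
      by (subst schur_complement_factorization[OF insert.prems(2), of k])
         (simp only: quadratic_form_transpose_mult G)
  qed
  have "(\<integral>\<^sup>+z. ennreal (exp (- (t * (extend_zero (insert k S) e z \<bullet> (A *v extend_zero (insert k S) e z)))))
        \<partial>Pi\<^sub>M (e ` insert k S) (\<lambda>_. lborel)) =
      (\<integral>\<^sup>+x. \<integral>\<^sup>+y. ennreal (exp (- (t * (extend_zero S e x \<bullet> (?C *v extend_zero S e x) +
        (sqrt ?a * y + (A $ k \<bullet> extend_zero S e x) / sqrt ?a)\<^sup>2)))) \<partial>lborel \<partial>Pi\<^sub>M (e ` S) (\<lambda>_. lborel))"
  proof -
    have "finite (e ` S)" using insert.hyps by simp
    moreover have "(\<lambda>z. ennreal (exp (- (t * (extend_zero (insert k S) e z \<bullet> (A *v extend_zero (insert k S) e z))))))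
        \<in> borel_measurable (Pi\<^sub>M (insert (e k) (e ` S)) (\<lambda>_. lborel))"
      using measurable_extend_zero[of e "insert k S" "insert (e k) (e ` S)"] by measurable simp
    ultimately show ?thesis
      unfolding image_insert form[symmetric] by (intro lborel_product.product_nn_integral_insert e(2))
  qed
  also have "\<dots> = (\<integral>\<^sup>+x. ennreal (exp (- (t * (extend_zero S e x \<bullet> (?C *v extend_zero S e x))))) *
      ennreal (sqrt (pi / t) / sqrt ?a) \<partial>Pi\<^sub>M (e ` S) (\<lambda>_. lborel))"
  proof (rule nn_integral_cong)
    fix x
    have "(\<integral>\<^sup>+y. ennreal (exp (- (t * (extend_zero S e x \<bullet> (?C *v extend_zero S e x) +
        (sqrt ?a * y + (A $ k \<bullet> extend_zero S e x) / sqrt ?a)\<^sup>2)))) \<partial>lborel) =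
      (\<integral>\<^sup>+y. ennreal (exp (- (t * (extend_zero S e x \<bullet> (?C *v extend_zero S e x))))) *
        ennreal (exp (- (t * (sqrt ?a * y + (A $ k \<bullet> extend_zero S e x) / sqrt ?a)\<^sup>2))) \<partial>lborel)"
      by (simp add: ennreal_mult[symmetric] distrib_left exp_add[symmetric])
    also have "\<dots> = ennreal (exp (- (t * (extend_zero S e x \<bullet> (?C *v extend_zero S e x))))) *
        ennreal (sqrt (pi / t) / sqrt ?a)"
      using a assms(1) by (subst nn_integral_cmult) (auto simp: nn_integral_gaussian_1d)
    finally show "(\<integral>\<^sup>+y. ennreal (exp (- (t * (extend_zero S e x \<bullet> (?C *v extend_zero S e x) +
        (sqrt ?a * y + (A $ k \<bullet> extend_zero S e x) / sqrt ?a)\<^sup>2)))) \<partial>lborel) =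
      ennreal (exp (- (t * (extend_zero S e x \<bullet> (?C *v extend_zero S e x))))) * ennreal (sqrt (pi / t) / sqrt ?a)" .
  qed
  also have "\<dots> = ennreal (sqrt (pi / t) ^ card S / sqrt (det ?C)) * ennreal (sqrt (pi / t) / sqrt ?a)"
    using insert.IH[OF e(1) C block] by (subst nn_integral_multc) auto
  also have "\<dots> = ennreal (sqrt (pi / t) ^ card (insert k S) / sqrt (det A))"
    using insert.hyps a assms(1) pos_def_det_pos[OF C]
    by (simp add: ennreal_mult[symmetric] det_schur_complement[OF insert.prems(2), of k] real_sqrt_mult mult_ac)
  finally show ?case .
qed

text \<open>
  Transfers the Gaussian integral from the product space to the space of vectors.
\<close>

lemma lborel_vec_eq_PiM:
  "(lborel :: (real^'d) measure) = distr (Pi\<^sub>M UNIV (\<lambda>_. lborel)) borel (\<lambda>z. \<chi> i. z i)"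
proof (rule lborel_eqI)
  fix l u :: "real^'d"
  assume le: "\<And>b. b \<in> Basis \<Longrightarrow> l \<bullet> b \<le> u \<bullet> b"
  have le': "l $ i \<le> u $ i" for i
    using le[of "axis i 1"] by (simp add: inner_axis)
  have "(\<lambda>z. \<chi> i. z i) -` box l u \<inter> space (Pi\<^sub>M UNIV (\<lambda>_. lborel)) = Pi\<^sub>E UNIV (\<lambda>i. {l $ i <..< u $ i})"
    by (auto simp: space_PiM mem_box_cart PiE_def Pi_def)
  then have "emeasure (distr (Pi\<^sub>M UNIV (\<lambda>_. lborel)) borel (\<lambda>z. \<chi> i. z i)) (box l u) =
      (\<Prod>i\<in>UNIV. ennreal (u $ i - l $ i))"
    using le' by (subst emeasure_distr) (auto simp: lborel_product.emeasure_PiM)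
  also have "\<dots> = ennreal (\<Prod>i\<in>UNIV. u $ i - l $ i)"
    using le' by (simp add: prod_ennreal)
  also have "(\<Prod>i\<in>UNIV. u $ i - l $ i) = (\<Prod>b\<in>Basis. (u - l) \<bullet> b)"
  proof -
    have basis: "(Basis :: (real^'d) set) = (\<lambda>i. axis i 1) ` UNIV"
      by (auto simp: Basis_vec_def)
    have inj: "inj (\<lambda>i :: 'd. axis i (1 :: real))"
      by (auto simp: inj_def axis_eq_axis)
    show ?thesis
      unfolding basis prod.reindex[OF inj] by (simp add: inner_axis)
  qed
  finally show "emeasure (distr (Pi\<^sub>M UNIV (\<lambda>_. lborel)) borel (\<lambda>z. \<chi> i. z i)) (box l u)
      = ennreal (\<Prod>b\<in>Basis. (u - l) \<bullet> b)" .
qed simp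

lemma nn_integral_gaussian:
  fixes A :: "real^'d^'d"
  assumes "t > 0" "pos_def A"
  shows "(\<integral>\<^sup>+v. ennreal (exp (- (t * ((v - c) \<bullet> (A *v (v - c)))))) \<partial>lborel)
    = ennreal (sqrt (pi / t) ^ CARD('d) / sqrt (det A))"
proof -
  have "(\<integral>\<^sup>+v. ennreal (exp (- (t * ((v - c) \<bullet> (A *v (v - c)))))) \<partial>lborel) =
      (\<integral>\<^sup>+v. ennreal (exp (- (t * ((v - c) \<bullet> (A *v (v - c)))))) \<partial>distr lborel borel ((+) c))"
    by (simp add: lborel_distr_plus)
  also have "\<dots> = (\<integral>\<^sup>+v. ennreal (exp (- (t * (v \<bullet> (A *v v))))) \<partial>lborel)"
    by (subst nn_integral_distr) auto
  also have "\<dots> = (\<integral>\<^sup>+z. ennreal (exp (- (t * (extend_zero UNIV id z \<bullet> (A *v extend_zero UNIV id z)))))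
      \<partial>Pi\<^sub>M UNIV (\<lambda>_. lborel))"
    by (subst lborel_vec_eq_PiM, subst nn_integral_distr) (auto simp: extend_zero_def)
  also have "\<dots> = ennreal (sqrt (pi / t) ^ CARD('d) / sqrt (det A))"
    using nn_integral_gaussian_PiM[of t id UNIV A] assms by simp
  finally show ?thesis .
qed

section \<open>Finiteness of the inverse Wishart integral\<close>

text \<open>
  From \<open>ln y \<le> y - 1\<close> at \<open>y = c u / \<beta>\<close>. This is the estimate by which exponentials absorb powers.
\<close>

lemma powr_mult_exp_bounded:
  fixes \<beta> c :: real
  assumes "\<beta> > 0" "c > 0"
  obtains C where "C > 0" "\<And>u. u \<ge> 0 \<Longrightarrow> u powr \<beta> * exp (- c * u) \<le> C"
proof (rule that)
  let ?C = "exp (\<beta> * (ln (\<beta> / c) - 1))"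
  show "?C > 0" by simp
  fix u :: real assume "u \<ge> 0"
  show "u powr \<beta> * exp (- c * u) \<le> ?C"
  proof (cases "u = 0")
    case False
    with \<open>u \<ge> 0\<close> have u: "u > 0" by simp
    have "ln u - ln (\<beta> / c) = ln (c * u / \<beta>)"
      using u assms by (simp add: ln_div ln_mult)
    also have "\<dots> \<le> c * u / \<beta> - 1"
      using u assms by (intro ln_le_minus_one) simp
    finally have "\<beta> * ln u \<le> \<beta> * (ln (\<beta> / c) + (c * u / \<beta> - 1))"
      using assms by (intro mult_left_mono) auto
    also have "\<dots> = \<beta> * (ln (\<beta> / c) - 1) + c * u"
      using assms by (simp add: algebra_simps)
    finally show ?thesis
      using u by (simp add: powr_def exp_add[symmetric])
  qed (use assms in simp)
qed

lemma nn_integral_powr_exp_inverse_finite: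
  fixes \<beta> c :: real
  assumes "\<beta> > 1" "c > 0"
  shows "(\<integral>\<^sup>+s. ennreal (if s > 0 then s powr (- \<beta>) * exp (- c / s) else 0) \<partial>lborel) < \<infinity>"
proof -
  obtain C where C: "C > 0" "\<And>u. u \<ge> 0 \<Longrightarrow> u powr \<beta> * exp (- c * u) \<le> C"
    using powr_mult_exp_bounded[of \<beta> c] assms by auto
  have tail: "(\<integral>\<^sup>+s. ennreal (s powr (- \<beta>)) * indicator {1..} s \<partial>lborel) = ennreal (0 - (- (1 powr (1 - \<beta>)) / (\<beta> - 1)))"
  proof (rule nn_integral_FTC_atLeast[where F="\<lambda>s. - (s powr (1 - \<beta>)) / (\<beta> - 1)"])
    fix s :: real assume "1 \<le> s"
    then have "((\<lambda>s. - (s powr (1 - \<beta>)) / (\<beta> - 1)) has_real_derivative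
        - ((1 - \<beta>) * s powr (1 - \<beta> - 1)) / (\<beta> - 1)) (at s)"
      by (intro DERIV_cdivide DERIV_minus has_real_derivative_powr) simp
    also have "- ((1 - \<beta>) * s powr (1 - \<beta> - 1)) / (\<beta> - 1) = s powr (- \<beta>)"
      using assms by (simp add: divide_eq_eq algebra_simps)
    finally show "((\<lambda>s. - (s powr (1 - \<beta>)) / (\<beta> - 1)) has_real_derivative s powr (- \<beta>)) (at s)" .
  next
    show "((\<lambda>s. - (s powr (1 - \<beta>)) / (\<beta> - 1)) \<longlongrightarrow> 0) at_top"
    proof -
      have "((\<lambda>s :: real. s powr (1 - \<beta>)) \<longlongrightarrow> 0) at_top"
        using assms by (intro tendsto_neg_powr filterlim_ident) simp
      from tendsto_divide_zero[OF tendsto_minus[OF this, unfolded minus_zero], of "\<beta> - 1"]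
      show ?thesis .
    qed
  qed auto
  have "(\<integral>\<^sup>+s. ennreal (if s > 0 then s powr (- \<beta>) * exp (- c / s) else 0) \<partial>lborel) \<le>
    (\<integral>\<^sup>+s. ennreal C * indicator {0..1} s + ennreal (s powr (- \<beta>)) * indicator {1..} s \<partial>lborel)"
  proof (rule nn_integral_mono)
    fix s :: real
    consider "s \<le> 0" | "0 < s" "s < 1" | "s \<ge> 1" by linarith
    then show "ennreal (if s > 0 then s powr (- \<beta>) * exp (- c / s) else 0) \<le>
        ennreal C * indicator {0..1} s + ennreal (s powr (- \<beta>)) * indicator {1..} s"
    proof cases
      case 2
      then have "s powr (- \<beta>) * exp (- c / s) \<le> C"
        using C(2)[of "1 / s"] by (simp add: powr_minus inverse_powr divide_inverse)
      with 2 show ?thesis by (simp add: ennreal_leI)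
    next
      case 3
      then have "s powr (- \<beta>) * exp (- c / s) \<le> s powr (- \<beta>) * 1"
        using assms by (intro mult_left_mono) auto
      with 3 have "ennreal (if s > 0 then s powr (- \<beta>) * exp (- c / s) else 0) \<le>
          ennreal (s powr (- \<beta>)) * indicator {1..} s"
        by (simp add: ennreal_leI)
      then show ?thesis by (rule order_trans) simp
    qed simp
  qed
  also have "\<dots> = ennreal C + ennreal (0 - (- (1 powr (1 - \<beta>)) / (\<beta> - 1)))"
    unfolding tail[symmetric] by (subst nn_integral_add) (auto simp: nn_integral_cmult)
  also have "\<dots> < \<infinity>" by simp
  finally show ?thesis .
qed

text \<open>
  The index set of the coordinates of a symmetric matrix with rows and columns in \<open>S\<close>, in the encoding by
  unordered pairs that underlies \<open>lborel_sym\<close>.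
\<close>

definition index_pairs :: "'d set \<Rightarrow> 'd set set" where
  "index_pairs S = {{i, j} | i j. i \<in> S \<and> j \<in> S}"

definition symmetric_matrix :: "('d::finite set \<Rightarrow> real) \<Rightarrow> real^'d^'d" where
  "symmetric_matrix z = (\<chi> i j. z {i, j})"

lemma index_pairs_insert:
  "index_pairs (insert k S) = insert {k} (index_pairs S \<union> (\<lambda>j. {k, j}) ` S)"
  by (auto simp: index_pairs_def insert_commute)

lemma finite_index_pairs [simp]: "finite (index_pairs (S :: 'd::finite set))"
  by (rule finite_subset[of _ "Pow UNIV"]) auto

lemma measurable_symmetric_block:
  fixes S :: "'d::finite set"
  assumes "index_pairs S \<subseteq> J"
  shows "(\<lambda>z. principal_block S (symmetric_matrix z)) \<in> borel_measurable (Pi\<^sub>M J (\<lambda>_. lborel))"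
  unfolding principal_block_def symmetric_matrix_def
proof (intro borel_measurable_vec_lambda)
  fix i j
  have "{i, j} \<in> J" if "i \<in> S" "j \<in> S"
    using that assms by (auto simp: index_pairs_def)
  then show "(\<lambda>z. if i \<in> S \<and> j \<in> S then (\<chi> p q. z {p, q}) $ i $ j else of_bool (i = j))
      \<in> borel_measurable (Pi\<^sub>M J (\<lambda>_. lborel))"
    by (cases "i \<in> S \<and> j \<in> S") auto
qed

text \<open>
  The inverse Wishart kernel with scale matrix a multiple of the identity, with \<open>\<alpha>\<close> for the exponent
  \<open>(\<nu> + d + 1) / 2\<close>, extended by zero to all matrices. The general kernel is bounded by it, whence the name.
\<close>

definition wishart_bound :: "real \<Rightarrow> real \<Rightarrow> real^'d^'d \<Rightarrow> real" where
  "wishart_bound \<alpha> c A =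
     (if pos_def A then det A powr (- \<alpha>) * exp (- c * trace (matrix_inv A)) else 0)"

lemma measurable_wishart_bound [measurable]: "wishart_bound \<alpha> c \<in> borel_measurable borel"
proof -
  have [measurable]: "Measurable.pred borel (\<lambda>A :: real^'d^'d. pos_def A)"
    using sets_pos_def by (simp add: pred_def)
  show ?thesis unfolding wishart_bound_def by measurable
qed

text \<open>
  The part of the integral that comes from one new row, with \<open>P\<close> the inverse of the block that is
  bordered. For a fixed pivot \<open>s\<close>, the integral over the row is Gaussian with form \<open>P\<^sup>2\<close>, which gives the
  factor \<open>1 / |P|\<close> and \<open>card S\<close> factors \<open>sqrt s\<close>; the integral over \<open>s\<close> then no longer involves \<open>P\<close>.
\<close>

lemma nn_integral_pivot_row:
  fixes e :: "'d::finite \<Rightarrow> 'i" and \<alpha> c :: real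
  assumes "\<alpha> > real (card S) / 2 + 1" "c > 0" and e: "inj_on e S"
  obtains C where "C < \<infinity>"
    "\<And>P :: real^'d^'d. pos_def P \<Longrightarrow> principal_block S P = P \<Longrightarrow>
      (\<integral>\<^sup>+b. \<integral>\<^sup>+s. ennreal (if s > 0 then s powr (- \<alpha>) * exp (- c * (1 + (norm (P *v extend_zero S e b))\<^sup>2) / s) else 0)
        \<partial>lborel \<partial>Pi\<^sub>M (e ` S) (\<lambda>_. lborel)) = C * ennreal (1 / det P)"
proof (rule that)
  let ?n = "card S"
  let ?I = "\<integral>\<^sup>+s. ennreal (if s > 0 then s powr (- (\<alpha> - real ?n / 2)) * exp (- c / s) else 0) \<partial>lborel"
  have "?I < \<infinity>"
    using assms by (intro nn_integral_powr_exp_inverse_finite) auto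
  then show "ennreal (sqrt (pi / c) ^ ?n) * ?I < \<infinity>"
    by (simp add: ennreal_mult_less_top)
  fix P :: "real^'d^'d" assume P: "pos_def P" and block: "principal_block S P = P"
  have sym: "transpose P = P" using P by (simp add: pos_def_def)
  have PP: "pos_def (P ** P)"
  proof -
    have "pos_def (transpose P ** mat 1 ** P)"
      using pos_def_det_nonzero[OF P] by (intro pos_def_congruence) (simp add: pos_def_def)
    then show ?thesis by (simp add: sym)
  qed
  have PP_block: "principal_block S (P ** P) = P ** P"
  proof -
    have P0: "P $ i $ j = of_bool (i = j)" if "i \<notin> S \<or> j \<notin> S" for i j
      using that principal_block_nth[of S P i j] unfolding block by (auto split: if_splits)
    have "(P ** P) $ i $ j = of_bool (i = j)" if ij: "i \<notin> S \<or> j \<notin> S" for i j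
    proof (cases "i \<in> S")
      case False
      then have "(P ** P) $ i $ j = (\<Sum>q\<in>UNIV. of_bool (i = q) * P $ q $ j)"
        by (simp add: matrix_matrix_mult_def P0)
      also have "\<dots> = P $ i $ j"
        by (simp add: of_bool_def if_distrib[of "\<lambda>x. x * _"] cong: if_cong)
      finally show ?thesis using False P0 by simp
    next
      case True
      with ij have j: "j \<notin> S" by simp
      then have "(P ** P) $ i $ j = (\<Sum>q\<in>UNIV. P $ i $ q * of_bool (q = j))"
        by (simp add: matrix_matrix_mult_def P0)
      also have "\<dots> = P $ i $ j"
        by (simp add: of_bool_def if_distrib[of "\<lambda>x. _ * x"] cong: if_cong)
      finally show ?thesis using j P0 by simp
    qed
    then show ?thesis by (auto simp: vec_eq_iff principal_block_nth)
  qed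
  have norm: "(norm (P *v v))\<^sup>2 = v \<bullet> ((P ** P) *v v)" for v
    using quadratic_form_transpose_mult[of v P "mat 1"] by (simp add: sym power2_norm_eq_inner)
  have det: "sqrt (det (P ** P)) = det P"
    using pos_def_det_pos[OF P] by (simp add: det_mul)
  interpret R: sigma_finite_measure "Pi\<^sub>M (e ` S) (\<lambda>_ :: 'i. lborel :: real measure)"
    by (rule lborel_product.sigma_finite) simp
  interpret pair_sigma_finite "Pi\<^sub>M (e ` S) (\<lambda>_ :: 'i. lborel :: real measure)" "lborel :: real measure" ..
  note [measurable] = measurable_extend_zero[OF order.refl]
  have "(\<integral>\<^sup>+b. \<integral>\<^sup>+s. ennreal (if s > 0 then s powr (- \<alpha>) * exp (- c * (1 + (norm (P *v extend_zero S e b))\<^sup>2) / s) else 0)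
        \<partial>lborel \<partial>Pi\<^sub>M (e ` S) (\<lambda>_. lborel)) =
      (\<integral>\<^sup>+s. \<integral>\<^sup>+b. ennreal (if s > 0 then s powr (- \<alpha>) * exp (- c * (1 + (norm (P *v extend_zero S e b))\<^sup>2) / s) else 0)
        \<partial>Pi\<^sub>M (e ` S) (\<lambda>_. lborel) \<partial>lborel)"
    by (rule Fubini'[symmetric]) measurable
  also have "\<dots> = (\<integral>\<^sup>+s. ennreal (sqrt (pi / c) ^ ?n) * ennreal (1 / det P) *
      ennreal (if s > 0 then s powr (- (\<alpha> - real ?n / 2)) * exp (- c / s) else 0) \<partial>lborel)"
  proof (rule nn_integral_cong)
    fix s :: real
    show "(\<integral>\<^sup>+b. ennreal (if s > 0 then s powr (- \<alpha>) * exp (- c * (1 + (norm (P *v extend_zero S e b))\<^sup>2) / s) else 0)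
        \<partial>Pi\<^sub>M (e ` S) (\<lambda>_. lborel)) = ennreal (sqrt (pi / c) ^ ?n) * ennreal (1 / det P) *
      ennreal (if s > 0 then s powr (- (\<alpha> - real ?n / 2)) * exp (- c / s) else 0)"
    proof (cases "s > 0")
      case True
      have "(\<integral>\<^sup>+b. ennreal (if s > 0 then s powr (- \<alpha>) * exp (- c * (1 + (norm (P *v extend_zero S e b))\<^sup>2) / s) else 0)
          \<partial>Pi\<^sub>M (e ` S) (\<lambda>_. lborel)) =
        (\<integral>\<^sup>+b. ennreal (s powr (- \<alpha>) * exp (- c / s)) *
          ennreal (exp (- ((c / s) * (extend_zero S e b \<bullet> ((P ** P) *v extend_zero S e b)))))
          \<partial>Pi\<^sub>M (e ` S) (\<lambda>_. lborel))"
        using True unfolding norm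
        by (intro nn_integral_cong)
           (simp add: ennreal_mult[symmetric] exp_add[symmetric] mult.assoc add_divide_distrib diff_divide_distrib algebra_simps)
      also have "\<dots> = ennreal (s powr (- \<alpha>) * exp (- c / s)) * ennreal (sqrt (pi / (c / s)) ^ ?n / det P)"
        using True \<open>c > 0\<close> nn_integral_gaussian_PiM[OF _ e PP PP_block, of "c / s"]
        by (subst nn_integral_cmult) (auto simp: det)
      also have "sqrt (pi / (c / s)) = sqrt (pi / c) * s powr (1 / 2)"
        using True by (simp add: powr_half_sqrt flip: real_sqrt_mult)
      also have "(sqrt (pi / c) * s powr (1 / 2)) ^ ?n = sqrt (pi / c) ^ ?n * s powr (real ?n / 2)"
        using True by (simp add: power_mult_distrib powr_realpow[symmetric] powr_powr)
      also have "ennreal (s powr (- \<alpha>) * exp (- c / s)) * ennreal (sqrt (pi / c) ^ ?n * s powr (real ?n / 2) / det P)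
          = ennreal (sqrt (pi / c) ^ ?n) * ennreal (1 / det P) *
            ennreal (s powr (- (\<alpha> - real ?n / 2)) * exp (- c / s))"
      proof -
        have "s powr (- (\<alpha> - real ?n / 2)) = s powr (- \<alpha>) * s powr (real ?n / 2)"
          by (simp add: powr_add[symmetric])
        then show ?thesis
          using True \<open>c > 0\<close> pos_def_det_pos[OF P]
          by (simp add: ennreal_mult[symmetric] mult_ac)
      qed
      finally show ?thesis using True by simp
    qed simp
  qed
  also have "\<dots> = ennreal (sqrt (pi / c) ^ ?n) * ennreal (1 / det P) * ?I"
    by (rule nn_integral_cmult) measurable
  finally show "(\<integral>\<^sup>+b. \<integral>\<^sup>+s. ennreal (if s > 0 then s powr (- \<alpha>) * exp (- c * (1 + (norm (P *v extend_zero S e b))\<^sup>2) / s) else 0)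
        \<partial>lborel \<partial>Pi\<^sub>M (e ` S) (\<lambda>_. lborel)) = ennreal (sqrt (pi / c) ^ ?n) * ?I * ennreal (1 / det P)"
    by (simp add: mult_ac)
qed

lemma principal_block_matrix_inv:
  fixes N :: "real^'d^'d"
  assumes N: "pos_def N" and block: "principal_block S N = N"
  shows "principal_block S (matrix_inv N) = matrix_inv N"
proof -
  note P = pos_def_matrix_inv[OF N]
  have N0: "N $ i $ j = of_bool (i = j)" if "i \<notin> S" for i j
    using that principal_block_nth[of S N i j] unfolding block by (auto split: if_splits)
  have row: "matrix_inv N $ i $ j = of_bool (i = j)" if i: "i \<notin> S" for i j
  proof -
    have "of_bool (i = j) = (N ** matrix_inv N) $ i $ j"
      by (simp add: P(1) mat_def)
    also have "\<dots> = (\<Sum>q\<in>UNIV. of_bool (i = q) * matrix_inv N $ q $ j)"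
      by (simp add: matrix_matrix_mult_def N0[OF i])
    also have "\<dots> = matrix_inv N $ i $ j"
      by (simp add: of_bool_def if_distrib[of "\<lambda>x. x * _"] cong: if_cong)
    finally show ?thesis ..
  qed
  have "matrix_inv N $ i $ j = of_bool (i = j)" if "i \<notin> S \<or> j \<notin> S" for i j
    using that row[of i j] row[of j i] pos_def_nth_commute[OF P(3), of i j] by auto
  then show ?thesis by (auto simp: vec_eq_iff principal_block_nth)
qed

lemma wishart_bound_bordered:
  fixes A :: "real^'d^'d"
  assumes c: "c > 0" and block: "principal_block (insert k S) A = A" and k: "k \<notin> S"
  defines "N \<equiv> principal_block S A"
  defines "b \<equiv> \<chi> i. if i \<in> S then A $ k $ i else 0"
  defines "w \<equiv> matrix_inv N *v b"
  defines "s \<equiv> A $ k $ k - b \<bullet> w"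
  shows "wishart_bound \<alpha> c A \<le> exp c * wishart_bound \<alpha> c N *
    (if s > 0 then s powr (- \<alpha>) * exp (- c * (1 + (norm w)\<^sup>2) / s) else 0)"
proof (cases "pos_def A")
  case True
  have s: "s > 0"
    unfolding s_def w_def b_def N_def by (rule bordered_pivot_pos[OF True block k])
  have det: "det A = s * det N"
    unfolding s_def w_def b_def N_def by (rule bordered_det[OF True block k])
  have tr: "trace (matrix_inv A) = trace (matrix_inv N) - 1 + (1 + (norm w)\<^sup>2) / s"
    unfolding s_def w_def b_def N_def by (rule bordered_trace_inv[OF True block k])
  have N: "pos_def N" unfolding N_def by (rule pos_def_principal_block[OF True])
  have "det A powr (- \<alpha>) = s powr (- \<alpha>) * det N powr (- \<alpha>)"
    unfolding det using s pos_def_det_pos[OF N] by (simp add: powr_mult)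
  moreover have "exp (- c * trace (matrix_inv A)) =
      exp c * exp (- c * trace (matrix_inv N)) * exp (- c * (1 + (norm w)\<^sup>2) / s)"
    unfolding tr exp_add[symmetric] by (simp add: algebra_simps add_divide_distrib diff_divide_distrib)
  ultimately show ?thesis
    using True N s by (simp add: wishart_bound_def)
next
  case False
  then show ?thesis by (auto simp: wishart_bound_def)
qed

text \<open>
  Induction on \<open>S\<close>. The integral over the new diagonal entry is, after a translation, an integral over the
  pivot. The integrals over the pivot and the new row yield the determinant of the smaller block, so that
  \<open>\<alpha>\<close> is lowered by one together with the size of \<open>S\<close>.
\<close>

lemma nn_integral_wishart_bound_finite:
  fixes S :: "'d::finite set" and \<alpha> c :: real
  assumes "\<alpha> > real (card S)" "c > 0"
  shows "(\<integral>\<^sup>+z. ennreal (wishart_bound \<alpha> c (principal_block S (symmetric_matrix z)))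
      \<partial>Pi\<^sub>M (index_pairs S) (\<lambda>_. lborel)) < \<infinity>"
  using finite[of S] assms
proof (induction S arbitrary: \<alpha> rule: finite_induct)
  case empty
  have "index_pairs ({} :: 'd set) = {}" by (simp add: index_pairs_def)
  then show ?case
    by (simp add: PiM_empty nn_integral_count_space_finite)
next
  case (insert k S)
  let ?J = "index_pairs S" and ?e = "\<lambda>j. {k, j}"
  let ?R = "?e ` S"
  define N :: "('d set \<Rightarrow> real) \<Rightarrow> real^'d^'d" where "N = (\<lambda>z. principal_block S (symmetric_matrix z))"
  define G where "G = (\<lambda>z b s. if s > 0 then s powr (- \<alpha>) *
      exp (- c * (1 + (norm (matrix_inv (N z) *v extend_zero S ?e b))\<^sup>2) / s) else 0)"
  have e: "inj_on ?e S"
    using insert.hyps(2) by (auto simp: inj_on_def doubleton_eq_iff)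
  have disjoint: "?J \<inter> ?R = {}" "{k} \<notin> ?J \<union> ?R"
    using insert.hyps(2) by (auto simp: index_pairs_def doubleton_eq_iff)
  have fin: "finite ?J" "finite ?R" "finite (?J \<union> ?R)" by auto
  have N_cong: "N z = N z'" if "\<And>p. p \<in> ?J \<Longrightarrow> z p = z' p" for z z'
    using that by (auto simp: N_def vec_eq_iff principal_block_nth symmetric_matrix_def index_pairs_def)
  have N_meas: "N \<in> borel_measurable (Pi\<^sub>M K (\<lambda>_. lborel))" if "?J \<subseteq> K" for K
    unfolding N_def by (rule measurable_symmetric_block[OF that])
  note [measurable] = N_meas[OF order.refl] N_meas[OF Un_upper1]
    measurable_extend_zero[OF order.refl] measurable_extend_zero[OF Un_upper2]
  obtain C where C: "C < \<infinity>" and C_eq: "\<And>P. pos_def P \<Longrightarrow> principal_block S P = P \<Longrightarrow>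
      (\<integral>\<^sup>+b. \<integral>\<^sup>+s. ennreal (if s > 0 then s powr (- \<alpha>) * exp (- c * (1 + (norm (P *v extend_zero S ?e b))\<^sup>2) / s) else 0)
        \<partial>lborel \<partial>Pi\<^sub>M ?R (\<lambda>_. lborel)) = C * ennreal (1 / det P)"
    using nn_integral_pivot_row[of S \<alpha> c ?e] insert.prems insert.hyps e by auto
  \<comment> \<open>\<open>G\<close> takes the matrix and the row separately; before the coordinates are split, both are read off \<open>x\<close>.\<close>
  have inner: "(\<integral>\<^sup>+a. ennreal (wishart_bound \<alpha> c (principal_block (insert k S) (symmetric_matrix (x({k} := a))))) \<partial>lborel)
      \<le> ennreal (exp c * wishart_bound \<alpha> c (N x)) * (\<integral>\<^sup>+s. ennreal (G x x s) \<partial>lborel)" for x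
  proof -
    let ?b = "extend_zero S ?e x"
    let ?q = "?b \<bullet> (matrix_inv (N x) *v ?b)"
    have bound: "wishart_bound \<alpha> c (principal_block (insert k S) (symmetric_matrix (x({k} := a))))
        \<le> exp c * wishart_bound \<alpha> c (N x) * G x x (a - ?q)" for a
    proof -
      let ?A = "principal_block (insert k S) (symmetric_matrix (x({k} := a)))"
      have block: "principal_block (insert k S) ?A = ?A"
        by (simp add: vec_eq_iff principal_block_nth)
      have NA: "principal_block S ?A = N x"
        using insert.hyps(2)
        by (auto simp: N_def vec_eq_iff principal_block_nth symmetric_matrix_def)
      have bA: "(\<chi> i. if i \<in> S then ?A $ k $ i else 0) = ?b"
        using insert.hyps(2)
        by (auto simp: vec_eq_iff principal_block_nth symmetric_matrix_def extend_zero_def)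
      have kk: "?A $ k $ k = a"
        by (simp add: principal_block_nth symmetric_matrix_def)
      show ?thesis
        using wishart_bound_bordered[OF insert.prems(2) block insert.hyps(2), of \<alpha>]
        unfolding NA bA kk G_def .
    qed
    have nonneg: "0 \<le> wishart_bound \<alpha> c (N x)" "0 \<le> G x x s" for s
      by (auto simp: wishart_bound_def G_def)
    have G_meas: "(\<lambda>s. ennreal (G x x s)) \<in> borel_measurable borel"
      unfolding G_def by measurable
    have "(\<integral>\<^sup>+a. ennreal (wishart_bound \<alpha> c (principal_block (insert k S) (symmetric_matrix (x({k} := a))))) \<partial>lborel)
        \<le> (\<integral>\<^sup>+a. ennreal (exp c * wishart_bound \<alpha> c (N x)) * ennreal (G x x (- ?q + 1 * a)) \<partial>lborel)"
      using bound nonneg by (intro nn_integral_mono) (simp add: ennreal_mult[symmetric] ennreal_leI)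
    also have "\<dots> = ennreal (exp c * wishart_bound \<alpha> c (N x)) * (\<integral>\<^sup>+a. ennreal (G x x (- ?q + 1 * a)) \<partial>lborel)"
      by (intro nn_integral_cmult measurable_compose[OF _ G_meas]) simp
    \<comment> \<open>For a fixed row, passing from the diagonal entry to the pivot is a translation.\<close>
    also have "(\<integral>\<^sup>+a. ennreal (G x x (- ?q + 1 * a)) \<partial>lborel) = (\<integral>\<^sup>+s. ennreal (G x x s) \<partial>lborel)"
      using nn_integral_real_affine[OF G_meas, of 1 "- ?q"] by simp
    finally show ?thesis .
  qed
  have "(\<integral>\<^sup>+z. ennreal (wishart_bound \<alpha> c (principal_block (insert k S) (symmetric_matrix z)))
      \<partial>Pi\<^sub>M (index_pairs (insert k S)) (\<lambda>_. lborel)) =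
    (\<integral>\<^sup>+x. \<integral>\<^sup>+a. ennreal (wishart_bound \<alpha> c (principal_block (insert k S) (symmetric_matrix (x({k} := a)))))
      \<partial>lborel \<partial>Pi\<^sub>M (?J \<union> ?R) (\<lambda>_. lborel))"
  proof -
    have "(\<lambda>z. ennreal (wishart_bound \<alpha> c (principal_block (insert k S) (symmetric_matrix z))))
        \<in> borel_measurable (Pi\<^sub>M (insert {k} (?J \<union> ?R)) (\<lambda>_. lborel))"
      using measurable_symmetric_block[of "insert k S" "insert {k} (?J \<union> ?R)"]
      by (auto simp: index_pairs_insert)
    then show ?thesis
      unfolding index_pairs_insert by (rule lborel_product.product_nn_integral_insert[OF fin(3) disjoint(2)])
  qed
  also have "\<dots> \<le> (\<integral>\<^sup>+x. ennreal (exp c * wishart_bound \<alpha> c (N x)) * (\<integral>\<^sup>+s. ennreal (G x x s) \<partial>lborel)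
      \<partial>Pi\<^sub>M (?J \<union> ?R) (\<lambda>_. lborel))"
    by (intro nn_integral_mono inner)
  also have "\<dots> = (\<integral>\<^sup>+z. \<integral>\<^sup>+b. ennreal (exp c * wishart_bound \<alpha> c (N (merge ?J ?R (z, b)))) *
      (\<integral>\<^sup>+s. ennreal (G (merge ?J ?R (z, b)) (merge ?J ?R (z, b)) s) \<partial>lborel)
      \<partial>Pi\<^sub>M ?R (\<lambda>_. lborel) \<partial>Pi\<^sub>M ?J (\<lambda>_. lborel))"
  proof (rule lborel_product.product_nn_integral_fold[OF disjoint(1) fin(1,2)])
    show "(\<lambda>x. ennreal (exp c * wishart_bound \<alpha> c (N x)) * (\<integral>\<^sup>+s. ennreal (G x x s) \<partial>lborel))
        \<in> borel_measurable (Pi\<^sub>M (?J \<union> ?R) (\<lambda>_. lborel))"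
      unfolding G_def by measurable
  qed
  also have "\<dots> = (\<integral>\<^sup>+z. \<integral>\<^sup>+b. ennreal (exp c * wishart_bound \<alpha> c (N z)) * (\<integral>\<^sup>+s. ennreal (G z b s) \<partial>lborel)
      \<partial>Pi\<^sub>M ?R (\<lambda>_. lborel) \<partial>Pi\<^sub>M ?J (\<lambda>_. lborel))"
  proof (intro nn_integral_cong)
    fix z b
    have merge_N: "N (merge ?J ?R (z, b)) = N z"
      by (rule N_cong) (simp add: merge_def)
    have merge_b: "extend_zero S ?e (merge ?J ?R (z, b)) = extend_zero S ?e b"
      using disjoint(1) by (auto simp: extend_zero_def vec_eq_iff merge_def)
    show "ennreal (exp c * wishart_bound \<alpha> c (N (merge ?J ?R (z, b)))) *
        (\<integral>\<^sup>+s. ennreal (G (merge ?J ?R (z, b)) (merge ?J ?R (z, b)) s) \<partial>lborel) =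
        ennreal (exp c * wishart_bound \<alpha> c (N z)) * (\<integral>\<^sup>+s. ennreal (G z b s) \<partial>lborel)"
      unfolding G_def merge_N merge_b ..
  qed
  also have "\<dots> = (\<integral>\<^sup>+z. ennreal (exp c) * C * ennreal (wishart_bound (\<alpha> - 1) c (N z)) \<partial>Pi\<^sub>M ?J (\<lambda>_. lborel))"
  proof (intro nn_integral_cong)
    fix z
    have "(\<integral>\<^sup>+b. ennreal (exp c * wishart_bound \<alpha> c (N z)) * (\<integral>\<^sup>+s. ennreal (G z b s) \<partial>lborel) \<partial>Pi\<^sub>M ?R (\<lambda>_. lborel))
        = ennreal (exp c * wishart_bound \<alpha> c (N z)) * (\<integral>\<^sup>+b. \<integral>\<^sup>+s. ennreal (G z b s) \<partial>lborel \<partial>Pi\<^sub>M ?R (\<lambda>_. lborel))"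
      unfolding G_def by (intro nn_integral_cmult) measurable
    also have "\<dots> = ennreal (exp c) * C * ennreal (wishart_bound (\<alpha> - 1) c (N z))"
    proof (cases "pos_def (N z)")
      case True
      note P = pos_def_matrix_inv[OF True]
      have "principal_block S (N z) = N z"
        by (simp add: N_def vec_eq_iff principal_block_nth)
      note block = principal_block_matrix_inv[OF True this]
      have det: "det (N z) > 0" by (rule pos_def_det_pos[OF True])
      have "det (N z) powr (- \<alpha>) * det (N z) = det (N z) powr (1 - \<alpha>)"
        using det powr_add[of "det (N z)" "- \<alpha>" 1] by simp
      then have "wishart_bound \<alpha> c (N z) * det (N z) = wishart_bound (\<alpha> - 1) c (N z)"
        using True by (simp add: wishart_bound_def mult_ac)
      moreover have "(\<integral>\<^sup>+b. \<integral>\<^sup>+s. ennreal (G z b s) \<partial>lborel \<partial>Pi\<^sub>M ?R (\<lambda>_. lborel)) = C * ennreal (det (N z))"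
        unfolding G_def C_eq[OF P(3) block] using det by (simp add: det_matrix_inv[OF True])
      moreover have "wishart_bound \<alpha> c (N z) \<ge> 0" by (simp add: wishart_bound_def)
      ultimately show ?thesis
        using det by (simp add: ennreal_mult mult_ac flip: \<open>wishart_bound \<alpha> c (N z) * det (N z) = wishart_bound (\<alpha> - 1) c (N z)\<close>)
    qed (simp add: wishart_bound_def)
    finally show "(\<integral>\<^sup>+b. ennreal (exp c * wishart_bound \<alpha> c (N z)) * (\<integral>\<^sup>+s. ennreal (G z b s) \<partial>lborel) \<partial>Pi\<^sub>M ?R (\<lambda>_. lborel))
        = ennreal (exp c) * C * ennreal (wishart_bound (\<alpha> - 1) c (N z))" .
  qed
  also have "\<dots> = ennreal (exp c) * C * (\<integral>\<^sup>+z. ennreal (wishart_bound (\<alpha> - 1) c (N z)) \<partial>Pi\<^sub>M ?J (\<lambda>_. lborel))"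
    by (intro nn_integral_cmult) measurable
  also have "\<dots> < \<infinity>"
  proof -
    have "\<alpha> - 1 > real (card S)" using insert.prems(1) insert.hyps by simp
    from insert.IH[OF this insert.prems(2)]
    show ?thesis using C unfolding N_def by (simp add: ennreal_mult_less_top)
  qed
  finally show ?case .
qed

section \<open>Lebesgue measure on the positive definite matrices\<close>

lemma index_pairs_UNIV: "{{i, j} | i j. True} = index_pairs UNIV"
  by (simp add: index_pairs_def)

lemma measurable_symmetric_matrix:
  "symmetric_matrix \<in> borel_measurable (Pi\<^sub>M (index_pairs UNIV) (\<lambda>_. lborel))"
  using measurable_symmetric_block[OF order.refl, of UNIV] by simp

lemma lborel_sym_eq:
  "lborel_sym = distr (Pi\<^sub>M (index_pairs UNIV) (\<lambda>_. lborel)) borel symmetric_matrix"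
  unfolding lborel_sym_def index_pairs_UNIV symmetric_matrix_def[abs_def] ..

lemma sets_lborel_sym [simp, measurable_cong]: "sets lborel_sym = sets borel"
  by (simp add: lborel_sym_def)

lemma space_lborel_sym [simp]: "space lborel_sym = UNIV"
  by (simp add: lborel_sym_def)

lemma space_lborel_pos_def: "space lborel_pos_def = {\<Lambda>. pos_def \<Lambda>}"
  by (simp add: lborel_pos_def_def space_restrict_space lborel_sym_def)

lemma measurable_lborel_pos_def:
  "f \<in> borel_measurable borel \<Longrightarrow> f \<in> borel_measurable lborel_pos_def"
  unfolding lborel_pos_def_def by (intro measurable_restrict_space1) simp

lemma measurable_ident_lborel_pos_def: "(\<lambda>\<Lambda>. \<Lambda>) \<in> lborel_pos_def \<rightarrow>\<^sub>M borel"
  by (rule measurable_lborel_pos_def) simp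

lemma nn_integral_wishart_bound_lborel_pos_def:
  assumes "\<alpha> > real CARD('d)" "c > 0"
  shows "(\<integral>\<^sup>+\<Lambda>. ennreal (wishart_bound \<alpha> c \<Lambda>) \<partial>(lborel_pos_def :: (real^'d^'d) measure)) < \<infinity>"
proof -
  have "(\<integral>\<^sup>+\<Lambda>. ennreal (wishart_bound \<alpha> c \<Lambda>) \<partial>(lborel_pos_def :: (real^'d^'d) measure)) =
      (\<integral>\<^sup>+\<Lambda>. ennreal (wishart_bound \<alpha> c \<Lambda>) * indicator {\<Lambda>. pos_def \<Lambda>} \<Lambda> \<partial>(lborel_sym :: (real^'d^'d) measure))"
    unfolding lborel_pos_def_def
    using sets_pos_def by (subst nn_integral_restrict_space) auto
  also have "\<dots> = (\<integral>\<^sup>+\<Lambda>. ennreal (wishart_bound \<alpha> c \<Lambda>) \<partial>(lborel_sym :: (real^'d^'d) measure))"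
    by (intro nn_integral_cong) (simp add: wishart_bound_def indicator_def)
  also have "\<dots> = (\<integral>\<^sup>+z. ennreal (wishart_bound \<alpha> c (symmetric_matrix z :: real^'d^'d))
      \<partial>Pi\<^sub>M (index_pairs UNIV) (\<lambda>_. lborel))"
    unfolding lborel_sym_eq using measurable_symmetric_matrix by (subst nn_integral_distr) auto
  also have "\<dots> < \<infinity>"
    using nn_integral_wishart_bound_finite[of "UNIV :: 'd set" \<alpha> c] assms by simp
  finally show ?thesis .
qed

text \<open>
  There is a strictly positive integrable function, and Markov's inequality bounds the measure of the sets
  on which it is at least \<open>1 / n\<close>.
\<close>

lemma sigma_finite_lborel_pos_def:
  "sigma_finite_measure (lborel_pos_def :: (real^'d^'d) measure)"
proof
  let ?M = "lborel_pos_def :: (real^'d^'d) measure"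
  let ?f = "\<lambda>\<Lambda> :: real^'d^'d. ennreal (wishart_bound (CARD('d) + 1) 1 \<Lambda>)"
  let ?A = "\<lambda>n :: nat. {\<Lambda> \<in> space ?M. 1 \<le> of_nat n * ?f \<Lambda>}"
  note [measurable] = measurable_lborel_pos_def[OF measurable_wishart_bound]
  have meas: "?A n \<in> sets ?M" for n by measurable
  have fin: "emeasure ?M (?A n) \<noteq> \<infinity>" for n
  proof -
    have "emeasure ?M (?A n) \<le> of_nat n * (\<integral>\<^sup>+\<Lambda>. ?f \<Lambda> * indicator (space ?M) \<Lambda> \<partial>?M)"
      using nn_integral_Markov_inequality[of ?f "space ?M" ?M "of_nat n"]
      by (simp add: Int_def conj_commute)
    also have "\<dots> = of_nat n * (\<integral>\<^sup>+\<Lambda>. ?f \<Lambda> \<partial>?M)"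
      by (simp cong: nn_integral_cong)
    also have "\<dots> < \<infinity>"
      using nn_integral_wishart_bound_lborel_pos_def[where 'd='d and \<alpha>="CARD('d) + 1" and c=1]
      by (simp add: ennreal_mult_less_top of_nat_less_top)
    finally show ?thesis by simp
  qed
  have "\<Lambda> \<in> (\<Union>n. ?A n)" if "\<Lambda> \<in> space ?M" for \<Lambda>
  proof -
    from that have "wishart_bound (CARD('d) + 1) 1 \<Lambda> > 0"
      using pos_def_det_pos[of \<Lambda>] by (simp add: space_lborel_pos_def wishart_bound_def)
    moreover obtain n :: nat where "real n > 1 / wishart_bound (CARD('d) + 1) 1 \<Lambda>"
      using reals_Archimedean2 by blast
    ultimately have "1 \<le> real n * wishart_bound (CARD('d) + 1) 1 \<Lambda>"
      by (simp add: field_simps)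
    then have "1 \<le> of_nat n * ?f \<Lambda>"
      by (metis ennreal_1 ennreal_leI ennreal_mult' ennreal_of_nat_eq_real_of_nat of_nat_0_le_iff)
    with that show ?thesis by blast
  qed
  then have "(\<Union>n. ?A n) = space ?M" by auto
  then show "\<exists>A. countable A \<and> A \<subseteq> sets ?M \<and> \<Union> A = space ?M \<and> (\<forall>a\<in>A. emeasure ?M a \<noteq> \<infinity>)"
    using meas fin by (intro exI[of _ "range ?A"]) auto
qed

lemma emeasure_lborel_pos_def_pos:
  "emeasure (lborel_pos_def :: (real^'d^'d) measure) {\<Lambda>. pos_def \<Lambda>} > 0"
proof -
  let ?P = "Pi\<^sub>M (index_pairs (UNIV :: 'd set)) (\<lambda>_. lborel :: real measure)"
  \<comment> \<open>The bound of \<open>pos_def_near_identity\<close>. In the box below, a singleton \<open>{i, i}\<close> indexes a diagonal entry,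
    which is why the centre at \<open>p\<close> depends on the cardinality of \<open>p\<close>.\<close>
  define \<epsilon> where "\<epsilon> = 1 / (real CARD('d) * real CARD('d))"
  let ?X = "\<lambda>p :: 'd set. {of_bool (card p = 1) - \<epsilon> <..< of_bool (card p = 1) + \<epsilon>}"
  have \<epsilon>: "\<epsilon> > 0" by (simp add: \<epsilon>_def)
  have "0 < (\<Prod>p\<in>index_pairs (UNIV :: 'd set). ennreal (2 * \<epsilon>))"
    using \<epsilon> by (simp add: ennreal_power)
  also have "\<dots> = emeasure ?P (Pi\<^sub>E (index_pairs UNIV) ?X)"
    using \<epsilon> by (subst lborel_product.emeasure_PiM) auto
  also have "\<dots> \<le> emeasure ?P (symmetric_matrix -` {\<Lambda>. pos_def \<Lambda>} \<inter> space ?P)"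
  proof (rule emeasure_mono)
    show "Pi\<^sub>E (index_pairs UNIV) ?X \<subseteq> symmetric_matrix -` {\<Lambda>. pos_def \<Lambda>} \<inter> space ?P"
    proof
      fix z assume z: "z \<in> Pi\<^sub>E (index_pairs (UNIV :: 'd set)) ?X"
      have "pos_def (symmetric_matrix z)"
      proof (rule pos_def_near_identity)
        show "transpose (symmetric_matrix z) = symmetric_matrix z"
          by (simp add: symmetric_matrix_def transpose_def insert_commute)
        fix i j :: 'd
        have "{i, j} \<in> index_pairs UNIV" by (auto simp: index_pairs_def)
        then have "z {i, j} \<in> ?X {i, j}" using z by (rule PiE_mem[rotated])
        moreover have "card {i, j} = 1 \<longleftrightarrow> i = j" by (auto simp: card_insert_if)
        ultimately show "\<bar>symmetric_matrix z $ i $ j - of_bool (i = j)\<bar> < 1 / (real CARD('d) * real CARD('d))"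
          by (auto simp: symmetric_matrix_def \<epsilon>_def[symmetric] abs_less_iff)
      qed
      with z show "z \<in> symmetric_matrix -` {\<Lambda>. pos_def \<Lambda>} \<inter> space ?P"
        by (auto simp: space_PiM)
    qed
    show "symmetric_matrix -` {\<Lambda>. pos_def \<Lambda>} \<inter> space ?P \<in> sets ?P"
      by (rule measurable_sets[OF measurable_symmetric_matrix sets_pos_def])
  qed
  also have "\<dots> = emeasure lborel_sym {\<Lambda> :: real^'d^'d. pos_def \<Lambda>}"
    unfolding lborel_sym_eq using sets_pos_def measurable_symmetric_matrix by (subst emeasure_distr) auto
  also have "\<dots> = emeasure (lborel_pos_def :: (real^'d^'d) measure) {\<Lambda>. pos_def \<Lambda>}"
    unfolding lborel_pos_def_def using sets_pos_def
    by (subst emeasure_restrict_space) auto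
  finally show ?thesis .
qed

lemma integral_pos_if_pos:
  fixes f :: "'a \<Rightarrow> real"
  assumes "integrable M f" "\<And>x. x \<in> space M \<Longrightarrow> f x > 0" "emeasure M (space M) \<noteq> 0"
  shows "(\<integral>x. f x \<partial>M) > 0"
proof -
  have "(\<integral>x. f x \<partial>M) \<noteq> 0"
  proof
    assume "(\<integral>x. f x \<partial>M) = 0"
    then have "AE x in M. f x = 0"
      using integral_nonneg_eq_0_iff_AE[OF assms(1)] assms(2) by (auto intro: less_imp_le)
    then have "AE x in M. False"
      by (rule AE_mp) (use assms(2) in \<open>force intro!: AE_I2\<close>)
    then show False using assms(3) by (simp add: AE_iff_measurable[OF sets.top])
  qed
  moreover have "(\<integral>x. f x \<partial>M) \<ge> 0"
    using assms(2) by (intro Bochner_Integration.integral_nonneg) (auto intro: less_imp_le)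
  ultimately show ?thesis by simp
qed

lemma nn_integral_mvn_density:
  fixes \<Lambda> :: "real^'d^'d"
  assumes "pos_def \<Lambda>"
  shows "(\<integral>\<^sup>+x. ennreal (mvn_density \<mu> \<Lambda> x) \<partial>lborel) = 1"
proof -
  let ?Y = "matrix_inv \<Lambda>"
  have det: "det \<Lambda> > 0" by (rule pos_def_det_pos[OF assms])
  have "(\<integral>\<^sup>+x. ennreal (mvn_density \<mu> \<Lambda> x) \<partial>lborel) =
      (\<integral>\<^sup>+x. ennreal (1 / sqrt ((2 * pi) ^ CARD('d) * det \<Lambda>)) *
        ennreal (exp (- ((1 / 2) * ((x - \<mu>) \<bullet> (?Y *v (x - \<mu>)))))) \<partial>lborel)"
    using det by (simp add: mvn_density_def ennreal_mult[symmetric])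
  also have "\<dots> = ennreal (1 / sqrt ((2 * pi) ^ CARD('d) * det \<Lambda>)) *
      ennreal (sqrt (pi / (1 / 2)) ^ CARD('d) / sqrt (det ?Y))"
    using nn_integral_gaussian[OF _ pos_def_matrix_inv(3)[OF assms], of "1 / 2" \<mu>]
    by (subst nn_integral_cmult) auto
  also have "\<dots> = 1"
    using det by (simp add: ennreal_mult[symmetric] det_matrix_inv[OF assms] real_sqrt_mult real_sqrt_divide
        real_sqrt_power mult.commute power_mult_distrib)
  finally show ?thesis .
qed

lemma det_scaleR: "det (c *\<^sub>R A :: real^'d^'d) = c ^ CARD('d) * det A"
  by (simp add: det_def prod.distrib sum_distrib_left mult_ac)

section \<open>An integrable envelope for the Normal-inverse-Wishart model\<close>

lemma space_niw_space: "space niw_space = {\<theta>. pos_def (snd \<theta>)}"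
  by (auto simp: niw_space_def space_pair_measure space_lborel_pos_def)

lemma measurable_niw_fst [measurable]: "fst \<in> borel_measurable niw_space"
  unfolding niw_space_def using measurable_fst[of lborel lborel_pos_def] by simp

lemma measurable_niw_snd [measurable]: "snd \<in> borel_measurable niw_space"
  unfolding niw_space_def by (rule measurable_compose[OF measurable_snd measurable_ident_lborel_pos_def])

lemma pair_sigma_finite_niw:
  "pair_sigma_finite (lborel :: (real^'d) measure) (lborel_pos_def :: (real^'d^'d) measure)"
  by (intro pair_sigma_finite.intro sigma_finite_lborel sigma_finite_lborel_pos_def)

lemma emeasure_niw_space_nonzero: "emeasure (niw_space :: ((real^'d) \<times> (real^'d^'d)) measure) (space niw_space) \<noteq> 0"
proof -
  interpret sigma_finite_measure "lborel_pos_def :: (real^'d^'d) measure"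
    by (rule sigma_finite_lborel_pos_def)
  have "emeasure (niw_space :: ((real^'d) \<times> (real^'d^'d)) measure) (UNIV \<times> {\<Lambda>. pos_def \<Lambda>}) =
      emeasure lborel (UNIV :: (real^'d) set) * emeasure lborel_pos_def {\<Lambda> :: real^'d^'d. pos_def \<Lambda>}"
    unfolding niw_space_def
    using sets.top[of "lborel_pos_def :: (real^'d^'d) measure"]
    by (intro emeasure_pair_measure_Times) (auto simp: space_lborel_pos_def)
  moreover have "(space niw_space :: ((real^'d) \<times> (real^'d^'d)) set) = UNIV \<times> {\<Lambda>. pos_def \<Lambda>}"
    by (auto simp: space_niw_space)
  moreover have "emeasure lborel (UNIV :: (real^'d) set) \<noteq> 0"
    by simp
  ultimately show ?thesis
    using emeasure_lborel_pos_def_pos[where 'd='d] by auto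
qed

text \<open>
  The exponent of the conditional density of \<open>\<mu>\<close> given \<open>\<Lambda>\<close>, up to the factor \<open>- \<kappa>\<^sub>0 / 2\<close>.
\<close>

definition niw_energy :: "real^'d \<Rightarrow> (real^'d) \<times> (real^'d^'d) \<Rightarrow> real" where
  "niw_energy \<mu>\<^sub>0 = (\<lambda>(\<mu>, \<Lambda>). (\<mu> - \<mu>\<^sub>0) \<bullet> (matrix_inv \<Lambda> *v (\<mu> - \<mu>\<^sub>0)))"

definition precision_trace :: "(real^'d) \<times> (real^'d^'d) \<Rightarrow> real" where
  "precision_trace \<theta> = trace (matrix_inv (snd \<theta>))"

text \<open>
  A family that is stable under the estimates below: polynomial factors in the trace and the energy only
  lower \<open>c\<close> and \<open>\<kappa>\<close>.
\<close>

definition niw_envelope :: "real \<Rightarrow> real \<Rightarrow> real \<Rightarrow> real^'d \<Rightarrow> (real^'d) \<times> (real^'d^'d) \<Rightarrow> real" where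
  "niw_envelope \<alpha> c \<kappa> \<mu>\<^sub>0 \<theta> =
     det (snd \<theta>) powr (- \<alpha>) * exp (- c * precision_trace \<theta>) * exp (- \<kappa> * niw_energy \<mu>\<^sub>0 \<theta>)"

lemma measurable_niw_energy [measurable]: "niw_energy \<mu>\<^sub>0 \<in> borel_measurable niw_space"
  unfolding niw_energy_def case_prod_beta by measurable

lemma measurable_precision_trace [measurable]: "precision_trace \<in> borel_measurable niw_space"
  unfolding precision_trace_def by measurable

lemma measurable_niw_envelope [measurable]: "niw_envelope \<alpha> c \<kappa> \<mu>\<^sub>0 \<in> borel_measurable niw_space"
  unfolding niw_envelope_def by measurable

lemma niw_energy_nonneg: "\<theta> \<in> space niw_space \<Longrightarrow> niw_energy \<mu>\<^sub>0 \<theta> \<ge> 0"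
  using pos_def_matrix_inv(3)[of "snd \<theta>"]
  by (cases "fst \<theta> = \<mu>\<^sub>0") (auto simp: space_niw_space niw_energy_def pos_def_def less_imp_le split: prod.splits)

lemma precision_trace_nonneg: "\<theta> \<in> space niw_space \<Longrightarrow> precision_trace \<theta> \<ge> 0"
  using pos_def_trace_bounds(1)[OF pos_def_matrix_inv(3)] by (auto simp: space_niw_space precision_trace_def)

text \<open>
  The integral over \<open>\<mu>\<close> is Gaussian and contributes the square root of \<open>|\<Lambda>|\<close>; what remains is the inverse
  Wishart integral with \<open>\<alpha> - 1 / 2\<close>.
\<close>

lemma integrable_niw_envelope:
  assumes "\<alpha> > real CARD('d) + 1 / 2" "c > 0" "\<kappa> > 0"
  shows "integrable niw_space (niw_envelope \<alpha> c \<kappa> (\<mu>\<^sub>0 :: real^'d))"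
proof (rule integrableI_nonneg)
  show "AE \<theta> in niw_space. 0 \<le> niw_envelope \<alpha> c \<kappa> \<mu>\<^sub>0 \<theta>"
    by (simp add: niw_envelope_def)
  interpret pair_sigma_finite "lborel :: (real^'d) measure" "lborel_pos_def :: (real^'d^'d) measure"
    by (rule pair_sigma_finite_niw)
  have "(\<integral>\<^sup>+\<theta>. ennreal (niw_envelope \<alpha> c \<kappa> \<mu>\<^sub>0 \<theta>) \<partial>niw_space) =
      (\<integral>\<^sup>+\<Lambda>. \<integral>\<^sup>+\<mu>. ennreal (niw_envelope \<alpha> c \<kappa> \<mu>\<^sub>0 (\<mu>, \<Lambda>)) \<partial>lborel \<partial>lborel_pos_def)"
    using nn_integral_snd[of "\<lambda>\<theta>. ennreal (niw_envelope \<alpha> c \<kappa> \<mu>\<^sub>0 \<theta>)"]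
      measurable_compose[OF measurable_niw_envelope measurable_ennreal, of \<alpha> c \<kappa> \<mu>\<^sub>0]
    unfolding niw_space_def by simp
  also have "\<dots> = (\<integral>\<^sup>+\<Lambda>. ennreal (sqrt (pi / \<kappa>) ^ CARD('d)) * ennreal (wishart_bound (\<alpha> - 1 / 2) c \<Lambda>)
      \<partial>(lborel_pos_def :: (real^'d^'d) measure))"
  proof (rule nn_integral_cong)
    fix \<Lambda> :: "real^'d^'d" assume "\<Lambda> \<in> space lborel_pos_def"
    then have \<Lambda>: "pos_def \<Lambda>" by (simp add: space_lborel_pos_def)
    note det = pos_def_det_pos[OF \<Lambda>]
    have "(\<integral>\<^sup>+\<mu>. ennreal (niw_envelope \<alpha> c \<kappa> \<mu>\<^sub>0 (\<mu>, \<Lambda>)) \<partial>lborel) =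
        (\<integral>\<^sup>+\<mu>. ennreal (det \<Lambda> powr (- \<alpha>) * exp (- c * trace (matrix_inv \<Lambda>))) *
          ennreal (exp (- (\<kappa> * ((\<mu> - \<mu>\<^sub>0) \<bullet> (matrix_inv \<Lambda> *v (\<mu> - \<mu>\<^sub>0)))))) \<partial>lborel)"
      by (simp add: niw_envelope_def niw_energy_def precision_trace_def ennreal_mult[symmetric])
    also have "\<dots> = ennreal (det \<Lambda> powr (- \<alpha>) * exp (- c * trace (matrix_inv \<Lambda>))) *
        ennreal (sqrt (pi / \<kappa>) ^ CARD('d) / sqrt (det (matrix_inv \<Lambda>)))"
      using nn_integral_gaussian[OF assms(3) pos_def_matrix_inv(3)[OF \<Lambda>], of \<mu>\<^sub>0]
      by (subst nn_integral_cmult) auto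
    also have "1 / sqrt (det (matrix_inv \<Lambda>)) = det \<Lambda> powr (1 / 2)"
      using det by (simp add: det_matrix_inv[OF \<Lambda>] real_sqrt_divide powr_half_sqrt)
    then have "sqrt (pi / \<kappa>) ^ CARD('d) / sqrt (det (matrix_inv \<Lambda>)) = sqrt (pi / \<kappa>) ^ CARD('d) * det \<Lambda> powr (1 / 2)"
      by (metis divide_inverse inverse_eq_divide)
    also have "ennreal (det \<Lambda> powr (- \<alpha>) * exp (- c * trace (matrix_inv \<Lambda>))) *
        ennreal (sqrt (pi / \<kappa>) ^ CARD('d) * det \<Lambda> powr (1 / 2)) =
        ennreal (sqrt (pi / \<kappa>) ^ CARD('d)) * ennreal (wishart_bound (\<alpha> - 1 / 2) c \<Lambda>)"
    proof -
      have "det \<Lambda> powr (- (\<alpha> - 1 / 2)) = det \<Lambda> powr (- \<alpha>) * det \<Lambda> powr (1 / 2)"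
        by (simp add: powr_add[symmetric])
      then show ?thesis
        using \<Lambda> assms(3) by (simp add: wishart_bound_def ennreal_mult[symmetric] mult_ac)
    qed
    finally show "(\<integral>\<^sup>+\<mu>. ennreal (niw_envelope \<alpha> c \<kappa> \<mu>\<^sub>0 (\<mu>, \<Lambda>)) \<partial>lborel) =
        ennreal (sqrt (pi / \<kappa>) ^ CARD('d)) * ennreal (wishart_bound (\<alpha> - 1 / 2) c \<Lambda>)" .
  qed
  also have "\<dots> = ennreal (sqrt (pi / \<kappa>) ^ CARD('d)) *
      (\<integral>\<^sup>+\<Lambda>. ennreal (wishart_bound (\<alpha> - 1 / 2) c \<Lambda>) \<partial>(lborel_pos_def :: (real^'d^'d) measure))"
    by (intro nn_integral_cmult measurable_compose[OF
          measurable_lborel_pos_def[OF measurable_wishart_bound] measurable_ennreal])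
  also have "\<dots> < \<infinity>"
    using nn_integral_wishart_bound_lborel_pos_def[where 'd='d and \<alpha>="\<alpha> - 1 / 2" and c=c] assms
    by (simp add: ennreal_mult_less_top)
  finally show "(\<integral>\<^sup>+\<theta>. ennreal (niw_envelope \<alpha> c \<kappa> \<mu>\<^sub>0 \<theta>) \<partial>niw_space) < \<infinity>" .
qed measurable

text \<open>
  Half of each exponential absorbs the polynomial factor.
\<close>

lemma integrable_niw_polynomial:
  fixes h :: "(real^'d) \<times> (real^'d^'d) \<Rightarrow> real"
  assumes "\<alpha> > real CARD('d) + 1 / 2" "c > 0" "\<kappa> > 0"
    and [measurable]: "h \<in> borel_measurable niw_space"
    and bound: "\<And>\<theta>. \<theta> \<in> space niw_space \<Longrightarrow>
      \<bar>h \<theta>\<bar> \<le> K * (1 + precision_trace \<theta> + niw_energy \<mu>\<^sub>0 \<theta>) * niw_envelope \<alpha> c \<kappa> \<mu>\<^sub>0 \<theta>"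
  shows "integrable niw_space h"
proof (rule Bochner_Integration.integrable_bound)
  let ?K = "\<bar>K\<bar> * (1 + 2 / c) * (1 + 2 / \<kappa>)"
  show "integrable niw_space (\<lambda>\<theta>. ?K * niw_envelope \<alpha> (c / 2) (\<kappa> / 2) \<mu>\<^sub>0 \<theta>)"
    using assms by (intro integrable_mult_right integrable_niw_envelope) auto
  show "AE \<theta> in niw_space. norm (h \<theta>) \<le> norm (?K * niw_envelope \<alpha> (c / 2) (\<kappa> / 2) \<mu>\<^sub>0 \<theta>)"
  proof (rule AE_I2)
    fix \<theta> :: "(real^'d) \<times> (real^'d^'d)" assume \<theta>: "\<theta> \<in> space niw_space"
    have linear: "1 + u \<le> (1 + 2 / a) * exp (a / 2 * u)" if "u \<ge> 0" "a > 0" for u a :: real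
    proof -
      have "1 \<le> exp (a / 2 * u)" using that by simp
      moreover have "u \<le> 2 / a * exp (a / 2 * u)"
      proof -
        have "a / 2 * u \<le> exp (a / 2 * u)"
          using exp_ge_add_one_self[of "a / 2 * u"] by linarith
        then show ?thesis using that by (simp add: field_simps)
      qed
      ultimately show ?thesis
        unfolding distrib_right mult_1_left by (rule add_mono)
    qed
    let ?t = "precision_trace \<theta>" and ?q = "niw_energy \<mu>\<^sub>0 \<theta>"
    have t: "?t \<ge> 0" and q: "?q \<ge> 0"
      by (rule precision_trace_nonneg[OF \<theta>], rule niw_energy_nonneg[OF \<theta>])
    have "1 + ?t + ?q \<le> (1 + ?t) * (1 + ?q)"
      using t q by (simp add: algebra_simps)
    also have "\<dots> \<le> ((1 + 2 / c) * exp (c / 2 * ?t)) * ((1 + 2 / \<kappa>) * exp (\<kappa> / 2 * ?q))"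
      using t q assms by (intro mult_mono linear) auto
    finally have poly: "1 + ?t + ?q \<le> (1 + 2 / c) * (1 + 2 / \<kappa>) * (exp (c / 2 * ?t) * exp (\<kappa> / 2 * ?q))"
      by (simp add: mult_ac)
    have env: "niw_envelope \<alpha> c \<kappa> \<mu>\<^sub>0 \<theta> \<ge> 0" by (simp add: niw_envelope_def)
    have "\<bar>h \<theta>\<bar> \<le> \<bar>K\<bar> * (1 + ?t + ?q) * niw_envelope \<alpha> c \<kappa> \<mu>\<^sub>0 \<theta>"
      by (rule order_trans[OF bound[OF \<theta>]]) (use t q env in \<open>intro mult_right_mono; auto\<close>)
    also have "\<dots> \<le> \<bar>K\<bar> * ((1 + 2 / c) * (1 + 2 / \<kappa>) * (exp (c / 2 * ?t) * exp (\<kappa> / 2 * ?q)))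
        * niw_envelope \<alpha> c \<kappa> \<mu>\<^sub>0 \<theta>"
      using poly env by (intro mult_right_mono mult_left_mono) auto
    also have "\<dots> = ?K * (exp (c / 2 * ?t) * exp (\<kappa> / 2 * ?q) * niw_envelope \<alpha> c \<kappa> \<mu>\<^sub>0 \<theta>)"
      by (simp add: mult_ac)
    also have "exp (c / 2 * ?t) * exp (\<kappa> / 2 * ?q) * niw_envelope \<alpha> c \<kappa> \<mu>\<^sub>0 \<theta> =
        niw_envelope \<alpha> (c / 2) (\<kappa> / 2) \<mu>\<^sub>0 \<theta>"
    proof -
      have shift: "exp (c / 2 * ?t) * exp (- c * ?t) = exp (- (c / 2) * ?t)"
        "exp (\<kappa> / 2 * ?q) * exp (- \<kappa> * ?q) = exp (- (\<kappa> / 2) * ?q)"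
        by (simp_all add: exp_add[symmetric])
      have "exp (c / 2 * ?t) * exp (\<kappa> / 2 * ?q) * niw_envelope \<alpha> c \<kappa> \<mu>\<^sub>0 \<theta> = det (snd \<theta>) powr (- \<alpha>) *
          (exp (c / 2 * ?t) * exp (- c * ?t)) * (exp (\<kappa> / 2 * ?q) * exp (- \<kappa> * ?q))"
        unfolding niw_envelope_def by (simp only: mult_ac)
      then show ?thesis
        unfolding shift niw_envelope_def .
    qed
    finally show "norm (h \<theta>) \<le> norm (?K * niw_envelope \<alpha> (c / 2) (\<kappa> / 2) \<mu>\<^sub>0 \<theta>)"
      by simp
  qed
qed measurable

section \<open>The likelihood of a single observation\<close>

lemma measurable_mvn_density [measurable (raw)]:
  fixes x :: "'a \<Rightarrow> real^'d"
  assumes [measurable]: "\<mu> \<in> borel_measurable M" "\<Lambda> \<in> borel_measurable M" "x \<in> borel_measurable M"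
  shows "(\<lambda>t. mvn_density (\<mu> t) (\<Lambda> t) (x t)) \<in> borel_measurable M"
  unfolding mvn_density_def by measurable

lemma mvn_density_pos: "pos_def \<Lambda> \<Longrightarrow> mvn_density \<mu> \<Lambda> x > 0"
  by (simp add: mvn_density_def pos_def_det_pos)

lemma mvn_density_le:
  fixes \<Lambda> :: "real^'d^'d"
  assumes "pos_def \<Lambda>"
  shows "mvn_density \<mu> \<Lambda> x \<le> det \<Lambda> powr (- 1 / 2)"
proof -
  have det: "det \<Lambda> > 0" by (rule pos_def_det_pos[OF assms])
  have "(x - \<mu>) \<bullet> (matrix_inv \<Lambda> *v (x - \<mu>)) \<ge> 0"
    using pos_def_matrix_inv(3)[OF assms]
    by (cases "x = \<mu>") (auto simp: pos_def_def less_imp_le)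
  moreover have "sqrt (det \<Lambda>) \<le> sqrt ((2 * pi) ^ CARD('d) * det \<Lambda>)"
  proof -
    have "1 \<le> (2 * pi) ^ CARD('d)"
      using pi_gt3 by (intro one_le_power) simp
    then have "1 * det \<Lambda> \<le> (2 * pi) ^ CARD('d) * det \<Lambda>"
      using det by (intro mult_right_mono) auto
    then show ?thesis by simp
  qed
  ultimately have "mvn_density \<mu> \<Lambda> x \<le> 1 / sqrt (det \<Lambda>)"
    unfolding mvn_density_def using det by (intro frac_le) auto
  also have "\<dots> = det \<Lambda> powr (- 1 / 2)"
    using det by (simp add: powr_minus_divide powr_half_sqrt)
  finally show ?thesis .
qed

lemma measurable_inv_wishart_kernel [measurable]: "inv_wishart_kernel \<nu> \<Psi> \<in> borel_measurable borel"
  unfolding inv_wishart_kernel_def by measurable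

lemma inv_wishart_kernel_pos: "pos_def \<Lambda> \<Longrightarrow> inv_wishart_kernel \<nu> \<Psi> \<Lambda> > 0"
  using pos_def_det_pos[of \<Lambda>] by (simp add: inv_wishart_kernel_def)

text \<open>
  The part of the log-likelihood of an observation \<open>v\<close> that depends on \<open>v\<close>. The omitted summand depends on
  the parameter only, hence cancels when two observations are exchanged.
\<close>

definition log_likelihood_kernel :: "(real^'d) \<times> (real^'d^'d) \<Rightarrow> real^'d \<Rightarrow> real" where
  "log_likelihood_kernel \<theta> v =
     (matrix_inv (snd \<theta>) *v fst \<theta>) \<bullet> v - (v \<bullet> (matrix_inv (snd \<theta>) *v v)) / 2"

lemma measurable_log_likelihood_kernel [measurable]:
  "(\<lambda>\<theta>. log_likelihood_kernel \<theta> v) \<in> borel_measurable niw_space"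
  unfolding log_likelihood_kernel_def by measurable

lemma normal_component_eq_exp_times:
  assumes "\<theta> \<in> space niw_space"
  shows "normal_component \<theta> u =
    exp (log_likelihood_kernel \<theta> u - log_likelihood_kernel \<theta> v) * normal_component \<theta> v"
proof -
  let ?Y = "matrix_inv (snd \<theta>)" and ?\<mu> = "fst \<theta>"
  have Y: "pos_def ?Y" using assms pos_def_matrix_inv(3) by (simp add: space_niw_space)
  have expand: "- ((w - ?\<mu>) \<bullet> (?Y *v (w - ?\<mu>))) / 2 = log_likelihood_kernel \<theta> w - (?\<mu> \<bullet> (?Y *v ?\<mu>)) / 2" for w
  proof -
    have "?\<mu> \<bullet> (?Y *v w) = (?Y *v ?\<mu>) \<bullet> w" by (rule pos_def_inner_commute[OF Y])
    moreover have "w \<bullet> (?Y *v ?\<mu>) = (?Y *v ?\<mu>) \<bullet> w" by (rule inner_commute)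
    ultimately show ?thesis
      by (simp add: log_likelihood_kernel_def matrix_vector_mult_diff_distrib inner_diff_left inner_diff_right
          field_simps)
  qed
  show ?thesis
    unfolding normal_component_def case_prod_beta mvn_density_def expand
    by (simp add: exp_diff)
qed

lemma AE_False_imp_null:
  assumes "AE x in M. False"
  shows "emeasure M (space M) = 0"
  using assms by (simp add: AE_iff_measurable[OF sets.top])

text \<open>
  For fixed \<open>\<Lambda>\<close> the difference is an affine function of \<open>\<mu>\<close> with the slope \<open>\<Lambda>\<^sup>-\<^sup>1 (u - v) \<noteq> 0\<close>, so it attains
  each value on a hyperplane only. This is where distinct observations enter.
\<close>

lemma log_likelihood_kernel_diff_not_constant:
  fixes u v :: "real^'d"
  assumes "u \<noteq> v"
  shows "\<not> (AE \<theta> in niw_space. log_likelihood_kernel \<theta> u - log_likelihood_kernel \<theta> v = c)"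
proof
  assume ae: "AE \<theta> in niw_space. log_likelihood_kernel \<theta> u - log_likelihood_kernel \<theta> v = c"
  interpret pair_sigma_finite "lborel :: (real^'d) measure" "lborel_pos_def :: (real^'d^'d) measure"
    by (rule pair_sigma_finite_niw)
  let ?P = "\<lambda>\<mu> \<Lambda>. log_likelihood_kernel (\<mu>, \<Lambda>) u - log_likelihood_kernel (\<mu>, \<Lambda>) v = c"
  have meas: "{\<theta> \<in> space niw_space. ?P (fst \<theta>) (snd \<theta>)} \<in> sets niw_space"
    unfolding prod.collapse by measurable
  have "AE \<mu> in lborel. AE \<Lambda> in lborel_pos_def. ?P \<mu> \<Lambda>"
    using ae unfolding niw_space_def by (rule AE_pair)
  then have swapped: "AE \<Lambda> in lborel_pos_def. AE \<mu> in lborel. ?P \<mu> \<Lambda>"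
    using AE_commute[of ?P] meas unfolding niw_space_def by simp
  have not_ae: "\<not> (AE \<mu> in lborel. ?P \<mu> \<Lambda>)" if "\<Lambda> \<in> space lborel_pos_def" for \<Lambda>
  proof
    assume ae_\<mu>: "AE \<mu> in lborel. ?P \<mu> \<Lambda>"
    let ?Y = "matrix_inv \<Lambda>"
    have Y: "pos_def ?Y" using that pos_def_matrix_inv(3) by (simp add: space_lborel_pos_def)
    define a where "a = ?Y *v (u - v)"
    define b where "b = c + (u \<bullet> (?Y *v u)) / 2 - (v \<bullet> (?Y *v v)) / 2"
    have "a \<noteq> 0"
      using Y assms unfolding a_def pos_def_def by (metis inner_zero_right less_irrefl right_minus_eq)
    then have "negligible {\<mu>. a \<bullet> \<mu> = b}" by (intro negligible_hyperplane) simp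
    then have "AE \<mu> in lebesgue. \<mu> \<notin> {\<mu>. a \<bullet> \<mu> = b}"
      by (intro AE_not_in) (simp add: negligible_iff_null_sets)
    then have "AE \<mu> in lborel. a \<bullet> \<mu> \<noteq> b"
      by (simp add: AE_completion_iff)
    then have "AE \<mu> in (lborel :: (real^'d) measure). False"
      using ae_\<mu>
    proof eventually_elim
      case (elim \<mu>)
      have "(?Y *v \<mu>) \<bullet> (u - v) = a \<bullet> \<mu>"
        unfolding a_def using pos_def_inner_commute[OF Y, of \<mu> "u - v"] by (simp add: inner_commute)
      with elim show False
        by (simp add: log_likelihood_kernel_def b_def inner_diff_right)
    qed
    then show False
      using AE_False_imp_null by fastforce
  qed
  have "AE \<Lambda> in (lborel_pos_def :: (real^'d^'d) measure). False"
    by (rule AE_mp[OF swapped]) (use not_ae in \<open>auto intro!: AE_I2\<close>)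
  then show False
    using AE_False_imp_null emeasure_lborel_pos_def_pos[where 'd='d]
    by (fastforce simp: space_lborel_pos_def)
qed

section \<open>The Normal-inverse-Wishart prior\<close>

context
  fixes \<kappa>\<^sub>0 \<nu>\<^sub>0 :: real and \<mu>\<^sub>0 :: "real^'d" and \<Sigma>\<^sub>0 :: "real^'d^'d"
  assumes \<kappa>\<^sub>0: "\<kappa>\<^sub>0 > 0" and \<nu>\<^sub>0: "\<nu>\<^sub>0 > 0" and \<Sigma>\<^sub>0: "pos_def \<Sigma>\<^sub>0"
begin

abbreviation (input) kernel :: "real^'d^'d \<Rightarrow> real" where
  "kernel \<equiv> inv_wishart_kernel (\<nu>\<^sub>0 + real CARD('d) + 1) (\<nu>\<^sub>0 *\<^sub>R \<Sigma>\<^sub>0)"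

abbreviation (input) prior :: "(real^'d) \<times> (real^'d^'d) \<Rightarrow> real" where
  "prior \<equiv> niw_density \<kappa>\<^sub>0 \<nu>\<^sub>0 \<mu>\<^sub>0 \<Sigma>\<^sub>0"

text \<open>
  With \<open>\<nu> = \<nu>\<^sub>0 + d + 1\<close>, the exponent \<open>(\<nu> + d + 1) / 2\<close> of the determinant is \<open>\<nu>\<^sub>0 / 2 + d + 1\<close>, which
  exceeds \<open>d\<close> as the finiteness of the integral requires.
\<close>

lemma kernel_le_wishart_bound:
  obtains c where "c > 0" "\<And>\<Lambda>. pos_def \<Lambda> \<Longrightarrow> kernel \<Lambda> \<le> wishart_bound (\<nu>\<^sub>0 / 2 + real CARD('d) + 1) c \<Lambda>"
proof -
  obtain e where e: "e > 0" "\<And>Y. pos_def Y \<Longrightarrow> trace (\<Sigma>\<^sub>0 ** Y) \<ge> e * trace Y"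
    using pos_def_trace_mult_ge[OF \<Sigma>\<^sub>0] by blast
  show ?thesis
  proof (rule that)
    show "\<nu>\<^sub>0 * e / 2 > 0" using \<nu>\<^sub>0 e(1) by simp
    fix \<Lambda> :: "real^'d^'d" assume \<Lambda>: "pos_def \<Lambda>"
    have "trace ((\<nu>\<^sub>0 *\<^sub>R \<Sigma>\<^sub>0) ** matrix_inv \<Lambda>) = \<nu>\<^sub>0 * trace (\<Sigma>\<^sub>0 ** matrix_inv \<Lambda>)"
      by (simp add: trace_def matrix_matrix_mult_def sum_distrib_left mult_ac)
    then have "exp (- trace ((\<nu>\<^sub>0 *\<^sub>R \<Sigma>\<^sub>0) ** matrix_inv \<Lambda>) / 2) \<le> exp (- (\<nu>\<^sub>0 * e / 2) * trace (matrix_inv \<Lambda>))"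
      using e(2)[OF pos_def_matrix_inv(3)[OF \<Lambda>]] \<nu>\<^sub>0 by (simp add: mult_ac)
    moreover have "- (\<nu>\<^sub>0 + real CARD('d) + 1 + real CARD('d) + 1) / 2 = - (\<nu>\<^sub>0 / 2 + real CARD('d) + 1)"
      by (simp add: field_simps)
    ultimately show "kernel \<Lambda> \<le> wishart_bound (\<nu>\<^sub>0 / 2 + real CARD('d) + 1) (\<nu>\<^sub>0 * e / 2) \<Lambda>"
      using \<Lambda> by (simp only: inv_wishart_kernel_def wishart_bound_def if_True mult_left_mono powr_ge_zero)
  qed
qed

lemma integrable_kernel: "integrable lborel_pos_def kernel"
proof -
  obtain c where c: "c > 0" "\<And>\<Lambda>. pos_def \<Lambda> \<Longrightarrow> kernel \<Lambda> \<le> wishart_bound (\<nu>\<^sub>0 / 2 + real CARD('d) + 1) c \<Lambda>"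
    using kernel_le_wishart_bound by blast
  show ?thesis
  proof (rule integrableI_nonneg)
    show "kernel \<in> borel_measurable lborel_pos_def"
      by (intro measurable_lborel_pos_def measurable_inv_wishart_kernel)
    show "AE \<Lambda> in lborel_pos_def. 0 \<le> kernel \<Lambda>"
      by (intro AE_I2) (simp add: space_lborel_pos_def inv_wishart_kernel_pos less_imp_le)
    have "(\<integral>\<^sup>+\<Lambda>. ennreal (kernel \<Lambda>) \<partial>lborel_pos_def) \<le> (\<integral>\<^sup>+\<Lambda>. ennreal (wishart_bound (\<nu>\<^sub>0 / 2 + real CARD('d) + 1) c \<Lambda>)
        \<partial>(lborel_pos_def :: (real^'d^'d) measure))"
      using c(2) by (intro nn_integral_mono ennreal_leI) (simp add: space_lborel_pos_def)
    also have "\<dots> < \<infinity>"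
      using c(1) \<nu>\<^sub>0 by (intro nn_integral_wishart_bound_lborel_pos_def) auto
    finally show "(\<integral>\<^sup>+\<Lambda>. ennreal (kernel \<Lambda>) \<partial>lborel_pos_def) < \<infinity>" .
  qed
qed

text \<open>
  The normalising constant of the inverse Wishart density is not a default value: the kernel is integrable
  and strictly positive on a set of positive measure.
\<close>

lemma integral_kernel_pos: "(\<integral>\<Lambda>. kernel \<Lambda> \<partial>lborel_pos_def) > 0"
proof (rule integral_pos_if_pos[OF integrable_kernel])
  show "emeasure (lborel_pos_def :: (real^'d^'d) measure) (space lborel_pos_def) \<noteq> 0"
    using emeasure_lborel_pos_def_pos[where 'd='d] by (simp add: space_lborel_pos_def)
qed (simp add: space_lborel_pos_def inv_wishart_kernel_pos)

lemma prior_eq: "prior \<theta> = kernel (snd \<theta>) / (\<integral>\<Lambda>. kernel \<Lambda> \<partial>lborel_pos_def)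
    * mvn_density \<mu>\<^sub>0 ((1 / \<kappa>\<^sub>0) *\<^sub>R snd \<theta>) (fst \<theta>)"
  by (simp add: niw_density_def inv_wishart_density_def case_prod_beta)

lemma prior_pos:
  assumes "\<theta> \<in> space niw_space"
  shows "prior \<theta> > 0"
proof -
  have \<Lambda>: "pos_def (snd \<theta>)" using assms by (simp add: space_niw_space)
  then show ?thesis
    unfolding prior_eq
    using integral_kernel_pos inv_wishart_kernel_pos[OF \<Lambda>]
      mvn_density_pos[OF pos_def_scaleR(1)[OF \<Lambda>, of "1 / \<kappa>\<^sub>0"]] \<kappa>\<^sub>0
    by simp
qed

lemma measurable_prior [measurable]: "prior \<in> borel_measurable niw_space"
proof -
  have "(\<lambda>\<theta>. kernel (snd \<theta>)) \<in> borel_measurable niw_space"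
    by (rule measurable_compose[OF measurable_niw_snd measurable_inv_wishart_kernel])
  then show ?thesis unfolding prior_eq[abs_def] by measurable
qed

lemma prob_space_prior: "prob_space (density niw_space (\<lambda>\<theta>. ennreal (prior \<theta>)))"
proof
  let ?Z = "\<integral>\<Lambda>. kernel \<Lambda> \<partial>lborel_pos_def"
  interpret pair_sigma_finite "lborel :: (real^'d) measure" "lborel_pos_def :: (real^'d^'d) measure"
    by (rule pair_sigma_finite_niw)
  have "(\<integral>\<^sup>+\<theta>. ennreal (prior \<theta>) \<partial>niw_space) =
      (\<integral>\<^sup>+\<Lambda>. \<integral>\<^sup>+\<mu>. ennreal (prior (\<mu>, \<Lambda>)) \<partial>lborel \<partial>lborel_pos_def)"
    using nn_integral_snd[of "\<lambda>\<theta>. ennreal (prior \<theta>)"]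
      measurable_compose[OF measurable_prior measurable_ennreal]
    unfolding niw_space_def by simp
  also have "\<dots> = (\<integral>\<^sup>+\<Lambda>. ennreal (kernel \<Lambda> / ?Z) \<partial>lborel_pos_def)"
  proof (rule nn_integral_cong)
    fix \<Lambda> :: "real^'d^'d" assume "\<Lambda> \<in> space lborel_pos_def"
    then have \<Lambda>: "pos_def \<Lambda>" by (simp add: space_lborel_pos_def)
    then have \<Lambda>': "pos_def ((1 / \<kappa>\<^sub>0) *\<^sub>R \<Lambda>)" using \<kappa>\<^sub>0 by (intro pos_def_scaleR) auto
    have "(\<integral>\<^sup>+\<mu>. ennreal (prior (\<mu>, \<Lambda>)) \<partial>lborel) =
        (\<integral>\<^sup>+\<mu>. ennreal (kernel \<Lambda> / ?Z) * ennreal (mvn_density \<mu>\<^sub>0 ((1 / \<kappa>\<^sub>0) *\<^sub>R \<Lambda>) \<mu>) \<partial>lborel)"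
      unfolding prior_eq using integral_kernel_pos inv_wishart_kernel_pos[OF \<Lambda>] mvn_density_pos[OF \<Lambda>']
      by (intro nn_integral_cong) (simp add: ennreal_mult[symmetric] less_imp_le)
    also have "\<dots> = ennreal (kernel \<Lambda> / ?Z)"
      using nn_integral_mvn_density[OF \<Lambda>', of \<mu>\<^sub>0] by (subst nn_integral_cmult) auto
    finally show "(\<integral>\<^sup>+\<mu>. ennreal (prior (\<mu>, \<Lambda>)) \<partial>lborel) = ennreal (kernel \<Lambda> / ?Z)" .
  qed
  also have "\<dots> = ennreal (\<integral>\<Lambda>. kernel \<Lambda> / ?Z \<partial>lborel_pos_def)"
  proof (rule nn_integral_eq_integral)
    show "AE \<Lambda> in lborel_pos_def. 0 \<le> kernel \<Lambda> / ?Z"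
      using integral_kernel_pos
      by (intro AE_I2) (simp add: space_lborel_pos_def inv_wishart_kernel_pos less_imp_le)
  qed (use integrable_kernel in simp)
  also have "\<dots> = 1"
    using integral_kernel_pos by simp
  finally show "emeasure (density niw_space (\<lambda>\<theta>. ennreal (prior \<theta>))) (space (density niw_space (\<lambda>\<theta>. ennreal (prior \<theta>)))) = 1"
    by (simp add: emeasure_density cong: nn_integral_cong)
qed

section \<open>Integrability under the posterior of a cluster\<close>

text \<open>
  The integrand of the cluster likelihood: the posterior density of the parameter given the observations
  in \<open>I\<close>, without its normalising constant \<open>f(x\<^sub>I)\<close>.
\<close>

definition unnormalized_posterior :: "(nat \<Rightarrow> real^'d) \<Rightarrow> nat set \<Rightarrow> (real^'d) \<times> (real^'d^'d) \<Rightarrow> real" where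
  "unnormalized_posterior x I \<theta> = prior \<theta> * (\<Prod>i\<in>I. normal_component \<theta> (x i))"

lemma measurable_unnormalized_posterior [measurable]:
  "unnormalized_posterior x I \<in> borel_measurable niw_space"
  unfolding unnormalized_posterior_def normal_component_def case_prod_beta by measurable

lemma unnormalized_posterior_pos:
  assumes "\<theta> \<in> space niw_space"
  shows "unnormalized_posterior x I \<theta> > 0"
  unfolding unnormalized_posterior_def normal_component_def case_prod_beta
  using assms prior_pos[OF assms] by (intro mult_pos_pos prod_pos) (auto simp: space_niw_space mvn_density_pos)

lemma prior_le_niw_envelope:
  obtains c C where "c > 0" "C > 0"
    "\<And>\<theta>. \<theta> \<in> space niw_space \<Longrightarrow> prior \<theta> \<le> C * niw_envelope ((\<nu>\<^sub>0 / 2 + real CARD('d) + 1) + 1 / 2) c (\<kappa>\<^sub>0 / 2) \<mu>\<^sub>0 \<theta>"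
proof -
  let ?Z = "\<integral>\<Lambda>. kernel \<Lambda> \<partial>lborel_pos_def"
  obtain c where c: "c > 0" "\<And>\<Lambda>. pos_def \<Lambda> \<Longrightarrow> kernel \<Lambda> \<le> wishart_bound (\<nu>\<^sub>0 / 2 + real CARD('d) + 1) c \<Lambda>"
    using kernel_le_wishart_bound by blast
  define K where "K = 1 / sqrt ((2 * pi) ^ CARD('d) * (1 / \<kappa>\<^sub>0) ^ CARD('d))"
  have K: "K > 0" using \<kappa>\<^sub>0 by (simp add: K_def)
  show ?thesis
  proof (rule that)
    show "c > 0" by fact
    show "1 / ?Z * K > 0" using K integral_kernel_pos by simp
    fix \<theta> :: "(real^'d) \<times> (real^'d^'d)" assume "\<theta> \<in> space niw_space"
    then have \<Lambda>: "pos_def (snd \<theta>)" by (simp add: space_niw_space)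
    note det = pos_def_det_pos[OF \<Lambda>]
    have quad: "(fst \<theta> - \<mu>\<^sub>0) \<bullet> (matrix_inv ((1 / \<kappa>\<^sub>0) *\<^sub>R snd \<theta>) *v (fst \<theta> - \<mu>\<^sub>0)) = \<kappa>\<^sub>0 * niw_energy \<mu>\<^sub>0 \<theta>"
      using \<kappa>\<^sub>0 pos_def_scaleR(2)[OF \<Lambda>, of "1 / \<kappa>\<^sub>0"]
      by (simp add: niw_energy_def case_prod_beta scaleR_matrix_vector_assoc[symmetric])
    have "det (snd \<theta>) powr (- 1 / 2) = 1 / sqrt (det (snd \<theta>))"
      using det by (simp add: powr_minus_divide powr_half_sqrt)
    then have gauss: "mvn_density \<mu>\<^sub>0 ((1 / \<kappa>\<^sub>0) *\<^sub>R snd \<theta>) (fst \<theta>) =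
        K * det (snd \<theta>) powr (- 1 / 2) * exp (- (\<kappa>\<^sub>0 / 2) * niw_energy \<mu>\<^sub>0 \<theta>)"
      unfolding mvn_density_def quad det_scaleR K_def by (simp add: real_sqrt_mult)
    have "prior \<theta> \<le> wishart_bound (\<nu>\<^sub>0 / 2 + real CARD('d) + 1) c (snd \<theta>) / ?Z * mvn_density \<mu>\<^sub>0 ((1 / \<kappa>\<^sub>0) *\<^sub>R snd \<theta>) (fst \<theta>)"
      unfolding prior_eq using c(2)[OF \<Lambda>] integral_kernel_pos \<kappa>\<^sub>0
        mvn_density_pos[OF pos_def_scaleR(1)[OF \<Lambda>, of "1 / \<kappa>\<^sub>0"]]
      by (intro mult_right_mono divide_right_mono) (auto intro: less_imp_le)
    also have "\<dots> = 1 / ?Z * K * ((det (snd \<theta>) powr (- (\<nu>\<^sub>0 / 2 + real CARD('d) + 1)) * det (snd \<theta>) powr (- 1 / 2)) *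
        exp (- c * precision_trace \<theta>) * exp (- (\<kappa>\<^sub>0 / 2) * niw_energy \<mu>\<^sub>0 \<theta>))"
      unfolding gauss wishart_bound_def precision_trace_def using \<Lambda> by simp
    also have "det (snd \<theta>) powr (- (\<nu>\<^sub>0 / 2 + real CARD('d) + 1)) * det (snd \<theta>) powr (- 1 / 2) = det (snd \<theta>) powr (- ((\<nu>\<^sub>0 / 2 + real CARD('d) + 1) + 1 / 2))"
      by (simp add: powr_add[symmetric])
    finally show "prior \<theta> \<le> 1 / ?Z * K * niw_envelope ((\<nu>\<^sub>0 / 2 + real CARD('d) + 1) + 1 / 2) c (\<kappa>\<^sub>0 / 2) \<mu>\<^sub>0 \<theta>"
      by (simp add: niw_envelope_def)
  qed
qed

text \<open>
  Each observation contributes at most \<open>|\<Lambda>|\<^sup>-\<^sup>1\<^sup>/\<^sup>2\<close>, which is bounded by a power of \<open>tr(\<Lambda>\<^sup>-\<^sup>1)\<close> and is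
  absorbed by half of the exponential of the trace. The constant \<open>c\<close> shrinks with the size of the cluster.
\<close>

lemma unnormalized_posterior_le_niw_envelope:
  assumes "finite I"
  obtains c C where "c > 0" "C > 0"
    "\<And>\<theta>. \<theta> \<in> space niw_space \<Longrightarrow>
      unnormalized_posterior x I \<theta> \<le> C * niw_envelope ((\<nu>\<^sub>0 / 2 + real CARD('d) + 1) + 1 / 2) c (\<kappa>\<^sub>0 / 2) \<mu>\<^sub>0 \<theta>"
  using assms
proof (induction I arbitrary: thesis rule: finite_induct)
  case empty
  show ?case
    using prior_le_niw_envelope empty unfolding unnormalized_posterior_def prod.empty mult_1_right by blast
next
  case (insert i I)
  obtain c C where c: "c > 0" "C > 0" and le: "\<And>\<theta>. \<theta> \<in> space niw_space \<Longrightarrow>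
      unnormalized_posterior x I \<theta> \<le> C * niw_envelope ((\<nu>\<^sub>0 / 2 + real CARD('d) + 1) + 1 / 2) c (\<kappa>\<^sub>0 / 2) \<mu>\<^sub>0 \<theta>"
    using insert.IH by blast
  obtain K where K: "K > 0" "\<And>u. u \<ge> 0 \<Longrightarrow> u powr (real CARD('d) / 2) * exp (- (c / 2) * u) \<le> K"
    using powr_mult_exp_bounded[of "real CARD('d) / 2" "c / 2"] c(1) by auto
  let ?F = "sqrt (fact CARD('d)) :: real"
  show ?case
  proof (rule insert.prems)
    show "c / 2 > 0" "C * (?F * K) > 0" using c K by auto
    fix \<theta> :: "(real^'d) \<times> (real^'d^'d)" assume \<theta>: "\<theta> \<in> space niw_space"
    then have \<Lambda>: "pos_def (snd \<theta>)" by (simp add: space_niw_space)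
    let ?t = "precision_trace \<theta>"
    have t: "?t \<ge> 0" by (rule precision_trace_nonneg[OF \<theta>])
    have env: "niw_envelope \<alpha> c \<kappa> \<mu>\<^sub>0 \<theta> \<ge> 0" for \<alpha> c \<kappa> by (simp add: niw_envelope_def)
    have "det (snd \<theta>) powr (- 1 / 2) = sqrt (det (matrix_inv (snd \<theta>)))"
      using pos_def_det_pos[OF \<Lambda>]
      by (simp add: det_matrix_inv[OF \<Lambda>] powr_minus_divide powr_half_sqrt real_sqrt_divide)
    also have "\<dots> \<le> sqrt (fact CARD('d) * ?t ^ CARD('d))"
      unfolding precision_trace_def using pos_def_det_le_trace[OF pos_def_matrix_inv(3)[OF \<Lambda>]] by simp
    also have "\<dots> = ?F * ?t powr (real CARD('d) / 2)"
    proof (cases "?t = 0")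
      case False
      then have "sqrt (?t ^ CARD('d)) = ?t powr (real CARD('d) / 2)"
        using t by (simp add: powr_half_sqrt[symmetric] powr_realpow[symmetric] powr_powr)
      then show ?thesis by (simp add: real_sqrt_mult)
    qed (simp add: power_0_left)
    finally have det_le: "det (snd \<theta>) powr (- 1 / 2) \<le> ?F * ?t powr (real CARD('d) / 2)" .
    have "unnormalized_posterior x (insert i I) \<theta> = unnormalized_posterior x I \<theta> * normal_component \<theta> (x i)"
      using insert.hyps by (simp add: unnormalized_posterior_def)
    also have "\<dots> \<le> (C * niw_envelope ((\<nu>\<^sub>0 / 2 + real CARD('d) + 1) + 1 / 2) c (\<kappa>\<^sub>0 / 2) \<mu>\<^sub>0 \<theta>) * (?F * ?t powr (real CARD('d) / 2))"
      using mvn_density_le[OF \<Lambda>, of "fst \<theta>" "x i"] det_le le[OF \<theta>] unnormalized_posterior_pos[OF \<theta>, of x I] c(2) env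
        mvn_density_pos[OF \<Lambda>, of "fst \<theta>" "x i"]
      by (intro mult_mono) (auto simp: normal_component_def case_prod_beta intro: less_imp_le)
    also have "\<dots> = C * ?F * niw_envelope ((\<nu>\<^sub>0 / 2 + real CARD('d) + 1) + 1 / 2) (c / 2) (\<kappa>\<^sub>0 / 2) \<mu>\<^sub>0 \<theta> *
        (?t powr (real CARD('d) / 2) * exp (- (c / 2) * ?t))"
    proof -
      have "exp (- c * ?t) = exp (- (c / 2) * ?t) * exp (- (c / 2) * ?t)"
        by (simp add: exp_add[symmetric])
      then show ?thesis
        unfolding niw_envelope_def by (simp only: mult_ac)
    qed
    also have "\<dots> \<le> C * ?F * niw_envelope ((\<nu>\<^sub>0 / 2 + real CARD('d) + 1) + 1 / 2) (c / 2) (\<kappa>\<^sub>0 / 2) \<mu>\<^sub>0 \<theta> * K"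
      using K(2)[OF t] c(2) env by (intro mult_left_mono) auto
    finally show "unnormalized_posterior x (insert i I) \<theta> \<le>
        C * (?F * K) * niw_envelope ((\<nu>\<^sub>0 / 2 + real CARD('d) + 1) + 1 / 2) (c / 2) (\<kappa>\<^sub>0 / 2) \<mu>\<^sub>0 \<theta>"
      by (simp add: mult_ac)
  qed
qed

lemma integrable_posterior_times:
  assumes "finite I" and [measurable]: "f \<in> borel_measurable niw_space"
    and bound: "\<And>\<theta>. \<theta> \<in> space niw_space \<Longrightarrow> \<bar>f \<theta>\<bar> \<le> K * (1 + precision_trace \<theta> + niw_energy \<mu>\<^sub>0 \<theta>)"
  shows "integrable niw_space (\<lambda>\<theta>. unnormalized_posterior x I \<theta> * f \<theta>)"
proof -
  obtain c C where c: "c > 0" "C > 0" and le: "\<And>\<theta>. \<theta> \<in> space niw_space \<Longrightarrow>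
      unnormalized_posterior x I \<theta> \<le> C * niw_envelope ((\<nu>\<^sub>0 / 2 + real CARD('d) + 1) + 1 / 2) c (\<kappa>\<^sub>0 / 2) \<mu>\<^sub>0 \<theta>"
    using unnormalized_posterior_le_niw_envelope[OF assms(1)] by blast
  show ?thesis
  proof (rule integrable_niw_polynomial[of "(\<nu>\<^sub>0 / 2 + real CARD('d) + 1) + 1 / 2" c "\<kappa>\<^sub>0 / 2" _ "C * K"])
    fix \<theta> :: "(real^'d) \<times> (real^'d^'d)" assume \<theta>: "\<theta> \<in> space niw_space"
    have "\<bar>unnormalized_posterior x I \<theta> * f \<theta>\<bar> = unnormalized_posterior x I \<theta> * \<bar>f \<theta>\<bar>"
      using unnormalized_posterior_pos[OF \<theta>, of x I] by (simp add: abs_mult)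
    also have "\<dots> \<le> (C * niw_envelope ((\<nu>\<^sub>0 / 2 + real CARD('d) + 1) + 1 / 2) c (\<kappa>\<^sub>0 / 2) \<mu>\<^sub>0 \<theta>) *
        (K * (1 + precision_trace \<theta> + niw_energy \<mu>\<^sub>0 \<theta>))"
      using le[OF \<theta>] bound[OF \<theta>] unnormalized_posterior_pos[OF \<theta>, of x I] c(2)
      by (intro mult_mono) (auto simp: niw_envelope_def)
    finally show "\<bar>unnormalized_posterior x I \<theta> * f \<theta>\<bar> \<le>
        C * K * (1 + precision_trace \<theta> + niw_energy \<mu>\<^sub>0 \<theta>) * niw_envelope ((\<nu>\<^sub>0 / 2 + real CARD('d) + 1) + 1 / 2) c (\<kappa>\<^sub>0 / 2) \<mu>\<^sub>0 \<theta>"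
      by (simp add: mult_ac)
  qed (use c \<kappa>\<^sub>0 \<nu>\<^sub>0 in auto)
qed


section \<open>Exchanging two observations\<close>

definition posterior_mean :: "(nat \<Rightarrow> real^'d) \<Rightarrow> nat set \<Rightarrow> ((real^'d) \<times> (real^'d^'d) \<Rightarrow> real) \<Rightarrow> real" where
  "posterior_mean x I f =
     (\<integral>\<theta>. unnormalized_posterior x I \<theta> * f \<theta> \<partial>niw_space) / (\<integral>\<theta>. unnormalized_posterior x I \<theta> \<partial>niw_space)"

lemma cluster_likelihood_eq:
  "cluster_likelihood niw_space prior normal_component x I = (\<integral>\<theta>. unnormalized_posterior x I \<theta> \<partial>niw_space)"
  by (simp add: cluster_likelihood_def unnormalized_posterior_def)

lemma integrable_unnormalized_posterior:
  assumes "finite I"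
  shows "integrable niw_space (unnormalized_posterior x I)"
proof -
  have "integrable niw_space (\<lambda>\<theta>. unnormalized_posterior x I \<theta> * 1)"
  proof (rule integrable_posterior_times[OF assms, of _ 1])
    fix \<theta> :: "(real^'d) \<times> (real^'d^'d)" assume \<theta>: "\<theta> \<in> space niw_space"
    show "\<bar>1\<bar> \<le> 1 * (1 + precision_trace \<theta> + niw_energy \<mu>\<^sub>0 \<theta>)"
      using precision_trace_nonneg[OF \<theta>] niw_energy_nonneg[OF \<theta>, of \<mu>\<^sub>0] by simp
  qed simp
  then show ?thesis by simp
qed

lemma cluster_likelihood_pos:
  assumes "finite I"
  shows "cluster_likelihood niw_space prior normal_component x I > 0"
  unfolding cluster_likelihood_eq
  by (intro integral_pos_if_pos integrable_unnormalized_posterior assms unnormalized_posterior_pos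
      emeasure_niw_space_nonzero)

lemma integrable_posterior_precision:
  assumes "finite I"
  shows "integrable niw_space (\<lambda>\<theta>. unnormalized_posterior x I \<theta> * matrix_inv (snd \<theta>) $ i $ j)"
proof (rule integrable_posterior_times[OF assms, of _ 1])
  fix \<theta> :: "(real^'d) \<times> (real^'d^'d)" assume \<theta>: "\<theta> \<in> space niw_space"
  then have "\<bar>matrix_inv (snd \<theta>) $ i $ j\<bar> \<le> precision_trace \<theta>"
    unfolding precision_trace_def
    by (intro pos_def_trace_bounds pos_def_matrix_inv) (simp add: space_niw_space)
  then show "\<bar>matrix_inv (snd \<theta>) $ i $ j\<bar> \<le> 1 * (1 + precision_trace \<theta> + niw_energy \<mu>\<^sub>0 \<theta>)"
    using niw_energy_nonneg[OF \<theta>, of \<mu>\<^sub>0] by simp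
qed measurable

text \<open>
  Split \<open>\<mu> = (\<mu> - \<mu>\<^sub>0) + \<mu>\<^sub>0\<close>: the first part is bounded by the geometric mean of trace and energy, the second
  by a multiple of the trace.
\<close>

lemma integrable_posterior_precision_mean:
  assumes "finite I"
  shows "integrable niw_space (\<lambda>\<theta>. unnormalized_posterior x I \<theta> * (matrix_inv (snd \<theta>) *v fst \<theta>) $ i)"
proof (rule integrable_posterior_times[OF assms, of _ "1 + (\<Sum>j\<in>UNIV. \<bar>\<mu>\<^sub>0 $ j\<bar>)"])
  fix \<theta> :: "(real^'d) \<times> (real^'d^'d)" assume \<theta>: "\<theta> \<in> space niw_space"
  let ?Y = "matrix_inv (snd \<theta>)" and ?t = "precision_trace \<theta>" and ?q = "niw_energy \<mu>\<^sub>0 \<theta>"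
  have Y: "pos_def ?Y" using \<theta> pos_def_matrix_inv(3) by (simp add: space_niw_space)
  have t: "?t \<ge> 0" and q: "?q \<ge> 0"
    by (rule precision_trace_nonneg[OF \<theta>], rule niw_energy_nonneg[OF \<theta>])
  have "((?Y *v (fst \<theta> - \<mu>\<^sub>0)) $ i)\<^sup>2 \<le> ?t * ?q"
    using pos_def_trace_bounds(3)[OF Y] by (simp add: precision_trace_def niw_energy_def case_prod_beta)
  also have "\<dots> \<le> (?t + ?q)\<^sup>2"
    using t q by (simp add: power2_eq_square algebra_simps)
  finally have centred: "\<bar>(?Y *v (fst \<theta> - \<mu>\<^sub>0)) $ i\<bar> \<le> ?t + ?q"
    using t q by (simp flip: abs_le_square_iff)
  have "\<bar>(?Y *v \<mu>\<^sub>0) $ i\<bar> \<le> (\<Sum>j\<in>UNIV. \<bar>?Y $ i $ j * \<mu>\<^sub>0 $ j\<bar>)"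
    unfolding matrix_vector_mult_def vec_lambda_beta by (rule sum_abs)
  also have "\<dots> \<le> (\<Sum>j\<in>UNIV. ?t * \<bar>\<mu>\<^sub>0 $ j\<bar>)"
    unfolding abs_mult precision_trace_def
    by (intro sum_mono mult_right_mono pos_def_trace_bounds(2)[OF Y]) auto
  also have "\<dots> = ?t * (\<Sum>j\<in>UNIV. \<bar>\<mu>\<^sub>0 $ j\<bar>)"
    by (simp add: sum_distrib_left)
  also have "\<dots> \<le> (1 + ?t + ?q) * (\<Sum>j\<in>UNIV. \<bar>\<mu>\<^sub>0 $ j\<bar>)"
    using t q by (intro mult_right_mono sum_nonneg) auto
  finally have const: "\<bar>(?Y *v \<mu>\<^sub>0) $ i\<bar> \<le> (1 + ?t + ?q) * (\<Sum>j\<in>UNIV. \<bar>\<mu>\<^sub>0 $ j\<bar>)" .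
  have "(?Y *v fst \<theta>) $ i = (?Y *v (fst \<theta> - \<mu>\<^sub>0)) $ i + (?Y *v \<mu>\<^sub>0) $ i"
    by (simp add: matrix_vector_mult_diff_distrib)
  then have "\<bar>(?Y *v fst \<theta>) $ i\<bar> \<le> (1 + ?t + ?q) + (1 + ?t + ?q) * (\<Sum>j\<in>UNIV. \<bar>\<mu>\<^sub>0 $ j\<bar>)"
    using centred const by linarith
  then show "\<bar>(?Y *v fst \<theta>) $ i\<bar> \<le> (1 + (\<Sum>j\<in>UNIV. \<bar>\<mu>\<^sub>0 $ j\<bar>)) * (1 + ?t + ?q)"
    by (simp add: algebra_simps)
qed measurable

text \<open>
  The log-likelihood is linear in the entries of \<open>\<Lambda>\<^sup>-\<^sup>1\<close> and \<open>\<Lambda>\<^sup>-\<^sup>1\<mu>\<close>, so its posterior mean is again a quadratic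
  polynomial, whose coefficients are the posterior means of these entries.
\<close>

lemma
  assumes "finite I"
  shows integrable_posterior_log_likelihood_kernel:
      "integrable niw_space (\<lambda>\<theta>. unnormalized_posterior x I \<theta> * log_likelihood_kernel \<theta> v)"
    and posterior_mean_log_likelihood_kernel:
      "posterior_mean x I (\<lambda>\<theta>. log_likelihood_kernel \<theta> v) =
      (\<chi> i. posterior_mean x I (\<lambda>\<theta>. (matrix_inv (snd \<theta>) *v fst \<theta>) $ i)) \<bullet> v
      - (v \<bullet> ((\<chi> i j. posterior_mean x I (\<lambda>\<theta>. matrix_inv (snd \<theta>) $ i $ j)) *v v)) / 2"
proof -
  let ?h = "unnormalized_posterior x I"
  let ?b = "\<lambda>\<theta> i. ?h \<theta> * (matrix_inv (snd \<theta>) *v fst \<theta>) $ i"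
  let ?Q = "\<lambda>\<theta> i j. ?h \<theta> * matrix_inv (snd \<theta>) $ i $ j"
  have expand: "?h \<theta> * log_likelihood_kernel \<theta> v =
      (\<Sum>i\<in>UNIV. ?b \<theta> i * v $ i) - (\<Sum>i\<in>UNIV. \<Sum>j\<in>UNIV. ?Q \<theta> i j * (v $ i * v $ j)) / 2" for \<theta>
    unfolding log_likelihood_kernel_def right_diff_distrib
    by (simp add: inner_vec_def matrix_vector_mult_def[of _ v] sum_distrib_left mult_ac sum_divide_distrib)
  note int = integrable_posterior_precision[OF assms] integrable_posterior_precision_mean[OF assms]
  show "integrable niw_space (\<lambda>\<theta>. ?h \<theta> * log_likelihood_kernel \<theta> v)"
    unfolding expand
    by (intro Bochner_Integration.integrable_diff integrable_divide Bochner_Integration.integrable_sum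
        integrable_mult_left int)
  have "(\<integral>\<theta>. ?h \<theta> * log_likelihood_kernel \<theta> v \<partial>niw_space) =
      (\<Sum>i\<in>UNIV. (\<integral>\<theta>. ?b \<theta> i \<partial>niw_space) * v $ i)
      - (\<Sum>i\<in>UNIV. \<Sum>j\<in>UNIV. (\<integral>\<theta>. ?Q \<theta> i j \<partial>niw_space) * (v $ i * v $ j)) / 2"
    unfolding expand
    by (subst Bochner_Integration.integral_diff)
       (simp_all add: Bochner_Integration.integral_sum Bochner_Integration.integrable_sum int)
  then show "posterior_mean x I (\<lambda>\<theta>. log_likelihood_kernel \<theta> v) =
      (\<chi> i. posterior_mean x I (\<lambda>\<theta>. (matrix_inv (snd \<theta>) *v fst \<theta>) $ i)) \<bullet> v
      - (v \<bullet> ((\<chi> i j. posterior_mean x I (\<lambda>\<theta>. matrix_inv (snd \<theta>) $ i $ j)) *v v)) / 2"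
    unfolding posterior_mean_def
    by (simp add: diff_divide_distrib inner_vec_def matrix_vector_mult_def sum_divide_distrib sum_distrib_left
        mult_ac)
qed

text \<open>
  Exchanging \<open>x i\<close> for \<open>x j\<close> multiplies the integrand by the exponential of the difference of the
  log-likelihoods, whose posterior mean is \<open>m\<close>; so this is Jensen's inequality for the posterior of \<open>I\<close>.
\<close>

lemma
  fixes x :: "nat \<Rightarrow> real^'d"
  assumes I: "finite I" "i \<in> I" "j \<notin> I"
  defines "m \<equiv> posterior_mean x I (\<lambda>\<theta>. log_likelihood_kernel \<theta> (x j))
      - posterior_mean x I (\<lambda>\<theta>. log_likelihood_kernel \<theta> (x i))"
  defines "F \<equiv> cluster_likelihood niw_space prior normal_component x"
  shows cluster_likelihood_exchange: "F I * exp m \<le> F (insert j (I - {i}))"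
    and cluster_likelihood_exchange_strict: "x i \<noteq> x j \<Longrightarrow> F I * exp m < F (insert j (I - {i}))"
proof -
  let ?h = "unnormalized_posterior x I"
  let ?r = "\<lambda>\<theta>. log_likelihood_kernel \<theta> (x j) - log_likelihood_kernel \<theta> (x i)"
  have exchange: "unnormalized_posterior x (insert j (I - {i})) \<theta> = ?h \<theta> * exp (?r \<theta>)"
    if "\<theta> \<in> space niw_space" for \<theta>
    using I normal_component_eq_exp_times[OF that, of "x j" "x i"]
    by (simp add: unnormalized_posterior_def prod.remove[of I i])
  have h: "integrable niw_space ?h"
    by (rule integrable_unnormalized_posterior[OF I(1)])
  have hr: "integrable niw_space (\<lambda>\<theta>. ?h \<theta> * ?r \<theta>)"
    unfolding right_diff_distrib
    by (intro Bochner_Integration.integrable_diff integrable_posterior_log_likelihood_kernel I(1))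
  have "integrable niw_space (unnormalized_posterior x (insert j (I - {i})))"
    using I(1) by (intro integrable_unnormalized_posterior) simp
  moreover have "integrable niw_space (unnormalized_posterior x (insert j (I - {i}))) \<longleftrightarrow>
      integrable niw_space (\<lambda>\<theta>. ?h \<theta> * exp (?r \<theta>))"
    by (intro Bochner_Integration.integrable_cong refl exchange)
  ultimately have hexp: "integrable niw_space (\<lambda>\<theta>. ?h \<theta> * exp (?r \<theta>))"
    by simp
  have pos: "(\<integral>\<theta>. ?h \<theta> \<partial>niw_space) > 0"
    using cluster_likelihood_pos[OF I(1)] unfolding cluster_likelihood_eq .
  have m: "(\<integral>\<theta>. ?h \<theta> * ?r \<theta> \<partial>niw_space) / (\<integral>\<theta>. ?h \<theta> \<partial>niw_space) = m"
    unfolding m_def posterior_mean_def right_diff_distrib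
    by (subst Bochner_Integration.integral_diff)
       (simp_all add: integrable_posterior_log_likelihood_kernel I(1) diff_divide_distrib)
  have F: "F (insert j (I - {i})) = (\<integral>\<theta>. ?h \<theta> * exp (?r \<theta>) \<partial>niw_space)"
    unfolding F_def cluster_likelihood_eq
    by (rule Bochner_Integration.integral_cong[OF refl exchange])
  show "F I * exp m \<le> F (insert j (I - {i}))"
    using jensen_exp[OF h unnormalized_posterior_pos hr hexp pos] unfolding m F
    by (simp add: F_def cluster_likelihood_eq)
  show "F I * exp m < F (insert j (I - {i}))" if "x i \<noteq> x j"
    using jensen_exp_strict[OF h unnormalized_posterior_pos hr hexp pos
        log_likelihood_kernel_diff_not_constant[OF that[symmetric]]] unfolding m F
    by (simp add: F_def cluster_likelihood_eq)
qed

text \<open>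
  The transposition of \<open>i\<close> and \<open>j\<close> maps the MAP partition to a competitor with the same prior probability,
  and the two partitions differ only in these two clusters. The common factors are positive and cancel.
\<close>

lemma MAP_cluster_exchange:
  fixes x :: "nat \<Rightarrow> real^'d"
  assumes P: "P \<in> space (prob_algebra (weight_space m))"
    and MAP: "MAP_partition niw_space prior normal_component P n x \<I>"
    and IJ: "I \<in> \<I>" "J \<in> \<I>" "I \<noteq> J" and ij: "i \<in> I" "j \<in> J"
  defines "F \<equiv> cluster_likelihood niw_space prior normal_component x"
  shows "F (insert j (I - {i})) * F (insert i (J - {j})) \<le> F I * F J"
proof -
  let ?p = "partition_prob niw_space prior P n"
  have part: "partition_on {1..n} \<I>"
    and max: "\<And>\<J>. partition_on {1..n} \<J> \<Longrightarrow>
      ?p \<J> * (\<Prod>K\<in>\<J>. F K) \<le> ?p \<I> * (\<Prod>K\<in>\<I>. F K)"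
    using MAP unfolding MAP_partition_def partition_likelihood_def F_def by auto
  have finite_cluster: "finite K" if "partition_on {1..n} \<J>" "K \<in> \<J>" for \<J> and K :: "nat set"
  proof -
    have "K \<subseteq> {1..n}" using partition_onD1[OF that(1)] that(2) by blast
    then show ?thesis by (rule finite_subset) simp
  qed
  have likelihood_pos: "(\<Prod>K\<in>\<J>. F K) > 0" if "partition_on {1..n} \<J>" for \<J>
    unfolding F_def using finite_cluster[OF that] by (intro prod_pos) (auto intro: cluster_likelihood_pos)
  have T: "(\<lambda>\<theta> :: (real^'d) \<times> (real^'d^'d). \<theta>) \<in> niw_space \<rightarrow>\<^sub>M borel"
    using measurable_Pair[OF measurable_niw_fst measurable_niw_snd] by (simp add: borel_prod)
  have p_pos: "?p \<I> > 0"
  proof -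
    obtain \<J> where \<J>: "partition_on {1..n} \<J>" "?p \<J> > 0"
      using ex_partition_prob_pos[OF T prob_space_prior P] by blast
    then have "0 < ?p \<J> * (\<Prod>K\<in>\<J>. F K)" by (simp add: likelihood_pos)
    also have "\<dots> \<le> ?p \<I> * (\<Prod>K\<in>\<I>. F K)" by (rule max[OF \<J>(1)])
    finally show ?thesis using likelihood_pos[OF part] by (simp add: zero_less_mult_iff)
  qed
  let ?\<sigma> = "Transposition.transpose i j"
  have \<sigma>: "?\<sigma> permutes {1..n}"
    using IJ ij partition_onD1[OF part] by (intro permutes_swap_id) auto
  have disj: "K \<inter> L = {}" if "K \<in> \<I>" "L \<in> \<I>" "K \<noteq> L" for K L
    using partition_onD2[OF part] that by (auto simp: disjoint_def)
  have "i \<notin> J" "j \<notin> I" using disj[OF IJ] ij by auto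
  have image_I: "?\<sigma> ` I = insert j (I - {i})"
    using ij \<open>j \<notin> I\<close> by (auto simp: Transposition.transpose_def image_iff)
  have image_J: "?\<sigma> ` J = insert i (J - {j})"
    using ij \<open>i \<notin> J\<close> by (auto simp: Transposition.transpose_def image_iff)
  have image_other: "?\<sigma> ` K = K" if "K \<in> \<I> - {I} - {J}" for K
  proof -
    have "i \<notin> K" "j \<notin> K" using that IJ ij disj[of K I] disj[of K J] by auto
    then have "?\<sigma> k = k" if "k \<in> K" for k using that by (auto simp: Transposition.transpose_def)
    then show ?thesis by simp
  qed
  have part': "partition_on {1..n} ((`) ?\<sigma> ` \<I>)"
  proof -
    have "partition_on (?\<sigma> ` {1..n}) ((`) ?\<sigma> ` \<I> - {{}})"
      using part permutes_inj_on[OF \<sigma>] by (rule partition_on_inj_image)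
    moreover have "{} \<notin> (`) ?\<sigma> ` \<I>" using partition_onD3[OF part] by auto
    ultimately show ?thesis by (simp add: permutes_image[OF \<sigma>] del: One_nat_def)
  qed
  have "inj_on ((`) ?\<sigma>) \<I>"
    by (rule inj_onI) (simp add: inj_image_eq_iff[OF permutes_inj[OF \<sigma>]])
  then have "(\<Prod>K\<in>(`) ?\<sigma> ` \<I>. F K) = (\<Prod>K\<in>\<I>. F (?\<sigma> ` K))"
    by (simp add: prod.reindex)
  moreover have split: "(\<Prod>K\<in>\<I>. G K) = G I * G J * (\<Prod>K\<in>\<I> - {I} - {J}. G K)" for G :: "nat set \<Rightarrow> real"
    using IJ finite_elements[OF _ part]
    by (simp add: prod.remove[of \<I> I] prod.remove[of "\<I> - {I}" J] mult.assoc)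
  moreover have "(\<Prod>K\<in>\<I> - {I} - {J}. F (?\<sigma> ` K)) = (\<Prod>K\<in>\<I> - {I} - {J}. F K)"
    by (intro prod.cong) (simp_all add: image_other)
  moreover have "(\<Prod>K\<in>(`) ?\<sigma> ` \<I>. F K) \<le> (\<Prod>K\<in>\<I>. F K)"
    using max[OF part'] p_pos
    unfolding partition_prob_exchangeable[OF T prob_space_prior P \<sigma>] by simp
  ultimately have "F (insert j (I - {i})) * F (insert i (J - {j})) * (\<Prod>K\<in>\<I> - {I} - {J}. F K)
      \<le> F I * F J * (\<Prod>K\<in>\<I> - {I} - {J}. F K)"
    by (simp add: image_I image_J)
  moreover have "(\<Prod>K\<in>\<I> - {I} - {J}. F K) > 0"
    unfolding F_def using finite_cluster[OF part] by (intro prod_pos) (auto intro: cluster_likelihood_pos)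
  ultimately show ?thesis by simp
qed

text \<open>
  The difference of the posterior means of the log-likelihood for the two clusters separates them: multiplying
  the two Jensen inequalities contradicts the maximality unless it is larger at \<open>x i\<close> than at \<open>x j\<close>.
  Subtracting the least value on \<open>I\<close> gives the asymmetric form \<open>\<ge> 0\<close> on \<open>I\<close> and \<open>< 0\<close> on \<open>J\<close>.
\<close>

lemma MAP_clusters_separated:
  fixes x :: "nat \<Rightarrow> real^'d"
  assumes P: "P \<in> space (prob_algebra (weight_space m))"
    and inj: "inj_on x {1..n}"
    and MAP: "MAP_partition niw_space prior normal_component P n x \<I>"
    and IJ: "I \<in> \<I>" "J \<in> \<I>" "I \<noteq> J"
  obtains L where "polynomial_of_degree_le 2 L" "\<And>i. i \<in> I \<Longrightarrow> L (x i) \<ge> 0" "\<And>j. j \<in> J \<Longrightarrow> L (x j) < 0"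
proof -
  let ?F = "cluster_likelihood niw_space prior normal_component x"
  define M where "M = (\<lambda>K v. posterior_mean x K (\<lambda>\<theta>. log_likelihood_kernel \<theta> v))"
  define contrast where "contrast = (\<lambda>v. M I v - M J v)"
  have part: "partition_on {1..n} \<I>"
    using MAP unfolding MAP_partition_def by blast
  have sub: "I \<subseteq> {1..n}" "J \<subseteq> {1..n}" using partition_onD1[OF part] IJ by auto
  then have fin: "finite I" "finite J" by (auto intro: finite_subset)
  have "I \<noteq> {}" using partition_onD3[OF part] IJ by auto
  have disj: "I \<inter> J = {}" using partition_onD2[OF part] IJ by (auto simp: disjoint_def)
  have less: "contrast (x j) < contrast (x i)" if ij: "i \<in> I" "j \<in> J" for i j
  proof -
    have notin: "i \<notin> J" "j \<notin> I" using disj ij by auto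
    then have "x i \<noteq> x j" using inj sub ij by (metis inj_onD subsetD)
    let ?a = "M I (x j) - M I (x i)" and ?b = "M J (x i) - M J (x j)"
    have pos: "?F I > 0" "?F J > 0" using fin by (auto intro: cluster_likelihood_pos)
    have "?F I * exp ?a < ?F (insert j (I - {i}))"
      unfolding M_def by (rule cluster_likelihood_exchange_strict[OF fin(1) ij(1) notin(2) \<open>x i \<noteq> x j\<close>])
    moreover have "?F J * exp ?b \<le> ?F (insert i (J - {j}))"
      unfolding M_def by (rule cluster_likelihood_exchange[OF fin(2) ij(2) notin(1)])
    ultimately have "(?F I * exp ?a) * (?F J * exp ?b) < ?F (insert j (I - {i})) * ?F (insert i (J - {j}))"
      using pos by (intro mult_less_le_imp_less) auto
    also have "\<dots> \<le> ?F I * ?F J"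
      by (rule MAP_cluster_exchange[OF P MAP IJ ij])
    finally have "(?F I * ?F J) * exp (?a + ?b) < (?F I * ?F J) * 1"
      by (simp add: exp_add mult_ac)
    then have "exp (?a + ?b) < 1"
      using pos by (subst (asm) mult_less_cancel_left_pos) auto
    then show ?thesis by (simp add: contrast_def)
  qed
  define t where "t = Min ((\<lambda>i. contrast (x i)) ` I)"
  have quadratic: "\<exists>Q b. \<forall>v. M K v = b \<bullet> v - (v \<bullet> (Q *v v)) / 2" if "finite K" for K
    unfolding M_def posterior_mean_log_likelihood_kernel[OF that] by blast
  obtain Q b R c where M: "\<And>v. M I v = b \<bullet> v - (v \<bullet> (Q *v v)) / 2" "\<And>v. M J v = c \<bullet> v - (v \<bullet> (R *v v)) / 2"
    using quadratic[OF fin(1)] quadratic[OF fin(2)] by blast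
  show ?thesis
  proof (rule that)
    have "contrast v - t = v \<bullet> (((1 / 2) *\<^sub>R (R - Q)) *v v) + (b - c) \<bullet> v + (- t)" for v
      by (simp add: contrast_def M scaleR_matrix_vector_assoc[symmetric] matrix_vector_mult_diff_rdistrib
          inner_diff_left inner_diff_right diff_divide_distrib)
    then show "polynomial_of_degree_le 2 (\<lambda>v. contrast v - t)"
      using polynomial_of_degree_le_quadratic[of "(1 / 2) *\<^sub>R (R - Q)" "b - c" "- t"] by presburger
    show "contrast (x i) - t \<ge> 0" if "i \<in> I" for i
      using that fin by (simp add: t_def)
    show "contrast (x j) - t < 0" if "j \<in> J" for j
    proof -
      have "t \<in> (\<lambda>i. contrast (x i)) ` I"
        unfolding t_def using fin \<open>I \<noteq> {}\<close> by (intro Min_in) auto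
      then obtain i where "i \<in> I" "t = contrast (x i)" by blast
      then show ?thesis using less[of i j] that by simp
    qed
  qed
qed

end

theorem corollary2p6:
  fixes \<kappa>\<^sub>0 \<nu>\<^sub>0 :: real
    and \<mu>\<^sub>0 :: "real^'d"
    and \<Sigma>\<^sub>0 :: "real^'d^'d"
    and m :: enat
    and P :: "(nat \<Rightarrow> real) measure"
    and n :: nat
    and x :: "nat \<Rightarrow> real^'d"
    and \<I> :: "nat set set"
  assumes "\<kappa>\<^sub>0 > 0" and "\<nu>\<^sub>0 > 0"
    and "pos_def \<Sigma>\<^sub>0"
    and "P \<in> space (prob_algebra (weight_space m))"
    and "inj_on x {1..n}"
    and "MAP_partition niw_space (niw_density \<kappa>\<^sub>0 \<nu>\<^sub>0 \<mu>\<^sub>0 \<Sigma>\<^sub>0) normal_component P n x \<I>"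
  shows "quadratically_separable ((\<lambda>I. x ` I) ` \<I>)"
  unfolding quadratically_separable_def
proof (intro ballI impI)
  fix A B assume "A \<in> (\<lambda>I. x ` I) ` \<I>" "B \<in> (\<lambda>I. x ` I) ` \<I>" "A \<noteq> B"
  then obtain I J where IJ: "I \<in> \<I>" "J \<in> \<I>" "I \<noteq> J" "A = x ` I" "B = x ` J" by auto
  obtain L where "polynomial_of_degree_le 2 L" "\<And>i. i \<in> I \<Longrightarrow> L (x i) \<ge> 0" "\<And>j. j \<in> J \<Longrightarrow> L (x j) < 0"
    using MAP_clusters_separated[OF assms IJ(1-3)] by blast
  then show "\<exists>L. polynomial_of_degree_le 2 L \<and> (\<forall>a\<in>A. L a \<ge> 0) \<and> (\<forall>b\<in>B. L b < 0)"
    using IJ by blast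
qed

end
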